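(* Let $\mathcal{T}$ be a tree with colouring structure $\mathscr{C}=(L,\ell,\mathcal{D},\operatorname{ccol})$ and a patterning $\mathscr{P}=(L,\ell,\mathcal{D},\operatorname{ccol},\mathscr{F})$. Then $$\overline{D(\operatorname{AAut}_{\mathscr{P}}(\mathcal{T}))}=\overline{D(V_{\mathscr{C}})},$$ where closures are taken in $\operatorname{AAut}_{\mathscr{P}}(\mathcal{T})$, and this group is topologically simple.
   Context: For a group $G$, $D(G)$ denotes its commutator subgroup. A topological group is topologically simple if it has no closed normal subgroups other than itself and the trivial one. **Trees and almost automorphisms.** Let $\mathcal{T}=(\mathcal{V},\mathcal{E})$ be a locally finite tree with root $v_0$, edges oriented away from the root via $o,t\colon\mathcal{E}\to\mathcal{V}$ (so $t(e)$ is a child of $o(e)$). $\operatorname{Aut}(\mathcal{T})$ is the group of automorphisms of the rooted tree $\mathcal{T}$, with the topology of pointwise convergence. A finite subtree $T$ is complete if it contains $v_0$ and for each of its vertices contains all or none of its children. $\mathcal{L}T$ denotes the set of leaves of $T$ (vertices without children in $T$), $\mathcal{T}_v$ the subtree of all descendants of $v$ (rooted at $v$), and $\mathcal{T}\setminus T:=\bigsqcup_{v\in\mathcal{L}T}\mathcal{T}_v$. An honest almost automorphism is a forest isomorphism $\varphi\colon\mathcal{T}\setminus T_1\to\mathcal{T}\setminus T_2$ with $T_1,T_2$ finite complete subtrees. Two of them, with domains $\mathcal{T}\setminus T_1$ and $\mathcal{T}\setminus T_1'$, are equivalent if they coincide on $\mathcal{T}\setminus T$ for some finite complete $T\supset T_1\cup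 T_1'$. The equivalence classes are the almost automorphisms; they form a group $\operatorname{AAut}(\mathcal{T})$ under composition of suitable representatives. Automorphisms of $\mathcal{T}$ are regarded as almost automorphisms. **Colouring structures and patternings.** A colouring structure $\mathscr{C}=(L,\ell,\mathcal{D},\operatorname{ccol})$ on $\mathcal{T}$ consists of: a finite set $L$ of labels; a labelling $\ell\colon\mathcal{V}\setminus\{v_0\}\to L$ such that for any two vertices $v,w$ with $\ell(v)=\ell(w)$ there is a label-preserving bijection between the children of $v$ and the children of $w$, and such that for each $l\in L$ the set $\ell^{-1}(l)$ is not contained in any proper subtree of $\mathcal{T}$; a set $\mathcal{D}=\{D_{l,l'}\mid l,l'\in L\}$ of finite disjoint sets, $D_{l,l'}$ having the same cardinality as the set of children with label $l'$ of every vertex with label $l$; and a map $\operatorname{ccol}\colon\mathcal{E}\setminus o^{-1}(v_0)\to\bigsqcup_{l,l'}D_{l,l'}$ which for every $v\neq v_0$ with $\ell(v)=l$ and every $l'$ restricts to a bijection $\{e\in\mathcal{E}\mid o(e)=v,\ \ell(t(e))=l'\}\to D_{l,l'}$. Put $D_l=\bigsqcup_{l'}D_{l,l'}$. A patterning $\mathscr{P}=(L,\ell,\mathcal{D},\operatorname{ccol},\mathscr{F})$ is a colouring structure together with a set of permutation groups $\mathscr{F}=\{F_l\le\operatorname{Sym}(D_l)\mid l\in L\}$ that preserve the partition $D_l=\bigsqcup_{l'}D_{l,l'}$ (each $D_{l,l'}$ is mapped to itself). For an honest almost automorphism $\varphi\colon\mathcal{T}\setminus T_1\to\mathcal{T}\setminus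 T_2$ and a vertex $v$ of $\mathcal{T}\setminus T_1$, the local permutation of $\varphi$ at $v$ is $\operatorname{prm}_{\varphi,v}:=\operatorname{ccol}\circ\varphi\circ\operatorname{ccol}^{-1}|_{D_{\ell(v)}}\colon D_{\ell(v)}\to D_{\ell(\varphi(v))}$ (with $\operatorname{ccol}^{-1}$ taken on the edges with origin $v$). $\varphi$ is child colour preserving if $\operatorname{ccol}(\varphi(e))=\operatorname{ccol}(e)$ for every edge $e\notin o^{-1}(v_0)$ of $\mathcal{T}\setminus T_1$; it is $\mathscr{P}$-patterning if $\ell(\varphi(v))=\ell(v)$ for all $v\in\mathcal{L}T_1$ and $\operatorname{prm}_{\varphi,v}\in F_{\ell(v)}$ for all vertices $v$ of $\mathcal{T}\setminus T_1$. $V_{\mathscr{C}}$, respectively $\operatorname{AAut}_{\mathscr{P}}(\mathcal{T})$, is the set of almost automorphisms admitting a child colour preserving, respectively $\mathscr{P}$-patterning, representative; both are groups. $\operatorname{Aut}_{\mathscr{P}}(\mathcal{T}):=\operatorname{AAut}_{\mathscr{P}}(\mathcal{T})\cap\operatorname{Aut}(\mathcal{T})$. $\operatorname{AAut}_{\mathscr{P}}(\mathcal{T})$ carries the unique group topology for which $\operatorname{Aut}_{\mathscr{P}}(\mathcal{T})$, with its subspace topology from $\operatorname{Aut}(\mathcal{T})$, is an open subgroup.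
   Formalization: Added assumption: some vertex other than the root has at least two children. It excludes only the one-vertex tree, finite stars and finite unions of rays at the root; the claim fails for two rays (closure is Z) and for the star with four leaves (A_4). *)

theory Defs
  imports
    "HOL-Analysis.Function_Topology"
    "HOL-Analysis.Product_Topology"
    "HOL-Algebra.Generated_Groups"
    "HOL-Algebra.Bij"
begin

section \<open>Rooted trees\<close>

text \<open>
  An edge is the pair of its origin and its terminus: in a tree oriented away from its root, the
  maps o and t are \<^const>\<open>fst\<close> and \<^const>\<open>snd\<close>.
\<close>

record 'v rooted_tree =
  tverts :: "'v set"
  tedges :: "('v \<times> 'v) set"
  troot :: 'v

definition children :: "'v rooted_tree \<Rightarrow> 'v \<Rightarrow> 'v set" where
  "children T v = {w. (v, w) \<in> tedges T}"

definition descendants :: "'v rooted_tree \<Rightarrow> 'v \<Rightarrow> 'v set" where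
  "descendants T v = {w. (v, w) \<in> (tedges T)\<^sup>*}"

definition locally_finite_tree :: "'v rooted_tree \<Rightarrow> bool" where
  "locally_finite_tree T \<longleftrightarrow>
     troot T \<in> tverts T \<and>
     tedges T \<subseteq> tverts T \<times> tverts T \<and>
     (\<forall>u. (u, troot T) \<notin> tedges T) \<and>
     (\<forall>v \<in> tverts T - {troot T}. \<exists>!u. (u, v) \<in> tedges T) \<and>
     (\<forall>v \<in> tverts T. v \<in> descendants T (troot T)) \<and>
     (\<forall>v \<in> tverts T. finite (children T v))"

text \<open>
  A subtree is a non-empty connected subgraph, given by its set of vertices (connected subgraphs
  of a tree are induced). It need not contain the root.
\<close>

definition subtree :: "'v rooted_tree \<Rightarrow> 'v set \<Rightarrow> bool" where
  "subtree T S \<longleftrightarrow> S \<noteq> {} \<and> S \<subseteq> tverts T \<and>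
     (\<forall>x \<in> S. \<forall>y \<in> S. (x, y) \<in> ((tedges T \<union> (tedges T)\<inverse>) \<inter> S \<times> S)\<^sup>*)"

definition finite_complete_subtree :: "'v rooted_tree \<Rightarrow> 'v set \<Rightarrow> bool" where
  "finite_complete_subtree T S \<longleftrightarrow>
     subtree T S \<and> finite S \<and> troot T \<in> S \<and>
     (\<forall>v \<in> S. children T v \<subseteq> S \<or> children T v \<inter> S = {})"

definition leaves :: "'v rooted_tree \<Rightarrow> 'v set \<Rightarrow> 'v set" where
  "leaves T S = {v \<in> S. children T v \<inter> S = {}}"

text \<open>
  The vertices of the forest obtained from \<open>T\<close> by removing \<open>S\<close>. The leaves of \<open>S\<close>
  belong to it, as the roots of its components. Its edges are the edges of \<open>T\<close> with origin in it.
\<close>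

definition forest :: "'v rooted_tree \<Rightarrow> 'v set \<Rightarrow> 'v set" where
  "forest T S = (\<Union>v \<in> leaves T S. descendants T v)"


section \<open>Almost automorphisms\<close>

text \<open>
  An honest almost automorphism is a triple of the two removed finite complete subtrees and the
  isomorphism between the remaining forests, which is \<^const>\<open>undefined\<close> outside of its domain.
\<close>

type_synonym 'v honest = "'v set \<times> 'v set \<times> ('v \<Rightarrow> 'v)"

definition honest_almost_automorphisms :: "'v rooted_tree \<Rightarrow> 'v honest set" where
  "honest_almost_automorphisms T =
     {(S1, S2, \<phi>). finite_complete_subtree T S1 \<and> finite_complete_subtree T S2 \<and>
        \<phi> \<in> extensional (forest T S1) \<and>
        bij_betw \<phi> (forest T S1) (forest T S2) \<and>
        (\<forall>x \<in> forest T S1. \<forall>y \<in> forest T S1.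
           (x, y) \<in> tedges T \<longleftrightarrow> (\<phi> x, \<phi> y) \<in> tedges T)}"

definition honest_equiv :: "'v rooted_tree \<Rightarrow> ('v honest \<times> 'v honest) set" where
  "honest_equiv T =
     {((S1, S2, \<phi>), (S1', S2', \<phi>')).
        (S1, S2, \<phi>) \<in> honest_almost_automorphisms T \<and>
        (S1', S2', \<phi>') \<in> honest_almost_automorphisms T \<and>
        (\<exists>S. finite_complete_subtree T S \<and> S1 \<union> S1' \<subseteq> S \<and> (\<forall>x \<in> forest T S. \<phi> x = \<phi>' x))}"

definition almost_class :: "'v rooted_tree \<Rightarrow> 'v honest \<Rightarrow> 'v honest set" where
  "almost_class T p = honest_equiv T `` {p}"

text \<open>
  The product of two classes is the common class of all composites of a representative of the
  second with a representative of the first whose domain is the image of the former.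
\<close>

definition AAut :: "'v rooted_tree \<Rightarrow> 'v honest set monoid" where
  "AAut T =
     \<lparr>carrier = honest_almost_automorphisms T // honest_equiv T,
      mult = (\<lambda>A B. \<Union> {almost_class T (S1, S3, compose (forest T S1) \<phi> \<psi>) | S1 S2 S3 \<phi> \<psi>.
                          (S1, S2, \<psi>) \<in> B \<and> (S2, S3, \<phi>) \<in> A}),
      one = almost_class T ({troot T}, {troot T}, \<lambda>x \<in> tverts T. x)\<rparr>"

definition tree_automorphisms :: "'v rooted_tree \<Rightarrow> ('v \<Rightarrow> 'v) set" where
  "tree_automorphisms T =
     {\<alpha> \<in> Bij (tverts T). \<alpha> (troot T) = troot T \<and>
        (\<forall>x \<in> tverts T. \<forall>y \<in> tverts T. (x, y) \<in> tedges T \<longleftrightarrow> (\<alpha> x, \<alpha> y) \<in> tedges T)}"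

definition aut_topology :: "'v rooted_tree \<Rightarrow> ('v \<Rightarrow> 'v) topology" where
  "aut_topology T =
     subtopology (product_topology (\<lambda>_. discrete_topology (tverts T)) (tverts T))
       (tree_automorphisms T)"

definition aut_to_almost :: "'v rooted_tree \<Rightarrow> ('v \<Rightarrow> 'v) \<Rightarrow> 'v honest set" where
  "aut_to_almost T \<alpha> = almost_class T ({troot T}, {troot T}, \<alpha>)"


section \<open>Colouring structures and patternings\<close>

text \<open>
  The value of \<open>lab\<close> at the root, and the values of \<open>ccol\<close> at the edges with origin the
  root, carry no meaning and are never used.
\<close>

record ('v, 'l, 'c) colouring =
  labels :: "'l set"
  lab :: "'v \<Rightarrow> 'l"
  cols :: "'l \<Rightarrow> 'l \<Rightarrow> 'c set"
  ccol :: "'v \<times> 'v \<Rightarrow> 'c"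

definition all_cols :: "('v, 'l, 'c) colouring \<Rightarrow> 'l \<Rightarrow> 'c set" where
  "all_cols C l = (\<Union>l' \<in> labels C. cols C l l')"

definition colouring_structure :: "'v rooted_tree \<Rightarrow> ('v, 'l, 'c) colouring \<Rightarrow> bool" where
  "colouring_structure T C \<longleftrightarrow>
     finite (labels C) \<and>
     (\<forall>v \<in> tverts T - {troot T}. lab C v \<in> labels C) \<and>
     (\<forall>v \<in> tverts T - {troot T}. \<forall>w \<in> tverts T - {troot T}. lab C v = lab C w \<longrightarrow>
        (\<exists>f. bij_betw f (children T v) (children T w) \<and>
             (\<forall>x \<in> children T v. lab C (f x) = lab C x))) \<and>
     (\<forall>l \<in> labels C. \<not> (\<exists>S. subtree T S \<and> S \<noteq> tverts T \<and>
        {v \<in> tverts T - {troot T}. lab C v = l} \<subseteq> S)) \<and>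
     (\<forall>l \<in> labels C. \<forall>l' \<in> labels C. finite (cols C l l')) \<and>
     (\<forall>l \<in> labels C. \<forall>l' \<in> labels C. \<forall>m \<in> labels C. \<forall>m' \<in> labels C.
        (l, l') \<noteq> (m, m') \<longrightarrow> cols C l l' \<inter> cols C m m' = {}) \<and>
     (\<forall>v \<in> tverts T - {troot T}. \<forall>l' \<in> labels C.
        card (cols C (lab C v) l') = card {w \<in> children T v. lab C w = l'}) \<and>
     (\<forall>v \<in> tverts T - {troot T}. \<forall>l' \<in> labels C.
        bij_betw (ccol C) {e \<in> tedges T. fst e = v \<and> lab C (snd e) = l'} (cols C (lab C v) l'))"

definition patterning ::
  "'v rooted_tree \<Rightarrow> ('v, 'l, 'c) colouring \<Rightarrow> ('l \<Rightarrow> ('c \<Rightarrow> 'c) set) \<Rightarrow> bool" where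
  "patterning T C F \<longleftrightarrow> colouring_structure T C \<and>
     (\<forall>l \<in> labels C. subgroup (F l) (BijGroup (all_cols C l)) \<and>
        (\<forall>f \<in> F l. \<forall>l' \<in> labels C. f ` cols C l l' = cols C l l'))"

definition local_permutation ::
  "'v rooted_tree \<Rightarrow> ('v, 'l, 'c) colouring \<Rightarrow> ('v \<Rightarrow> 'v) \<Rightarrow> 'v \<Rightarrow> ('c \<Rightarrow> 'c)" where
  "local_permutation T C \<phi> v =
     (\<lambda>d \<in> all_cols C (lab C v).
        ccol C (map_prod \<phi> \<phi> (inv_into {e \<in> tedges T. fst e = v} (ccol C) d)))"

definition child_colour_preserving ::
  "'v rooted_tree \<Rightarrow> ('v, 'l, 'c) colouring \<Rightarrow> 'v honest \<Rightarrow> bool" where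
  "child_colour_preserving T C = (\<lambda>(S1, S2, \<phi>).
     \<forall>e \<in> tedges T. fst e \<in> forest T S1 - {troot T} \<longrightarrow> ccol C (map_prod \<phi> \<phi> e) = ccol C e)"

text \<open>
  The root belongs to the forest only when \<open>S1\<close> is the single vertex \<open>troot T\<close>. It is left
  out since it has neither a label nor a local permutation.
\<close>

definition honest_patterning ::
  "'v rooted_tree \<Rightarrow> ('v, 'l, 'c) colouring \<Rightarrow> ('l \<Rightarrow> ('c \<Rightarrow> 'c) set) \<Rightarrow> 'v honest \<Rightarrow> bool" where
  "honest_patterning T C F = (\<lambda>(S1, S2, \<phi>).
     (\<forall>v \<in> leaves T S1 - {troot T}. lab C (\<phi> v) = lab C v) \<and>
     (\<forall>v \<in> forest T S1 - {troot T}. local_permutation T C \<phi> v \<in> F (lab C v)))"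

definition V_group :: "'v rooted_tree \<Rightarrow> ('v, 'l, 'c) colouring \<Rightarrow> 'v honest set set" where
  "V_group T C = {A \<in> carrier (AAut T). \<exists>p \<in> A. child_colour_preserving T C p}"

definition AAut_pat ::
  "'v rooted_tree \<Rightarrow> ('v, 'l, 'c) colouring \<Rightarrow> ('l \<Rightarrow> ('c \<Rightarrow> 'c) set) \<Rightarrow> 'v honest set monoid" where
  "AAut_pat T C F =
     AAut T\<lparr>carrier := {A \<in> carrier (AAut T). \<exists>p \<in> A. honest_patterning T C F p}\<rparr>"

definition Aut_pat ::
  "'v rooted_tree \<Rightarrow> ('v, 'l, 'c) colouring \<Rightarrow> ('l \<Rightarrow> ('c \<Rightarrow> 'c) set) \<Rightarrow> 'v honest set set" where
  "Aut_pat T C F = carrier (AAut_pat T C F) \<inter> aut_to_almost T ` tree_automorphisms T"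


section \<open>Topological groups\<close>

definition topological_group :: "('a, 'b) monoid_scheme \<Rightarrow> 'a topology \<Rightarrow> bool" where
  "topological_group G X \<longleftrightarrow> group G \<and> topspace X = carrier G \<and>
     continuous_map (prod_topology X X) X (\<lambda>(x, y). x \<otimes>\<^bsub>G\<^esub> y) \<and>
     continuous_map X X (\<lambda>x. inv\<^bsub>G\<^esub> x)"

definition topologically_simple :: "('a, 'b) monoid_scheme \<Rightarrow> 'a topology \<Rightarrow> bool" where
  "topologically_simple G X \<longleftrightarrow> topological_group G X \<and>
     (\<forall>N. N \<lhd> G \<and> closedin X N \<longrightarrow> N = carrier G \<or> N = {\<one>\<^bsub>G\<^esub>})"

text \<open>
  The homeomorphism condition says that the topology induced on \<^const>\<open>Aut_pat\<close> is the subspace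
  topology from the automorphism group of the tree.
\<close>

definition AAut_pat_topology ::
  "'v rooted_tree \<Rightarrow> ('v, 'l, 'c) colouring \<Rightarrow> ('l \<Rightarrow> ('c \<Rightarrow> 'c) set) \<Rightarrow>
     'v honest set topology" where
  "AAut_pat_topology T C F =
     (THE X. topological_group (AAut_pat T C F) X \<and>
        openin X (Aut_pat T C F) \<and>
        homeomorphic_map
          (subtopology (aut_topology T)
             {\<alpha> \<in> tree_automorphisms T. aut_to_almost T \<alpha> \<in> Aut_pat T C F})
          (subtopology X (Aut_pat T C F))
          (aut_to_almost T))"

end

theory Submission
  imports Defs "HOL-Combinatorics.Permutations"
begin

text \<open>
  The proof replaces almost automorphisms by the permutations of the space of ends of the tree that
  they induce. Below every vertex the tree branches, since the label of a branching vertex recurs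
  everywhere; therefore an almost automorphism can be recovered from its action on the ends
  (\<open>honest_equiv_iff\<close>). The permutations that arise are those that restrict to tree
  isomorphisms between the branches below the vertices of some depth and their images
  (\<open>ex_representative\<close>, \<open>mult_AAut\<close>), and patterned almost automorphisms correspond
  to those which in addition respect labels and have their local permutations in the pattern. Child
  colour preserving almost automorphisms are the patterned ones for the trivial permutation groups.

  The elements of the group that are induced by automorphisms fixing large balls are a neighbourhood
  base of the identity for a group topology (\<open>ball_fixing_conj\<close>), and a group topology is determined by
  its restriction to an open subgroup, so this is the topology in question
  (\<open>AAut_pat_topology_eq\<close>). The colour preserving group \<open>V\<close> is dense: on the branch below each vertex of a
  large sphere, a patterned element can be replaced by the canonical colour preserving isomorphism
  onto the same image (\<open>ex_colour_preserving_approximation\<close>). As commutators depend continuously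
  on their entries, the derived groups of \<open>V\<close> and of the whole group have the same closure \<open>N\<close>.

  For simplicity it is enough that every nontrivial subgroup \<open>K\<close> normalized by the derived group
  of \<open>V\<close> contains that derived group (\<open>derived_subset_if_normalized\<close>): if \<open>K\<close> is also closed and
  lies in \<open>N\<close>, it equals \<open>N\<close>. This is an argument about groups acting on a Cantor space in which
  clopen sets can be compressed into each other. A nontrivial element displaces a clopen set \<open>U\<close>, and
  double commutators show that \<open>K\<close> contains all commutators of pairs of elements of the derived
  group that are supported in \<open>U\<close>. Conjugating by the derived group, \<open>K\<close> contains the commutators of all
  pairs with a common proper support. These generate a group \<open>E\<close> that is normal in \<open>V\<close>, and the action of \<open>V\<close>
  on a proper clopen set can be imitated by \<open>E\<close> through 3-cycles of clopen sets. So modulo \<open>E\<close> any two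
  elements of \<open>V\<close> can be given disjoint supports, whence they commute; so \<open>E\<close>, and with
  it \<open>K\<close>, contains the derived group of \<open>V\<close>. The required exchanges of clopen sets exist in \<open>V\<close> because each label
  occurs below every vertex (\<open>ex_swap\<close>, \<open>ex_compression\<close>).
\<close>

section \<open>Groups acting with swaps and compressions\<close>

text \<open>
  In the application \<open>X\<close> is the space of ends of a tree and \<open>B\<close> consists of its clopen subsets.
  The last two assumptions are all that is needed of the fact that a homeomorphism which is
  piecewise in \<open>V\<close> belongs to \<open>V\<close>: an element that displaces a clopen set can be cut down to
  one that does the same on this set but moves nothing outside of the set and its image, and a clopen set fits into every disjoint nonempty one.
\<close>

locale vigorous_action = group G for G (structure) +
  fixes act :: "'a \<Rightarrow> 'x \<Rightarrow> 'x"
    and X :: "'x set"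
    and B :: "'x set set"
    and V :: "'a set"
  assumes act_permutes: "g \<in> carrier G \<Longrightarrow> act g permutes X"
    and act_mult: "\<lbrakk>g \<in> carrier G; h \<in> carrier G\<rbrakk> \<Longrightarrow> act (g \<otimes> h) = act g \<circ> act h"
    and act_inj: "inj_on act (carrier G)"
    and subgroup_V: "subgroup V G"
    and B_space: "X \<in> B"
    and B_subset: "U \<in> B \<Longrightarrow> U \<subseteq> X"
    and B_Diff: "\<lbrakk>U \<in> B; W \<in> B\<rbrakk> \<Longrightarrow> U - W \<in> B"
    and B_image: "\<lbrakk>a \<in> V; U \<in> B\<rbrakk> \<Longrightarrow> act a ` U \<in> B"
    and split: "\<lbrakk>U \<in> B; U \<noteq> {}\<rbrakk> \<Longrightarrow> \<exists>W \<in> B. W \<noteq> {} \<and> W \<subset> U"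
    and swap: "\<lbrakk>a \<in> V; U \<in> B; act a ` U \<inter> U = {}\<rbrakk> \<Longrightarrow>
      \<exists>s \<in> V. (\<forall>x \<in> U. act s x = act a x) \<and> (\<forall>x. x \<notin> U \<union> act a ` U \<longrightarrow> act s x = x)"
    and compress_disjoint: "\<lbrakk>U \<in> B; W \<in> B; W \<noteq> {}; U \<inter> W = {}\<rbrakk> \<Longrightarrow> \<exists>c \<in> V. act c ` U \<subseteq> W"
begin

lemma V_carrier: "a \<in> V \<Longrightarrow> a \<in> carrier G"
  using subgroup.subset[OF subgroup_V] by blast

lemma B_Un: assumes "U \<in> B" "W \<in> B" shows "U \<union> W \<in> B"
proof -
  have "U \<union> W = X - ((X - U) - W)"
    using B_subset assms by blast
  then show ?thesis
    using B_Diff B_space assms by simp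
qed

lemma act_eq_iff:
  assumes "g \<in> carrier G"
  shows "act g x = act g y \<longleftrightarrow> x = y"
  using permutes_inj[OF act_permutes[OF assms]] by (auto simp: inj_def)

lemma act_one: "act \<one> = id"
proof
  fix x
  have "act \<one> (act \<one> x) = act \<one> x"
    using act_mult[OF one_closed one_closed] by (simp add: fun_eq_iff)
  then show "act \<one> x = id x"
    using act_eq_iff[OF one_closed] by simp
qed

lemma act_mult_apply:
  "\<lbrakk>g \<in> carrier G; h \<in> carrier G\<rbrakk> \<Longrightarrow> act (g \<otimes> h) x = act g (act h x)"
  by (simp add: act_mult)

lemma act_inv_act: assumes "g \<in> carrier G" shows "act (inv g) (act g x) = x"
  using act_mult_apply[of "inv g" g x] assms by (simp add: act_one)

lemma act_act_inv: assumes "g \<in> carrier G" shows "act g (act (inv g) x) = x"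
  using act_mult_apply[of g "inv g" x] assms by (simp add: act_one)

lemma eq_if_act_eq:
  "\<lbrakk>g \<in> carrier G; h \<in> carrier G; \<And>x. act g x = act h x\<rbrakk> \<Longrightarrow> g = h"
  using act_inj by (auto simp: inj_on_def fun_eq_iff)

definition supported :: "'a \<Rightarrow> 'x set \<Rightarrow> bool" where
  "supported g S \<longleftrightarrow> (\<forall>x. x \<notin> S \<longrightarrow> act g x = x)"

lemma supported_mono: "\<lbrakk>supported g S; S \<subseteq> S'\<rbrakk> \<Longrightarrow> supported g S'"
  by (auto simp: supported_def)

lemma supported_stable:
  assumes "g \<in> carrier G" "supported g S" "x \<in> S"
  shows "act g x \<in> S"
  using assms act_eq_iff[OF assms(1), of "act g x" x] by (auto simp: supported_def)

lemma supported_inv: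
  assumes "g \<in> carrier G" "supported g S"
  shows "supported (inv g) S"
  unfolding supported_def
  using assms act_inv_act[OF assms(1)] by (metis supported_def)

lemma supported_mult:
  "\<lbrakk>g \<in> carrier G; h \<in> carrier G; supported g S; supported h S\<rbrakk> \<Longrightarrow> supported (g \<otimes> h) S"
  by (auto simp: supported_def act_mult_apply)

lemma supported_conj:
  assumes "g \<in> carrier G" "a \<in> carrier G" "supported a S"
  shows "supported (g \<otimes> a \<otimes> inv g) (act g ` S)"
  unfolding supported_def
proof (intro allI impI)
  fix x assume "x \<notin> act g ` S"
  then have "act (inv g) x \<notin> S"
    using act_act_inv[OF assms(1), of x] by (metis imageI)
  then show "act (g \<otimes> a \<otimes> inv g) x = x"
    using assms by (simp add: act_mult_apply supported_def act_act_inv)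
qed

text \<open>
  The action is faithful, so this can be tested on points.
\<close>

lemma disjoint_supports_commute:
  assumes "g \<in> carrier G" "h \<in> carrier G" "supported g S" "supported h S'" "S \<inter> S' = {}"
  shows "g \<otimes> h = h \<otimes> g"
proof (rule eq_if_act_eq)
  fix x
  show "act (g \<otimes> h) x = act (h \<otimes> g) x"
    using assms supported_stable[of g S x] supported_stable[of h S' x]
    by (auto simp: act_mult_apply) (metis disjoint_iff supported_def)
qed (use assms in auto)

definition commutator :: "'a \<Rightarrow> 'a \<Rightarrow> 'a" where
  "commutator a b = a \<otimes> b \<otimes> inv a \<otimes> inv b"

lemma commutator_closed [simp]:
  "\<lbrakk>a \<in> carrier G; b \<in> carrier G\<rbrakk> \<Longrightarrow> commutator a b \<in> carrier G"
  by (simp add: commutator_def)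

lemma commutator_in_derived: "\<lbrakk>a \<in> H; b \<in> H\<rbrakk> \<Longrightarrow> commutator a b \<in> derived G H"
  unfolding derived_def commutator_def by (rule generate.incl) blast

lemma conj_commutator:
  assumes "g \<in> carrier G" "a \<in> carrier G" "b \<in> carrier G"
  shows "g \<otimes> commutator a b \<otimes> inv g = commutator (g \<otimes> a \<otimes> inv g) (g \<otimes> b \<otimes> inv g)"
proof -
  have cancel: "inv g \<otimes> (g \<otimes> y) = y" if "y \<in> carrier G" for y
    using assms that by (simp flip: m_assoc)
  show ?thesis
    using assms by (simp add: commutator_def inv_mult_group m_assoc cancel)
qed

text \<open>
  A pair with a common proper support can be squeezed into any prescribed clopen set. This is why
  these commutators, in contrast to arbitrary ones, can be reached by a nontrivial normal subgroup.
\<close>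

definition local_commutators :: "'a set \<Rightarrow> 'a set" where
  "local_commutators H =
     {commutator a b | a b. a \<in> H \<and> b \<in> H \<and> (\<exists>S \<in> B. S \<noteq> X \<and> supported a S \<and> supported b S)}"

text \<open>
  Elements of \<open>H\<close> imitate \<open>a\<close> on a set that it displaces, at the cost of disturbing only a spare
  region \<open>R\<close> that may be chosen at will. The spare region makes the property pass from \<open>H\<close> to the
  local commutators of \<open>H\<close>.
\<close>

definition extends_partial :: "'a set \<Rightarrow> bool" where
  "extends_partial H \<longleftrightarrow>
     (\<forall>a \<in> V. \<forall>U \<in> B. \<forall>R \<in> B. R \<noteq> {} \<longrightarrow> U \<inter> act a ` U = {} \<longrightarrow> R \<inter> (U \<union> act a ` U) = {} \<longrightarrow>
       (\<exists>e \<in> H. (\<forall>x \<in> U. act e x = act a x) \<and> supported e (U \<union> act a ` U \<union> R)))"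

lemma extends_partialD:
  assumes "extends_partial H" "a \<in> V" "U \<in> B" "R \<in> B" "R \<noteq> {}"
    "U \<inter> act a ` U = {}" "R \<inter> (U \<union> act a ` U) = {}"
  shows "\<exists>e \<in> H. (\<forall>x \<in> U. act e x = act a x) \<and> supported e (U \<union> act a ` U \<union> R)"
  using assms(1)[unfolded extends_partial_def, rule_format, OF assms(2-7)] .

lemma extends_partial_V: "extends_partial V"
  unfolding extends_partial_def
proof (intro ballI impI)
  fix a U R
  assume "a \<in> V" "U \<in> B" "U \<inter> act a ` U = {}"
  then obtain s where "s \<in> V" "\<forall>x \<in> U. act s x = act a x"
      "\<forall>x. x \<notin> U \<union> act a ` U \<longrightarrow> act s x = x"
    using swap[of a U] by (auto simp: Int_commute)
  then show "\<exists>e \<in> V. (\<forall>x \<in> U. act e x = act a x) \<and> supported e (U \<union> act a ` U \<union> R)"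
    by (intro bexI[of _ s]) (auto simp: supported_def)
qed

lemma split2:
  assumes "R \<in> B" "R \<noteq> {}"
  obtains R1 R2 where "R1 \<in> B" "R2 \<in> B" "R1 \<noteq> {}" "R2 \<noteq> {}" "R1 \<inter> R2 = {}" "R1 \<union> R2 = R"
proof -
  obtain W where W: "W \<in> B" "W \<noteq> {}" "W \<subset> R"
    using split[OF assms] by blast
  show thesis
    by (rule that[of W "R - W"]) (use W assms B_Diff in auto)
qed

text \<open>
  If \<open>W\<close> lies inside \<open>U\<close>, then \<open>U\<close> is first moved off itself into its complement; from there
  \<open>W\<close> is a disjoint target.
\<close>

lemma compress:
  assumes "U \<in> B" "U \<noteq> X" "W \<in> B" "W \<noteq> {}"
  shows "\<exists>c \<in> V. act c ` U \<subseteq> W"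
proof (cases "W - U = {}")
  case False
  then show ?thesis
    using compress_disjoint[of U "W - U"] assms B_Diff by blast
next
  case True
  have "X - U \<noteq> {}" "X - U \<in> B"
    using assms B_subset B_Diff B_space by auto
  then obtain c where c: "c \<in> V" "act c ` U \<subseteq> X - U"
    using compress_disjoint[of U "X - U"] assms by blast
  then obtain d where d: "d \<in> V" "act d ` (act c ` U) \<subseteq> W"
    using compress_disjoint[of "act c ` U" W] assms True B_image by blast
  have "act (d \<otimes> c) ` U \<subseteq> W"
    using c d V_carrier by (auto simp: act_mult_apply)
  then show ?thesis
    using c(1) d(1) subgroup.m_closed[OF subgroup_V] by blast
qed

text \<open>
  A 3-cycle is a commutator of two transpositions. Let \<open>s\<close> imitate \<open>a\<close> on \<open>U\<close>, and let \<open>h\<close> move \<open>U\<close>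
  into the spare region, off the support of \<open>s\<close>. Then \<open>inv h \<otimes> inv s \<otimes> h\<close> fixes \<open>U\<close> pointwise, so
  the commutator of \<open>s\<close> and \<open>inv h\<close> still imitates \<open>a\<close> on \<open>U\<close>. A part \<open>R4\<close> of the region stays
  untouched and makes the common support proper.
\<close>

lemma extends_partial_local_commutators:
  assumes H: "extends_partial H" "subgroup H G"
  shows "extends_partial (local_commutators H)"
  unfolding extends_partial_def
proof (intro ballI impI)
  fix a U R
  assume a: "a \<in> V" and U: "U \<in> B" and R: "R \<in> B" "R \<noteq> {}"
    and UaU: "U \<inter> act a ` U = {}" and RU: "R \<inter> (U \<union> act a ` U) = {}"
  obtain Ra Rb where 1: "Ra \<in> B" "Rb \<in> B" "Ra \<noteq> {}" "Rb \<noteq> {}" "Ra \<inter> Rb = {}" "Ra \<union> Rb = R"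
    using split2 R by metis
  obtain R1 R2 where 2: "R1 \<in> B" "R2 \<in> B" "R1 \<noteq> {}" "R2 \<noteq> {}" "R1 \<inter> R2 = {}" "R1 \<union> R2 = Ra"
    using split2 1 by metis
  obtain R3 R4 where 3: "R3 \<in> B" "R4 \<in> B" "R3 \<noteq> {}" "R4 \<noteq> {}" "R3 \<inter> R4 = {}" "R3 \<union> R4 = Rb"
    using split2 1 by metis
  have "R1 \<inter> (U \<union> act a ` U) = {}"
    using RU 1(6) 2(6) by blast
  then obtain s where s: "s \<in> H" "\<forall>x \<in> U. act s x = act a x"
      "supported s (U \<union> act a ` U \<union> R1)"
    using extends_partialD[OF H(1) a U 2(1,3) UaU] by blast
  have "U \<noteq> X"
    using RU R B_subset by blast
  then obtain c where c: "c \<in> V" "act c ` U \<subseteq> R2"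
    using compress[OF U _ 2(2,4)] by blast
  have "U \<inter> act c ` U = {}" "R3 \<inter> (U \<union> act c ` U) = {}"
    using c(2) RU 1(5,6) 2(6) 3(6) by blast+
  then obtain h where h: "h \<in> H" "\<forall>x \<in> U. act h x = act c x"
      "supported h (U \<union> act c ` U \<union> R3)"
    using extends_partialD[OF H(1) c(1) U 3(1,3)] by blast
  have sG: "s \<in> carrier G" and hG: "h \<in> carrier G"
    using s h subgroup.subset[OF H(2)] by auto
  define S where "S = U \<union> act a ` U \<union> R1 \<union> R2 \<union> R3"
  have S: "S \<in> B"
    unfolding S_def using U 2 3 B_image[OF a U] by (simp add: B_Un)
  have "R4 \<inter> S = {}"
    unfolding S_def using RU 1(5,6) 2(6) 3(5,6) by auto
  then have "S \<noteq> X"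
    using 3(4) B_subset[OF 3(2)] by auto
  moreover have "supported s S"
    using s(3) by (rule supported_mono) (auto simp: S_def)
  moreover have "supported (inv h) S"
    using supported_inv[OF hG h(3)] by (rule supported_mono) (use c(2) in \<open>auto simp: S_def\<close>)
  moreover note suppS = calculation(2,3)
  moreover have "supported h S"
    using supported_inv[OF _ suppS(2)] hG by simp
  note suppS = suppS this
  ultimately have mem: "commutator s (inv h) \<in> local_commutators H"
    unfolding local_commutators_def using s h S subgroup.m_inv_closed[OF H(2)] by blast
  have eq: "act (commutator s (inv h)) x = act a x" if "x \<in> U" for x
  proof -
    have "act h x \<in> R2"
      using that c h by auto
    then have "act h x \<notin> U \<union> act a ` U \<union> R1"
      using RU 1(6) 2(5,6) by blast
    then have "act (inv s) (act h x) = act h x"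
      using supported_inv[OF sG s(3)] by (auto simp: supported_def)
    then show ?thesis
      using sG hG s(2) that by (simp add: commutator_def act_mult_apply act_inv_act)
  qed
  have supp: "supported (commutator s (inv h)) (U \<union> act a ` U \<union> R)"
    unfolding commutator_def
  proof (rule supported_mono[of _ S])
    show "supported (s \<otimes> inv h \<otimes> inv s \<otimes> inv (inv h)) S"
      using sG hG suppS supported_inv[OF sG suppS(1)] by (intro supported_mult) auto
    show "S \<subseteq> U \<union> act a ` U \<union> R"
      using 1 2 3 by (auto simp: S_def)
  qed
  show "\<exists>e \<in> local_commutators H. (\<forall>x \<in> U. act e x = act a x) \<and> supported e (U \<union> act a ` U \<union> R)"
    using mem eq supp by blast
qed

lemma extends_partial_mono: "\<lbrakk>extends_partial H; H \<subseteq> H'\<rbrakk> \<Longrightarrow> extends_partial H'"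
  unfolding extends_partial_def by (meson subsetD)

lemma local_commutators_subset_derived: "local_commutators H \<subseteq> derived G H"
  by (auto simp: local_commutators_def commutator_in_derived)

text \<open>
  These are the waypoints for the next lemma: disjoint sets, each leaving room in its container and
  together leaving room in \<open>X\<close>.
\<close>

lemma two_rooms:
  assumes "Y \<in> B" "Y \<noteq> {}" "Z \<in> B" "Z \<noteq> {}"
  obtains Q R where "Q \<in> B" "R \<in> B" "Q \<noteq> {}" "R \<noteq> {}" "Q \<inter> R = {}" "Q \<subset> Y" "R \<subset> Z"
    "X - Q - R \<noteq> {}"
proof -
  obtain P P' where P: "P \<in> B" "P' \<in> B" "P \<noteq> {}" "P' \<noteq> {}" "P \<inter> P' = {}" "P \<union> P' = Y"
    using split2[OF assms(1,2)] by metis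
  obtain A A' where A: "A \<in> B" "A' \<in> B" "A \<noteq> {}" "A' \<noteq> {}" "A \<inter> A' = {}" "A \<union> A' = Z"
    using split2[OF assms(3,4)] by metis
  obtain C C' where C: "C \<in> B" "C' \<in> B" "C \<noteq> {}" "C' \<noteq> {}" "C \<inter> C' = {}" "C \<union> C' = A"
    using split2[OF A(1,3)] by metis
  show thesis
  proof (cases "P - C = {}")
    case True
    have "A' \<subseteq> X - P - C'"
      using True A(5) C(6) B_subset[OF A(2)] by auto
    then have "X - P - C' \<noteq> {}"
      using A(4) by blast
    moreover have "P \<inter> C' = {}"
      using True C(5) by blast
    moreover have "P \<subset> Y" "C' \<subset> Z"
      using P(4-6) C(3,5,6) A(6) by blast+
    ultimately show thesis
      using that[OF P(1) C(2) P(3) C(4)] by blast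
  next
    case False
    then obtain D D' where D: "D \<in> B" "D' \<in> B" "D \<noteq> {}" "D' \<noteq> {}" "D \<inter> D' = {}"
        "D \<union> D' = P - C"
      using split2[OF B_Diff[OF P(1) C(1)]] by metis
    have "D' \<subseteq> X - D - C"
      using D(5,6) B_subset[OF D(2)] by auto
    then have "X - D - C \<noteq> {}"
      using D(4) by blast
    moreover have "D \<inter> C = {}"
      using D(6) by blast
    moreover have "D \<subset> Y" "C \<subset> Z"
      using P(6) D(4-6) C(4-6) A(6) by blast+
    ultimately show thesis
      using that[OF D(1) C(1) D(3) C(3)] by blast
  qed
qed

text \<open>
  The element \<open>a\<close> need not displace \<open>U\<close>, and \<open>U\<close> together with its image may be everything. So
  \<open>U\<close> travels to its image in three steps, through a set \<open>Q1\<close> outside \<open>U\<close> and a set \<open>Q2\<close> outside the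
  image; every step displaces the travelling set and leaves spare room.
\<close>

lemma extends_global:
  assumes H: "extends_partial H" "subgroup H G" and a: "a \<in> V" and U: "U \<in> B" "U \<noteq> X"
  shows "\<exists>e \<in> H. \<forall>x \<in> U. act e x = act a x"
proof -
  have aG: "a \<in> carrier G"
    using a V_carrier by blast
  have aU: "act a ` U \<in> B" "act a ` U \<noteq> X"
  proof -
    show "act a ` U \<in> B"
      using B_image a U by blast
    have "act a ` X = X"
      by (rule permutes_image[OF act_permutes[OF aG]])
    then show "act a ` U \<noteq> X"
      using U(2) inj_image_eq_iff[OF permutes_inj[OF act_permutes[OF aG]], of U X] by simp
  qed
  have X: "X - U \<in> B" "X - U \<noteq> {}" "X - act a ` U \<in> B" "X - act a ` U \<noteq> {}"
    using U aU B_subset B_Diff B_space by auto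
  obtain Q1 Q2 where Q: "Q1 \<in> B" "Q2 \<in> B" "Q1 \<noteq> {}" "Q2 \<noteq> {}" "Q1 \<inter> Q2 = {}"
      "Q1 \<subset> X - U" "Q2 \<subset> X - act a ` U" "X - Q1 - Q2 \<noteq> {}"
    using two_rooms[OF X] by metis
  have room: "X - U - Q1 \<noteq> {}" "X - act a ` U - Q2 \<noteq> {}"
    using Q(6,7) by blast+
  obtain c where c: "c \<in> V" "act c ` U \<subseteq> Q1"
    using compress[OF U Q(1,3)] by blast
  obtain d where d: "d \<in> V" "act d ` U \<subseteq> Q2"
    using compress[OF U Q(2,4)] by blast
  have cG: "c \<in> carrier G" and dG: "d \<in> carrier G"
    using c d V_carrier by auto
  define dc where "dc = d \<otimes> inv c"
  define ad where "ad = a \<otimes> inv d"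
  have V: "dc \<in> V" "ad \<in> V"
    unfolding dc_def ad_def
    using a c d subgroup.m_closed[OF subgroup_V] subgroup.m_inv_closed[OF subgroup_V] by auto
  have act_dc: "act dc (act c x) = act d x" and act_ad: "act ad (act d x) = act a x" for x
    unfolding dc_def ad_def using aG cG dG by (simp_all add: act_mult_apply act_inv_act)
  have im: "act dc ` act c ` U = act d ` U" "act ad ` act d ` U = act a ` U"
    by (simp_all add: image_image act_dc act_ad)
  have "X - U - Q1 \<in> B" "X - Q1 - Q2 \<in> B" "X - act a ` U - Q2 \<in> B"
    using X Q B_Diff B_space by auto
  note R = this
  have "U \<inter> act c ` U = {}" "(X - U - Q1) \<inter> (U \<union> act c ` U) = {}"
    using c(2) Q(6) by blast+
  then obtain e1 where e1: "e1 \<in> H" "\<forall>x \<in> U. act e1 x = act c x"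
    using extends_partialD[OF H(1) c(1) U(1) R(1) room(1)] by blast
  have "act c ` U \<inter> act dc ` act c ` U = {}"
      "(X - Q1 - Q2) \<inter> (act c ` U \<union> act dc ` act c ` U) = {}"
    unfolding im using c(2) d(2) Q(5) by blast+
  then obtain e2 where e2: "e2 \<in> H" "\<forall>x \<in> act c ` U. act e2 x = act dc x"
    using extends_partialD[OF H(1) V(1) B_image[OF c(1) U(1)] R(2) Q(8)] by blast
  have "act d ` U \<inter> act ad ` act d ` U = {}"
      "(X - act a ` U - Q2) \<inter> (act d ` U \<union> act ad ` act d ` U) = {}"
    unfolding im using d(2) Q(7) by blast+
  then obtain e3 where e3: "e3 \<in> H" "\<forall>x \<in> act d ` U. act e3 x = act ad x"
    using extends_partialD[OF H(1) V(2) B_image[OF d(1) U(1)] R(3) room(2)] by blast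
  have G: "e1 \<in> carrier G" "e2 \<in> carrier G" "e3 \<in> carrier G"
    using e1 e2 e3 subgroup.subset[OF H(2)] by auto
  have "act (e3 \<otimes> e2 \<otimes> e1) x = act a x" if "x \<in> U" for x
    using that G e1(2) e2(2) e3(2) by (simp add: act_mult_apply act_dc act_ad)
  moreover have "e3 \<otimes> e2 \<otimes> e1 \<in> H"
    using e1 e2 e3 subgroup.m_closed[OF H(2)] by auto
  ultimately show ?thesis
    by blast
qed

lemma derived_conj_closed:
  assumes H: "subgroup H G" and p: "p \<in> derived G H" and g: "g \<in> H"
  shows "g \<otimes> p \<otimes> inv g \<in> derived G H"
proof -
  have D: "subgroup (derived G H) G"
    using derived_is_subgroup[OF subgroup.subset[OF H]] .
  have DH: "p \<in> H"
    using p derived_incl[OF subset_refl H] by blast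
  have G: "g \<in> carrier G" "p \<in> carrier G"
    using g DH subgroup.subset[OF H] by auto
  have "g \<otimes> p \<otimes> inv g = commutator g p \<otimes> p"
    using G by (simp add: commutator_def m_assoc)
  then show ?thesis
    using commutator_in_derived[OF g DH] p subgroup.m_closed[OF D] by simp
qed

lemma generate_conj_closed:
  assumes S: "S \<subseteq> carrier G" and g: "g \<in> carrier G" and x: "x \<in> generate G S"
    and conj: "\<And>s. s \<in> S \<Longrightarrow> g \<otimes> s \<otimes> inv g \<in> generate G S"
  shows "g \<otimes> x \<otimes> inv g \<in> generate G S"
proof -
  note sub = generate_is_subgroup[OF S]
  show ?thesis
    using x
  proof induction
    case one
    then show ?case using g generate.one by simp
  next
    case (incl h)
    then show ?case by (rule conj)
  next
    case (inv h)
    have "inv (g \<otimes> h \<otimes> inv g) \<in> generate G S"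
      using conj[OF inv] subgroup.m_inv_closed[OF sub] by blast
    then show ?case
      using g inv S by (simp add: inv_mult_group m_assoc subset_iff)
  next
    case (eng h1 h2)
    have G: "h1 \<in> carrier G" "h2 \<in> carrier G"
      using eng S generate_in_carrier by auto
    have "g \<otimes> (h1 \<otimes> h2) \<otimes> inv g = (g \<otimes> h1 \<otimes> inv g) \<otimes> (g \<otimes> h2 \<otimes> inv g)"
    proof -
      have "inv g \<otimes> (g \<otimes> y) = y" if "y \<in> carrier G" for y
        using g that by (simp flip: m_assoc)
      then show ?thesis
        using G g by (simp add: m_assoc)
    qed
    then show ?case
      using eng.IH subgroup.m_closed[OF sub] by simp
  qed
qed

lemma local_commutators_conj:
  assumes H: "subgroup H G" and g: "g \<in> V"
    and gH: "\<And>h. h \<in> H \<Longrightarrow> g \<otimes> h \<otimes> inv g \<in> H"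
    and x: "x \<in> local_commutators H"
  shows "g \<otimes> x \<otimes> inv g \<in> local_commutators H"
proof -
  obtain a b S where ab: "x = commutator a b" "a \<in> H" "b \<in> H" "S \<in> B" "S \<noteq> X"
      "supported a S" "supported b S"
    using x unfolding local_commutators_def by blast
  have G: "a \<in> carrier G" "b \<in> carrier G" "g \<in> carrier G"
    using ab g V_carrier subgroup.subset[OF H] by auto
  have "act g ` S \<noteq> X"
  proof
    assume "act g ` S = X"
    then have "act g ` S = act g ` X"
      using permutes_image[OF act_permutes[OF G(3)]] by simp
    then show False
      using ab(5) inj_image_eq_iff[OF permutes_inj[OF act_permutes[OF G(3)]]] by simp
  qed
  then show ?thesis
    unfolding local_commutators_def ab(1) conj_commutator[OF G(3,1,2)]
    using gH[OF ab(2)] gH[OF ab(3)] B_image[OF g ab(4)]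
      supported_conj[OF G(3,1) ab(6)] supported_conj[OF G(3,2) ab(7)] by blast
qed

text \<open>
  The generated group \<open>E\<close> is normal in \<open>V\<close>, and the quotient is abelian: modulo \<open>E\<close> two elements
  can be replaced by elements supported in disjoint sets, because by \<open>extends_global\<close> the group \<open>E\<close>
  contains an element that agrees with a given one on any proper clopen set.
\<close>

lemma derived_subset_local_commutators:
  assumes H: "subgroup H G" "H \<subseteq> V" and norm: "\<And>g h. \<lbrakk>g \<in> V; h \<in> H\<rbrakk> \<Longrightarrow> g \<otimes> h \<otimes> inv g \<in> H"
    and ext: "extends_partial H" and X: "X \<noteq> {}"
  shows "derived G V \<subseteq> generate G (local_commutators H)"
proof -
  have HG: "H \<subseteq> carrier G"
    using subgroup.subset[OF H(1)] .
  have lcG: "local_commutators H \<subseteq> carrier G"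
    unfolding local_commutators_def using HG by (blast intro: commutator_closed)
  define E where "E = generate G (local_commutators H)"
  have E: "subgroup E G"
    unfolding E_def by (rule generate_is_subgroup[OF lcG])
  have EV: "E \<subseteq> V"
    unfolding E_def
    by (rule generate_subgroup_incl[OF order_trans[OF local_commutators_subset_derived
      derived_incl[OF H(2) subgroup_V]] subgroup_V])
  have Econj: "g \<otimes> x \<otimes> inv g \<in> E" if "g \<in> V" "x \<in> E" for g x
    using that(2) unfolding E_def
  proof (rule generate_conj_closed[OF lcG V_carrier[OF that(1)]])
    fix s assume "s \<in> local_commutators H"
    then have "g \<otimes> s \<otimes> inv g \<in> local_commutators H"
      using local_commutators_conj[OF H(1) that(1) norm[OF that(1)]] by blast
    then show "g \<otimes> s \<otimes> inv g \<in> generate G (local_commutators H)"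
      by (rule generate.incl)
  qed
  have Eext: "extends_partial E"
    using extends_partial_local_commutators[OF ext H(1)]
    by (rule extends_partial_mono) (auto simp: E_def intro: generate.incl)
  obtain Q Q' where Q: "Q \<in> B" "Q' \<in> B" "Q \<noteq> {}" "Q' \<noteq> {}" "Q \<inter> Q' = {}" "Q \<union> Q' = X"
    using split2[OF B_space X] by metis
  \<comment> \<open>Modulo \<open>E\<close>, every element of \<open>V\<close> is trivial on a prescribed proper clopen set.\<close>
  have trim: "\<exists>e \<in> E. \<exists>a' \<in> V. a = e \<otimes> a' \<and> supported a' (X - R)"
    if a: "a \<in> V" and R: "R \<in> B" "R \<noteq> X" for a R
  proof -
    obtain e where e: "e \<in> E" "\<forall>x \<in> R. act e x = act a x"
      using extends_global[OF Eext E a R] by blast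
    have G: "e \<in> carrier G" "a \<in> carrier G"
      using e a EV V_carrier by auto
    have "supported (inv e \<otimes> a) (X - R)"
      unfolding supported_def
    proof (intro allI impI)
      fix x assume x: "x \<notin> X - R"
      show "act (inv e \<otimes> a) x = x"
      proof (cases "x \<in> R")
        case True
        then have "act a x = act e x"
          using e by simp
        then show ?thesis
          using G by (simp add: act_mult_apply act_inv_act)
      next
        case False
        then have "x \<notin> X"
          using x by blast
        then show ?thesis
          using permutes_not_in[OF act_permutes, of "inv e \<otimes> a" x] G by simp
      qed
    qed
    moreover have "inv e \<otimes> a \<in> V"
      using e a EV subgroup.m_closed[OF subgroup_V] subgroup.m_inv_closed[OF subgroup_V] by blast
    moreover have "a = e \<otimes> (inv e \<otimes> a)"
      using G by (simp flip: m_assoc)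
    ultimately show ?thesis
      using e(1) by blast
  qed
  have "commutator a b \<in> E" if ab: "a \<in> V" "b \<in> V" for a b
  proof -
    obtain e a' where a: "e \<in> E" "a' \<in> V" "a = e \<otimes> a'" "supported a' (X - Q)"
      using trim[OF ab(1) Q(1)] Q by blast
    obtain f b' where b: "f \<in> E" "b' \<in> V" "b = f \<otimes> b'" "supported b' (X - Q')"
      using trim[OF ab(2) Q(2)] Q by blast
    have G: "a' \<in> carrier G" "b' \<in> carrier G" "e \<in> carrier G" "f \<in> carrier G"
      using a b EV V_carrier by auto
    have comm: "a' \<otimes> b' = b' \<otimes> a'"
      using disjoint_supports_commute[OF G(1,2) a(4) b(4)] Q by blast
    have cancel: "inv x \<otimes> (x \<otimes> y) = y" "x \<otimes> (inv x \<otimes> y) = y"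
      if "x \<in> carrier G" "y \<in> carrier G" for x y
      using that by (simp_all flip: m_assoc)
    have "commutator a b =
        e \<otimes> (a' \<otimes> f \<otimes> inv a') \<otimes> (b' \<otimes> inv e \<otimes> inv b') \<otimes> inv f"
    proof -
      have "commutator a b = e \<otimes> a' \<otimes> f \<otimes> (b' \<otimes> inv a') \<otimes> inv e \<otimes> inv b' \<otimes> inv f"
        using G by (simp add: commutator_def a(3) b(3) inv_mult_group m_assoc)
      also have "b' \<otimes> inv a' = inv a' \<otimes> b'"
        using comm G by (metis cancel(1) inv_closed inv_solve_right m_assoc m_closed)
      finally show ?thesis
        using G by (simp add: m_assoc)
    qed
    moreover have "a' \<otimes> f \<otimes> inv a' \<in> E" "b' \<otimes> inv e \<otimes> inv b' \<in> E"
      using Econj a b subgroup.m_inv_closed[OF E] by auto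
    ultimately show ?thesis
      using a(1) b(1) subgroup.m_closed[OF E] subgroup.m_inv_closed[OF E] by simp
  qed
  then have "derived_set G V \<subseteq> E"
    by (auto simp: commutator_def)
  then show ?thesis
    using generate_subgroup_incl[OF _ E] by (simp add: derived_def E_def)
qed

text \<open>
  The double commutator trick. If \<open>a\<close> and \<open>b\<close> are supported in \<open>U\<close>, the conjugate of \<open>inv a\<close> by \<open>k\<close> is
  supported in a set disjoint from \<open>U\<close>, so it commutes with \<open>b\<close>, and the commutator of \<open>a\<close> and \<open>b\<close>
  equals that of \<open>a \<otimes> (k \<otimes> inv a \<otimes> inv k)\<close> and \<open>b\<close>; the latter lies in \<open>K\<close>. Every local commutator of
  the derived group \<open>P\<close> of \<open>V\<close> is conjugate under \<open>P\<close> to one of this kind, and these generate a group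
  that contains \<open>P\<close>.
\<close>

theorem derived_subset_if_normalized:
  assumes K: "subgroup K G" and norm: "\<And>g k. \<lbrakk>g \<in> derived G V; k \<in> K\<rbrakk> \<Longrightarrow> g \<otimes> k \<otimes> inv g \<in> K"
    and k: "k \<in> K" and U: "U \<in> B" "U \<noteq> {}" "act k ` U \<inter> U = {}"
  shows "derived G V \<subseteq> K"
proof -
  define P where "P = derived G V"
  have VG: "V \<subseteq> carrier G"
    using V_carrier by blast
  have P: "subgroup P G"
    unfolding P_def by (rule derived_is_subgroup[OF VG])
  have PV: "P \<subseteq> V"
    unfolding P_def by (rule derived_incl[OF subset_refl subgroup_V])
  have extP: "extends_partial P"
    using extends_partial_local_commutators[OF extends_partial_V subgroup_V]
    by (rule extends_partial_mono) (simp add: P_def local_commutators_subset_derived)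
  have KG: "K \<subseteq> carrier G" and PG: "P \<subseteq> carrier G"
    using K P subgroup.subset by auto
  note K_closed = subgroup.m_closed[OF K] subgroup.m_inv_closed[OF K]
  have local: "commutator a b \<in> K" if ab: "a \<in> P" "b \<in> P" "supported a U" "supported b U" for a b
  proof -
    have G: "a \<in> carrier G" "b \<in> carrier G" "k \<in> carrier G"
      using ab k KG PG by auto
    define a' where "a' = k \<otimes> inv a \<otimes> inv k"
    have a'G: "a' \<in> carrier G"
      using G by (simp add: a'_def)
    have "supported a' (act k ` U)"
      unfolding a'_def using G ab supported_inv by (intro supported_conj) auto
    then have comm: "a' \<otimes> b = b \<otimes> a'"
      using disjoint_supports_commute[OF a'G G(2) _ ab(4)] U by blast
    have "a \<otimes> a' = (a \<otimes> k \<otimes> inv a) \<otimes> inv k"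
      using G by (simp add: a'_def m_assoc)
    then have aa': "a \<otimes> a' \<in> K"
      using norm[of a k] ab k K_closed by (simp add: P_def)
    have "commutator (a \<otimes> a') b = commutator a b"
    proof -
      have "a \<otimes> a' \<otimes> b \<otimes> inv (a \<otimes> a') = a \<otimes> b \<otimes> inv a"
      proof -
        have "a \<otimes> a' \<otimes> b \<otimes> inv (a \<otimes> a') = a \<otimes> (a' \<otimes> b) \<otimes> inv a' \<otimes> inv a"
          using G a'G by (simp add: inv_mult_group m_assoc)
        also have "\<dots> = a \<otimes> b \<otimes> (a' \<otimes> inv a') \<otimes> inv a"
          using G a'G by (simp only: comm) (simp add: m_assoc del: r_inv)
        finally show ?thesis
          using G a'G by simp
      qed
      then show ?thesis
        by (simp add: commutator_def)
    qed
    moreover have "commutator (a \<otimes> a') b = (a \<otimes> a') \<otimes> (b \<otimes> inv (a \<otimes> a') \<otimes> inv b)"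
      using G a'G by (simp add: commutator_def m_assoc)
    moreover have "(a \<otimes> a') \<otimes> (b \<otimes> inv (a \<otimes> a') \<otimes> inv b) \<in> K"
      using K_closed(1)[OF aa' norm[of b "inv (a \<otimes> a')"]] ab K_closed(2)[OF aa'] by (simp add: P_def)
    ultimately show ?thesis
      by simp
  qed
  have "local_commutators P \<subseteq> K"
  proof
    fix x assume "x \<in> local_commutators P"
    then obtain a b S where ab: "x = commutator a b" "a \<in> P" "b \<in> P" "S \<in> B" "S \<noteq> X"
        "supported a S" "supported b S"
      unfolding local_commutators_def by blast
    obtain c where c: "c \<in> V" "act c ` S \<subseteq> U"
      using compress[OF ab(4,5) U(1,2)] by blast
    obtain g where g: "g \<in> P" "\<forall>x \<in> S. act g x = act c x"
      using extends_global[OF extP P c(1) ab(4,5)] by blast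
    have G: "a \<in> carrier G" "b \<in> carrier G" "g \<in> carrier G"
      using ab g PG by auto
    have gS: "act g ` S \<subseteq> U"
      using g c by auto
    have "commutator (g \<otimes> a \<otimes> inv g) (g \<otimes> b \<otimes> inv g) \<in> K"
      using ab g G gS subgroup.m_closed[OF P] subgroup.m_inv_closed[OF P]
      by (intro local supported_mono[OF supported_conj]) auto
    then have "g \<otimes> x \<otimes> inv g \<in> K"
      using conj_commutator G ab(1) by simp
    then have "inv g \<otimes> (g \<otimes> x \<otimes> inv g) \<otimes> inv (inv g) \<in> K"
      using norm[of "inv g"] g(1) subgroup.m_inv_closed[OF P] by (simp add: P_def)
    moreover have "inv g \<otimes> (g \<otimes> x \<otimes> inv g) \<otimes> inv (inv g) = x"
      using G ab(1) by (simp add: m_assoc) (simp flip: m_assoc)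
    ultimately show "x \<in> K"
      by simp
  qed
  then have "generate G (local_commutators P) \<subseteq> K"
    by (rule generate_subgroup_incl[OF _ K])
  moreover have "derived G V \<subseteq> generate G (local_commutators P)"
    using derived_conj_closed[OF subgroup_V] B_subset[OF U(1)] U(2)
    by (intro derived_subset_local_commutators P PV extP) (auto simp: P_def)
  ultimately show ?thesis
    by blast
qed

end

section \<open>Topological groups\<close>

lemma topological_group_continuous_mult:
  assumes "topological_group G X" "continuous_map Y X f" "continuous_map Y X g"
  shows "continuous_map Y X (\<lambda>y. f y \<otimes>\<^bsub>G\<^esub> g y)"
proof -
  have "continuous_map Y X ((\<lambda>(x, y). x \<otimes>\<^bsub>G\<^esub> y) \<circ> (\<lambda>y. (f y, g y)))"
    using assms by (intro continuous_map_compose[where X' = "prod_topology X X"] continuous_map_pairedI)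
      (auto simp: topological_group_def)
  then show ?thesis
    by (simp add: o_def)
qed

lemma topological_group_continuous_inv:
  assumes "topological_group G X" "continuous_map Y X f"
  shows "continuous_map Y X (\<lambda>y. inv\<^bsub>G\<^esub> (f y))"
proof -
  have "continuous_map Y X ((\<lambda>x. inv\<^bsub>G\<^esub> x) \<circ> f)"
    using assms by (intro continuous_map_compose[where X' = X]) (auto simp: topological_group_def)
  then show ?thesis
    by (simp add: o_def)
qed

lemma closure_of_subgroup:
  assumes X: "topological_group G X" and H: "subgroup H G"
  shows "subgroup (X closure_of H) G"
proof -
  interpret group G
    using X by (simp add: topological_group_def)
  have top: "topspace X = carrier G"
    using X by (simp add: topological_group_def)
  have HX: "H \<subseteq> topspace X"
    using subgroup.subset[OF H] top by simp
  have mult: "continuous_map (prod_topology X X) X (\<lambda>(x, y). x \<otimes>\<^bsub>G\<^esub> y)"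
    and inv: "continuous_map X X (\<lambda>x. inv\<^bsub>G\<^esub> x)"
    using X by (auto simp: topological_group_def)
  show ?thesis
  proof
    show "X closure_of H \<subseteq> carrier G"
      using closure_of_subset_topspace[of X H] top by simp
    show "\<one>\<^bsub>G\<^esub> \<in> X closure_of H"
      using subgroup.one_closed[OF H] closure_of_subset[OF HX] by blast
  next
    fix x y assume xy: "x \<in> X closure_of H" "y \<in> X closure_of H"
    have "(\<lambda>(x, y). x \<otimes>\<^bsub>G\<^esub> y) ` (prod_topology X X closure_of (H \<times> H))
        \<subseteq> X closure_of ((\<lambda>(x, y). x \<otimes>\<^bsub>G\<^esub> y) ` (H \<times> H))"
      using continuous_map_image_closure_subset[OF mult] .
    moreover have "(\<lambda>(x, y). x \<otimes>\<^bsub>G\<^esub> y) ` (H \<times> H) \<subseteq> H"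
      using subgroup.m_closed[OF H] by auto
    moreover have "(x, y) \<in> prod_topology X X closure_of (H \<times> H)"
      using xy by (simp add: closure_of_Times)
    ultimately show "x \<otimes>\<^bsub>G\<^esub> y \<in> X closure_of H"
      using closure_of_mono by (smt (verit) case_prod_conv imageI subset_iff)
  next
    fix x assume x: "x \<in> X closure_of H"
    have "(\<lambda>x. inv\<^bsub>G\<^esub> x) ` (X closure_of H) \<subseteq> X closure_of ((\<lambda>x. inv\<^bsub>G\<^esub> x) ` H)"
      using continuous_map_image_closure_subset[OF inv] .
    moreover have "(\<lambda>x. inv\<^bsub>G\<^esub> x) ` H \<subseteq> H"
      using subgroup.m_inv_closed[OF H] by auto
    ultimately show "inv\<^bsub>G\<^esub> x \<in> X closure_of H"
      using x closure_of_mono[of "(\<lambda>x. inv\<^bsub>G\<^esub> x) ` H" H X] by blast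
  qed
qed

text \<open>
  The commutator map is continuous, and pairs of elements of \<open>V\<close> are dense among all pairs.
\<close>

lemma closure_of_derived_dense:
  assumes X: "topological_group G X" and V: "V \<subseteq> carrier G" and dense: "X closure_of V = carrier G"
  shows "X closure_of derived G (carrier G) = X closure_of derived G V"
proof
  interpret group G
    using X by (simp add: topological_group_def)
  have top: "topspace X = carrier G"
    using X by (simp add: topological_group_def)
  let ?c = "\<lambda>(x, y). x \<otimes>\<^bsub>G\<^esub> y \<otimes>\<^bsub>G\<^esub> inv\<^bsub>G\<^esub> x \<otimes>\<^bsub>G\<^esub> inv\<^bsub>G\<^esub> y"
  have cont: "continuous_map (prod_topology X X) X ?c"
    unfolding case_prod_beta
    by (intro topological_group_continuous_mult[OF X] topological_group_continuous_inv[OF X]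
        continuous_map_fst continuous_map_snd)
  have "?c ` (prod_topology X X closure_of (V \<times> V)) \<subseteq> X closure_of (?c ` (V \<times> V))"
    using continuous_map_image_closure_subset[OF cont] .
  also have "\<dots> \<subseteq> X closure_of derived G V"
    unfolding derived_def by (intro closure_of_mono) (auto intro!: generate.incl)
  finally have "derived_set G (carrier G) \<subseteq> X closure_of derived G V"
    by (auto simp: closure_of_Times dense image_subset_iff)
  then have "derived G (carrier G) \<subseteq> X closure_of derived G V"
    using generate_subgroup_incl[OF _ closure_of_subgroup[OF X derived_is_subgroup[OF V]]]
    by (simp add: derived_def)
  then show "X closure_of derived G (carrier G) \<subseteq> X closure_of derived G V"
    by (simp add: closure_of_minimal)
  show "X closure_of derived G V \<subseteq> X closure_of derived G (carrier G)"
    by (intro closure_of_mono mono_derived V)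
qed

lemma topological_group_subgroup:
  assumes X: "topological_group G X" and H: "subgroup H G"
  shows "topological_group (G\<lparr>carrier := H\<rparr>) (subtopology X H)"
proof -
  interpret group G
    using X by (simp add: topological_group_def)
  have top: "topspace X = carrier G"
    using X by (simp add: topological_group_def)
  have HX: "H \<subseteq> topspace X"
    using subgroup.subset[OF H] top by simp
  let ?Y = "subtopology X H"
  have "continuous_map (prod_topology ?Y ?Y) X (\<lambda>(x, y). x \<otimes>\<^bsub>G\<^esub> y)"
    unfolding case_prod_beta
    by (intro topological_group_continuous_mult[OF X]
        continuous_map_into_fulltopology[OF continuous_map_fst]
        continuous_map_into_fulltopology[OF continuous_map_snd])
  then have "continuous_map (prod_topology ?Y ?Y) ?Y (\<lambda>(x, y). x \<otimes>\<^bsub>G\<^esub> y)"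
    using subgroup.m_closed[OF H] by (auto simp: continuous_map_in_subtopology)
  moreover have "continuous_map ?Y ?Y (\<lambda>x. inv\<^bsub>G\<lparr>carrier := H\<rparr>\<^esub> x)"
  proof -
    have "continuous_map ?Y X (\<lambda>x. inv\<^bsub>G\<^esub> x)"
      by (intro topological_group_continuous_inv[OF X] continuous_map_from_subtopology continuous_map_id[unfolded id_def])
    then have "continuous_map ?Y ?Y (\<lambda>x. inv\<^bsub>G\<^esub> x)"
      using subgroup.m_inv_closed[OF H] by (auto simp: continuous_map_in_subtopology)
    then show ?thesis
      by (rule continuous_map_eq) (use m_inv_consistent[OF H] in auto)
  qed
  moreover have "topspace ?Y = H"
    using HX by auto
  ultimately show ?thesis
    using subgroup.subgroup_is_group[OF H is_group] by (simp add: topological_group_def)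
qed

text \<open>
  Every open set is a union of translates of open subsets of the subgroup.
\<close>

lemma openin_iff_translates:
  assumes X: "topological_group G X" and H: "openin X H" "\<one>\<^bsub>G\<^esub> \<in> H"
  shows "openin X A \<longleftrightarrow>
    A \<subseteq> carrier G \<and> (\<forall>g \<in> A. openin (subtopology X H) {h \<in> H. g \<otimes>\<^bsub>G\<^esub> h \<in> A})"
proof -
  interpret group G
    using X by (simp add: topological_group_def)
  have top: "topspace X = carrier G"
    using X by (simp add: topological_group_def)
  have HG: "H \<subseteq> carrier G"
    using openin_subset[OF H(1)] top by simp
  have transl: "openin X {h \<in> carrier G. g \<otimes>\<^bsub>G\<^esub> h \<in> A}" if "openin X A" "g \<in> carrier G" for g A
  proof -
    have "continuous_map X X (\<lambda>h. g \<otimes>\<^bsub>G\<^esub> h)"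
      using that top by (intro topological_group_continuous_mult[OF X] continuous_map_id[unfolded id_def]) auto
    from openin_continuous_map_preimage[OF this that(1)] show ?thesis
      by (simp add: top)
  qed
  show ?thesis
  proof (intro iffI conjI ballI)
    assume A: "openin X A"
    show AG: "A \<subseteq> carrier G"
      using openin_subset[OF A] top by simp
    fix g assume "g \<in> A"
    then have "openin X {h \<in> carrier G. g \<otimes>\<^bsub>G\<^esub> h \<in> A}"
      using A AG transl by blast
    moreover have "{h \<in> H. g \<otimes>\<^bsub>G\<^esub> h \<in> A} = {h \<in> carrier G. g \<otimes>\<^bsub>G\<^esub> h \<in> A} \<inter> H"
      using HG by blast
    ultimately show "openin (subtopology X H) {h \<in> H. g \<otimes>\<^bsub>G\<^esub> h \<in> A}"
      by (auto simp: openin_subtopology)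
  next
    assume A: "A \<subseteq> carrier G \<and> (\<forall>g \<in> A. openin (subtopology X H) {h \<in> H. g \<otimes>\<^bsub>G\<^esub> h \<in> A})"
    show "openin X A"
    proof (subst openin_subopen, intro ballI)
      fix g assume g: "g \<in> A"
      then have gG: "g \<in> carrier G"
        using A by blast
      have "openin X {h \<in> H. g \<otimes>\<^bsub>G\<^esub> h \<in> A}"
        using A g H(1) by (simp add: openin_open_subtopology)
      then have "openin X {x \<in> carrier G. inv\<^bsub>G\<^esub> g \<otimes>\<^bsub>G\<^esub> x \<in> {h \<in> H. g \<otimes>\<^bsub>G\<^esub> h \<in> A}}"
        by (intro transl inv_closed gG)
      moreover have "g \<otimes>\<^bsub>G\<^esub> (inv\<^bsub>G\<^esub> g \<otimes>\<^bsub>G\<^esub> x) = x" if "x \<in> carrier G" for x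
        using gG that by (simp flip: m_assoc)
      then have "{x \<in> carrier G. inv\<^bsub>G\<^esub> g \<otimes>\<^bsub>G\<^esub> x \<in> {h \<in> H. g \<otimes>\<^bsub>G\<^esub> h \<in> A}} \<subseteq> A"
        by auto
      moreover have "g \<in> {x \<in> carrier G. inv\<^bsub>G\<^esub> g \<otimes>\<^bsub>G\<^esub> x \<in> {h \<in> H. g \<otimes>\<^bsub>G\<^esub> h \<in> A}}"
        using g gG H(2) by simp
      ultimately show "\<exists>W. openin X W \<and> g \<in> W \<and> W \<subseteq> A"
        by blast
    qed
  qed
qed

text \<open>
  This justifies the definite description in the definition of the topology of the group of
  patterned almost automorphisms.
\<close>

lemma topological_group_unique:
  assumes X: "topological_group G X" "openin X H" and Y: "topological_group G Y" "openin Y H"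
    and one: "\<one>\<^bsub>G\<^esub> \<in> H" and f: "homeomorphic_map Z (subtopology X H) f" "homeomorphic_map Z (subtopology Y H) f"
  shows "X = Y"
proof -
  have sub: "openin (subtopology W H) A \<longleftrightarrow> A \<subseteq> H \<and> openin Z {z \<in> topspace Z. f z \<in> A}"
    if W: "openin W H" "homeomorphic_map Z (subtopology W H) f" for W A
  proof -
    have "topspace (subtopology W H) = H"
      using openin_subset[OF W(1)] by auto
    then show ?thesis
      using W(2)[unfolded homeomorphic_map_def] openin_subset[of "subtopology W H" A]
      unfolding quotient_map_def by auto
  qed
  have "openin (subtopology X H) = openin (subtopology Y H)"
    using sub[OF X(2) f(1)] sub[OF Y(2) f(2)] by blast
  then have "openin X = openin Y"
    using openin_iff_translates[OF X one] openin_iff_translates[OF Y one] by (intro ext) simp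
  then show ?thesis
    by (simp add: topology_eq)
qed

text \<open>
  A decreasing sequence of subgroups is a neighbourhood base of the identity for a group topology as
  soon as conjugation by each single element is continuous at the identity.
\<close>

locale subgroup_basis = group G for G (structure) +
  fixes U :: "nat \<Rightarrow> 'a set"
  assumes subgroup_U: "subgroup (U n) G"
    and decseq_U: "m \<le> n \<Longrightarrow> U n \<subseteq> U m"
    and conj_U: "g \<in> carrier G \<Longrightarrow> \<exists>m. \<forall>u \<in> U m. g \<otimes> u \<otimes> inv g \<in> U n"
begin

definition basis_topology :: "'a topology" where
  "basis_topology =
     topology (\<lambda>A. A \<subseteq> carrier G \<and> (\<forall>g \<in> A. \<exists>n. \<forall>u \<in> U n. g \<otimes> u \<in> A))"

lemma openin_basis_topology:
  "openin basis_topology A \<longleftrightarrow> A \<subseteq> carrier G \<and> (\<forall>g \<in> A. \<exists>n. \<forall>u \<in> U n. g \<otimes> u \<in> A)"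
proof -
  have "istopology (\<lambda>A. A \<subseteq> carrier G \<and> (\<forall>g \<in> A. \<exists>n. \<forall>u \<in> U n. g \<otimes> u \<in> A))"
    unfolding istopology_def
  proof (intro conjI allI impI ballI)
    fix A A' g
    assume A: "A \<subseteq> carrier G \<and> (\<forall>g \<in> A. \<exists>n. \<forall>u \<in> U n. g \<otimes> u \<in> A)"
      and A': "A' \<subseteq> carrier G \<and> (\<forall>g \<in> A'. \<exists>n. \<forall>u \<in> U n. g \<otimes> u \<in> A')"
      and g: "g \<in> A \<inter> A'"
    obtain n n' where "\<forall>u \<in> U n. g \<otimes> u \<in> A" "\<forall>u \<in> U n'. g \<otimes> u \<in> A'"
      using A A' g by blast
    then have "\<forall>u \<in> U (max n n'). g \<otimes> u \<in> A \<inter> A'"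
      using decseq_U[of n "max n n'"] decseq_U[of n' "max n n'"] by auto
    then show "\<exists>n. \<forall>u \<in> U n. g \<otimes> u \<in> A \<inter> A'"
      by blast
  next
    fix \<K> g
    assume \<K>: "\<forall>A \<in> \<K>. A \<subseteq> carrier G \<and> (\<forall>g \<in> A. \<exists>n. \<forall>u \<in> U n. g \<otimes> u \<in> A)" and "g \<in> \<Union>\<K>"
    then obtain A where "A \<in> \<K>" "g \<in> A"
      by blast
    then obtain n where "\<forall>u \<in> U n. g \<otimes> u \<in> A"
      using \<K> by blast
    then show "\<exists>n. \<forall>u \<in> U n. g \<otimes> u \<in> \<Union>\<K>"
      using \<open>A \<in> \<K>\<close> by blast
  qed blast+
  then show ?thesis
    unfolding basis_topology_def by (simp add: topology_inverse')
qed

lemma U_carrier: "u \<in> U n \<Longrightarrow> u \<in> carrier G"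
  using subgroup.subset[OF subgroup_U] by blast

lemma topspace_basis_topology: "topspace basis_topology = carrier G"
proof -
  have "openin basis_topology (carrier G)"
    using U_carrier by (auto simp: openin_basis_topology)
  then show ?thesis
    using openin_subset openin_topspace[of basis_topology] openin_basis_topology by blast
qed

lemma openin_coset:
  assumes "g \<in> carrier G"
  shows "openin basis_topology ((\<lambda>u. g \<otimes> u) ` U n)"
  unfolding openin_basis_topology
proof (intro conjI ballI)
  show "(\<lambda>u. g \<otimes> u) ` U n \<subseteq> carrier G"
    using assms U_carrier by auto
  fix x assume "x \<in> (\<lambda>u. g \<otimes> u) ` U n"
  then obtain u where "x = g \<otimes> u" "u \<in> U n"
    by blast
  then have "\<forall>u' \<in> U n. x \<otimes> u' \<in> (\<lambda>u. g \<otimes> u) ` U n"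
    using assms subgroup.m_closed[OF subgroup_U] U_carrier by (auto simp: m_assoc)
  then show "\<exists>m. \<forall>u' \<in> U m. x \<otimes> u' \<in> (\<lambda>u. g \<otimes> u) ` U n"
    by blast
qed

lemma mem_coset: "g \<in> carrier G \<Longrightarrow> g \<in> (\<lambda>u. g \<otimes> u) ` U n"
  using subgroup.one_closed[OF subgroup_U] by (intro image_eqI[of _ _ \<one>]) auto

lemma topological_group_basis_topology: "topological_group G basis_topology"
  unfolding topological_group_def
proof (intro conjI)
  show "group G"
    by (rule is_group)
  show "topspace basis_topology = carrier G"
    by (rule topspace_basis_topology)
  show "continuous_map (prod_topology basis_topology basis_topology) basis_topology (\<lambda>(x, y). x \<otimes> y)"
    unfolding continuous_map_def
  proof (intro conjI allI impI)
    show "(\<lambda>(x, y). x \<otimes> y) \<in>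
        topspace (prod_topology basis_topology basis_topology) \<rightarrow> topspace basis_topology"
      by (auto simp: topspace_basis_topology)
    fix A assume A: "openin basis_topology A"
    show "openin (prod_topology basis_topology basis_topology)
        {z \<in> topspace (prod_topology basis_topology basis_topology). (case z of (x, y) \<Rightarrow> x \<otimes> y) \<in> A}"
      unfolding openin_prod_topology_alt
    proof (intro allI impI)
      fix x y
      assume "(x, y) \<in> {z \<in> topspace (prod_topology basis_topology basis_topology). (case z of (x, y) \<Rightarrow> x \<otimes> y) \<in> A}"
      then have xy: "x \<in> carrier G" "y \<in> carrier G" "x \<otimes> y \<in> A"
        by (auto simp: topspace_basis_topology)
      then obtain n where n: "\<forall>u \<in> U n. x \<otimes> y \<otimes> u \<in> A"
        using A by (auto simp: openin_basis_topology)
      obtain m where m: "\<forall>u \<in> U m. inv y \<otimes> u \<otimes> inv (inv y) \<in> U n"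
        using conj_U[of "inv y" n] xy by auto
      have "x \<otimes> u \<otimes> (y \<otimes> u') \<in> A" if "u \<in> U m" "u' \<in> U n" for u u'
      proof -
        have G: "u \<in> carrier G" "u' \<in> carrier G"
          using that U_carrier by auto
        have cancel: "y \<otimes> (inv y \<otimes> z) = z" if "z \<in> carrier G" for z
          using xy that by (simp flip: m_assoc)
        have "x \<otimes> y \<otimes> ((inv y \<otimes> u \<otimes> y) \<otimes> u') \<in> A"
          using m n that xy subgroup.m_closed[OF subgroup_U] by simp
        then show ?thesis
          using xy G by (simp add: m_assoc cancel)
      qed
      then have "(\<lambda>u. x \<otimes> u) ` U m \<times> (\<lambda>u. y \<otimes> u) ` U n \<subseteq>
          {z \<in> topspace (prod_topology basis_topology basis_topology). (case z of (x, y) \<Rightarrow> x \<otimes> y) \<in> A}"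
        using xy U_carrier by (auto simp: topspace_basis_topology)
      then show "\<exists>W W'. openin basis_topology W \<and> openin basis_topology W' \<and> x \<in> W \<and> y \<in> W' \<and>
          W \<times> W' \<subseteq> {z \<in> topspace (prod_topology basis_topology basis_topology). (case z of (x, y) \<Rightarrow> x \<otimes> y) \<in> A}"
        using openin_coset mem_coset xy by meson
    qed
  qed
  show "continuous_map basis_topology basis_topology (\<lambda>x. inv x)"
    unfolding continuous_map_def
  proof (intro conjI allI impI)
    show "(\<lambda>x. inv x) \<in> topspace basis_topology \<rightarrow> topspace basis_topology"
      by (auto simp: topspace_basis_topology)
    fix A assume A: "openin basis_topology A"
    show "openin basis_topology {x \<in> topspace basis_topology. inv x \<in> A}"
      unfolding openin_basis_topology topspace_basis_topology
    proof (intro conjI ballI)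
      fix x assume "x \<in> {x \<in> carrier G. inv x \<in> A}"
      then have x: "x \<in> carrier G" "inv x \<in> A"
        by auto
      then obtain n where n: "\<forall>u \<in> U n. inv x \<otimes> u \<in> A"
        using A by (auto simp: openin_basis_topology)
      obtain m where m: "\<forall>u \<in> U m. x \<otimes> u \<otimes> inv x \<in> U n"
        using conj_U[of x n] x by auto
      have "inv (x \<otimes> u) \<in> A" if u: "u \<in> U m" for u
      proof -
        have uG: "u \<in> carrier G"
          using u U_carrier by auto
        have cancel: "inv x \<otimes> (x \<otimes> z) = z" if "z \<in> carrier G" for z
          using x that by (simp flip: m_assoc)
        have "inv x \<otimes> (x \<otimes> inv u \<otimes> inv x) \<in> A"
          using m n u subgroup.m_inv_closed[OF subgroup_U] by blast
        then show ?thesis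
          using x uG by (simp add: m_assoc cancel inv_mult_group)
      qed
      then show "\<exists>n. \<forall>u \<in> U n. x \<otimes> u \<in> {x \<in> carrier G. inv x \<in> A}"
        using x U_carrier by (intro exI[of _ m]) auto
    qed auto
  qed
qed

end

section \<open>Ends of a branching tree\<close>

abbreviation perm_inv :: "('a \<Rightarrow> 'a) \<Rightarrow> 'a \<Rightarrow> 'a" where
  "perm_inv g \<equiv> inv_into UNIV g"

text \<open>
  Branching below every vertex rules out vertices without children and isolated ends. Near an
  isolated end, an almost automorphism could shift the vertices without moving any end.
\<close>

locale branching_tree =
  fixes T :: "'v rooted_tree"
  assumes locally_finite: "locally_finite_tree T"
    and branching: "v \<in> tverts T \<Longrightarrow> \<exists>w \<in> descendants T v. 2 \<le> card (children T w)"
begin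

lemma root_vert: "troot T \<in> tverts T"
  using locally_finite by (simp add: locally_finite_tree_def)

lemma edge_verts: "(x, y) \<in> tedges T \<Longrightarrow> x \<in> tverts T \<and> y \<in> tverts T"
  using locally_finite by (auto simp: locally_finite_tree_def)

lemma not_edge_root: "(x, troot T) \<notin> tedges T"
  using locally_finite by (simp add: locally_finite_tree_def)

lemma parent_unique:
  assumes "(x, z) \<in> tedges T" "(y, z) \<in> tedges T"
  shows "x = y"
proof -
  have "z \<in> tverts T - {troot T}"
    using assms edge_verts not_edge_root by auto
  then have "\<exists>!u. (u, z) \<in> tedges T"
    using locally_finite by (simp add: locally_finite_tree_def)
  then show ?thesis
    using assms by blast
qed

lemma finite_children: "v \<in> tverts T \<Longrightarrow> finite (children T v)"
  using locally_finite by (simp add: locally_finite_tree_def)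

lemma ex_child:
  assumes "v \<in> tverts T"
  shows "\<exists>w. (v, w) \<in> tedges T"
proof -
  obtain w where w: "(v, w) \<in> (tedges T)\<^sup>*" "2 \<le> card (children T w)"
    using branching[OF assms] by (auto simp: descendants_def)
  show ?thesis
  proof (cases "v = w")
    case True
    then have "children T v \<noteq> {}"
      using w by auto
    then show ?thesis
      by (auto simp: children_def)
  next
    case False
    then show ?thesis
      using w(1) by (meson converse_rtranclE)
  qed
qed

text \<open>
  An end is given by the vertices of the ray that represents it and starts at the root, so
  \<open>\<xi> n\<close> is its vertex of depth \<open>n\<close>.
\<close>

definition ends :: "(nat \<Rightarrow> 'v) set" where
  "ends = {\<xi>. \<xi> 0 = troot T \<and> (\<forall>n. (\<xi> n, \<xi> (Suc n)) \<in> tedges T)}"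

lemma ends_root: "\<xi> \<in> ends \<Longrightarrow> \<xi> 0 = troot T"
  by (simp add: ends_def)

lemma ends_edge: "\<xi> \<in> ends \<Longrightarrow> (\<xi> n, \<xi> (Suc n)) \<in> tedges T"
  by (simp add: ends_def)

lemma ends_vert: "\<xi> \<in> ends \<Longrightarrow> \<xi> n \<in> tverts T"
  using ends_edge edge_verts by blast

lemma ex_ray:
  assumes "v \<in> tverts T"
  shows "\<exists>\<tau>. \<tau> 0 = v \<and> (\<forall>n. (\<tau> n, \<tau> (Suc n)) \<in> tedges T)"
proof -
  define step where "step x = (SOME w. (x, w) \<in> tedges T)" for x
  have step: "(x, step x) \<in> tedges T" if "x \<in> tverts T" for x
    unfolding step_def using ex_child[OF that] by (rule someI_ex)
  have "(step ^^ n) v \<in> tverts T" for n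
    by (induction n) (use assms step edge_verts in auto)
  then show ?thesis
    using step by (intro exI[of _ "\<lambda>n. (step ^^ n) v"]) auto
qed

lemma splice:
  assumes "\<xi> \<in> ends" "\<tau> 0 = \<xi> n" "\<And>k. (\<tau> k, \<tau> (Suc k)) \<in> tedges T"
  shows "\<exists>\<eta> \<in> ends. (\<forall>i \<le> n. \<eta> i = \<xi> i) \<and> (\<forall>k. \<eta> (n + k) = \<tau> k)"
proof -
  define \<eta> where "\<eta> i = (if i \<le> n then \<xi> i else \<tau> (i - n))" for i
  have "(\<eta> i, \<eta> (Suc i)) \<in> tedges T" for i
  proof -
    consider "i < n" | "i = n" | "n < i"
      by linarith
    then show ?thesis
    proof cases
      case 1
      then show ?thesis
        using ends_edge[OF assms(1)] by (simp add: \<eta>_def)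
    next
      case 2
      then show ?thesis
        using assms(2) assms(3)[of 0] by (simp add: \<eta>_def)
    next
      case 3
      then show ?thesis
        using assms(3)[of "i - n"] by (simp add: \<eta>_def Suc_diff_le)
    qed
  qed
  then have "\<eta> \<in> ends"
    using ends_root[OF assms(1)] by (simp add: ends_def \<eta>_def)
  moreover have "\<eta> (n + k) = \<tau> k" for k
    using assms(2) by (simp add: \<eta>_def)
  moreover have "\<eta> i = \<xi> i" if "i \<le> n" for i
    using that by (simp add: \<eta>_def)
  ultimately show ?thesis
    by blast
qed

lemma ends_nonempty: "ends \<noteq> {}"
  using ex_ray[OF root_vert] by (auto simp: ends_def)

text \<open>
  Since parents are unique, a vertex determines its depth and all of its ancestors.
\<close>

lemma ends_unique:
  assumes "\<xi> \<in> ends" "\<eta> \<in> ends" "\<xi> n = \<eta> m"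
  shows "n = m \<and> (\<forall>i \<le> n. \<xi> i = \<eta> i)"
  using assms(3)
proof (induction n arbitrary: m)
  case 0
  then show ?case
    using assms(1,2) ends_root[of \<xi>] ends_root[of \<eta>] ends_edge[of \<eta> "m - 1"] not_edge_root
    by (cases m) auto
next
  case (Suc n)
  show ?case
  proof (cases m)
    case 0
    then show ?thesis
      using Suc.prems assms(1,2) ends_root[of \<eta>] ends_edge[of \<xi> n] not_edge_root by auto
  next
    case (Suc m')
    then have "\<xi> n = \<eta> m'"
      using Suc.prems ends_edge[OF assms(1), of n] ends_edge[OF assms(2), of m'] parent_unique
      by auto
    then have "n = m' \<and> (\<forall>i \<le> n. \<xi> i = \<eta> i)"
      by (rule Suc.IH)
    then show ?thesis
      using Suc.prems Suc by (auto simp: le_Suc_eq)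
  qed
qed

lemma ends_level: "\<lbrakk>\<xi> \<in> ends; \<eta> \<in> ends; \<xi> n = \<eta> m\<rbrakk> \<Longrightarrow> n = m"
  using ends_unique by blast

lemma ends_agree: "\<lbrakk>\<xi> \<in> ends; \<eta> \<in> ends; \<xi> n = \<eta> n; i \<le> n\<rbrakk> \<Longrightarrow> \<xi> i = \<eta> i"
  using ends_unique by blast

lemma ends_eqI:
  assumes "\<xi> \<in> ends" "\<eta> \<in> ends" "\<And>j. \<xi> (n + j) = \<eta> (n + j)"
  shows "\<xi> = \<eta>"
proof
  fix i
  show "\<xi> i = \<eta> i"
    using ends_agree[OF assms(1,2) assms(3)[of i]] by simp
qed

lemma ex_end_child:
  assumes "\<xi> \<in> ends" "(\<xi> n, w) \<in> tedges T"
  shows "\<exists>\<eta> \<in> ends. (\<forall>i \<le> n. \<eta> i = \<xi> i) \<and> \<eta> (Suc n) = w"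
proof -
  obtain \<tau> where \<tau>: "\<tau> 0 = w" "\<forall>n. (\<tau> n, \<tau> (Suc n)) \<in> tedges T"
    using ex_ray assms(2) edge_verts by metis
  have "\<exists>\<eta> \<in> ends. (\<forall>i \<le> n. \<eta> i = \<xi> i) \<and> (\<forall>k. \<eta> (n + k) = case_nat (\<xi> n) \<tau> k)"
    using \<tau> assms(2) by (intro splice[OF assms(1)]) (auto split: nat.split)
  then obtain \<eta> where "\<eta> \<in> ends" "\<forall>i \<le> n. \<eta> i = \<xi> i" "\<forall>k. \<eta> (n + k) = case_nat (\<xi> n) \<tau> k"
    by blast
  then show ?thesis
    using \<tau>(1) by (intro bexI[of _ \<eta>]) (auto dest: spec[of _ "Suc 0"])
qed

lemma ex_end_descendant:
  assumes "\<xi> \<in> ends" "(\<xi> n, w) \<in> (tedges T)\<^sup>*"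
  shows "\<exists>\<eta> \<in> ends. \<exists>j. \<eta> n = \<xi> n \<and> \<eta> (n + j) = w"
  using assms(2)
proof induction
  case base
  then show ?case
    using assms(1) by (intro bexI[of _ \<xi>] exI[of _ 0]) auto
next
  case (step y z)
  then obtain \<eta> j where \<eta>: "\<eta> \<in> ends" "\<eta> n = \<xi> n" "\<eta> (n + j) = y"
    by blast
  then obtain \<eta>' where "\<eta>' \<in> ends" "\<forall>i \<le> n + j. \<eta>' i = \<eta> i" "\<eta>' (Suc (n + j)) = z"
    using ex_end_child[of \<eta> "n + j" z] step by auto
  then show ?case
    using \<eta> by (intro bexI[of _ \<eta>'] exI[of _ "Suc j"]) auto
qed

lemma ex_end_vertex:
  assumes "x \<in> tverts T"
  shows "\<exists>\<xi> \<in> ends. \<exists>n. \<xi> n = x"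
proof -
  obtain \<xi> where "\<xi> \<in> ends"
    using ends_nonempty by blast
  moreover have "(troot T, x) \<in> (tedges T)\<^sup>*"
    using locally_finite assms by (simp add: locally_finite_tree_def descendants_def)
  ultimately show ?thesis
    using ex_end_descendant[of \<xi> 0 x] ends_root by fastforce
qed

lemma ends_descendant:
  assumes "\<xi> \<in> ends"
  shows "(\<xi> n, \<xi> (n + j)) \<in> (tedges T)\<^sup>*"
  by (induction j) (use ends_edge[OF assms] in \<open>auto intro: rtrancl.rtrancl_into_rtrancl\<close>)

lemma ex_branching:
  assumes "\<xi> \<in> ends"
  shows "\<exists>\<eta> \<in> ends. \<exists>\<eta>' \<in> ends. \<exists>j. \<eta> n = \<xi> n \<and> \<eta>' n = \<xi> n \<and>
    \<eta> (n + j) = \<eta>' (n + j) \<and> \<eta> (Suc (n + j)) \<noteq> \<eta>' (Suc (n + j))"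
proof -
  obtain w where w: "(\<xi> n, w) \<in> (tedges T)\<^sup>*" "2 \<le> card (children T w)"
    using branching[OF ends_vert[OF assms]] by (auto simp: descendants_def)
  have fin: "finite (children T w)"
    using w(2) by (metis card.infinite not_numeral_le_zero)
  have "\<not> card (children T w) \<le> Suc 0"
    using w(2) by simp
  then obtain c c' where c: "(w, c) \<in> tedges T" "(w, c') \<in> tedges T" "c \<noteq> c'"
    using card_le_Suc0_iff_eq[OF fin] by (auto simp: children_def)
  obtain \<zeta> j where \<zeta>: "\<zeta> \<in> ends" "\<zeta> n = \<xi> n" "\<zeta> (n + j) = w"
    using ex_end_descendant[OF assms w(1)] by blast
  obtain \<eta> where \<eta>: "\<eta> \<in> ends" "\<forall>i \<le> n + j. \<eta> i = \<zeta> i" "\<eta> (Suc (n + j)) = c"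
    using ex_end_child[of \<zeta> "n + j" c] \<zeta> c by auto
  obtain \<eta>' where \<eta>': "\<eta>' \<in> ends" "\<forall>i \<le> n + j. \<eta>' i = \<zeta> i" "\<eta>' (Suc (n + j)) = c'"
    using ex_end_child[of \<zeta> "n + j" c'] \<zeta> c by auto
  show ?thesis
    using \<eta> \<eta>' c(3) \<zeta>(2) by (intro bexI[of _ \<eta>] bexI[of _ \<eta>'] exI[of _ j]) auto
qed

definition cyl :: "nat \<Rightarrow> 'v \<Rightarrow> (nat \<Rightarrow> 'v) set" where
  "cyl n x = {\<xi> \<in> ends. \<xi> n = x}"

lemma mem_cyl [simp]: "\<xi> \<in> cyl n x \<longleftrightarrow> \<xi> \<in> ends \<and> \<xi> n = x"
  by (simp add: cyl_def)

definition sphere :: "nat \<Rightarrow> 'v set" where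
  "sphere n = (\<lambda>\<xi>. \<xi> n) ` ends"

lemma finite_sphere: "finite (sphere n)"
proof (induction n)
  case 0
  have "sphere 0 \<subseteq> {troot T}"
    by (auto simp: sphere_def ends_root)
  then show ?case
    using finite_subset by blast
next
  case (Suc n)
  have "sphere (Suc n) \<subseteq> (\<Union>x \<in> sphere n. children T x)"
    using ends_edge by (auto simp: sphere_def children_def)
  moreover have "finite (\<Union>x \<in> sphere n. children T x)"
  proof (rule finite_UN_I[OF Suc])
    show "finite (children T x)" if "x \<in> sphere n" for x
      using that finite_children ends_vert by (auto simp: sphere_def)
  qed
  ultimately show ?case
    using finite_subset by blast
qed

section \<open>Finite complete subtrees as cuts of the space of ends\<close>

text \<open>
  Follow a path inside \<open>S\<close> from the root. Each step adds a vertex to the chain of ancestors or removes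
  one, so the chain never leaves \<open>S\<close>.
\<close>

lemma complete_subtree_closed:
  assumes S: "finite_complete_subtree T S" and \<xi>: "\<xi> \<in> ends" "\<xi> n \<in> S" "i \<le> n"
  shows "\<xi> i \<in> S"
proof -
  let ?R = "(tedges T \<union> (tedges T)\<inverse>) \<inter> S \<times> S"
  have root: "troot T \<in> S"
    using S by (simp add: finite_complete_subtree_def)
  have "(troot T, \<xi> n) \<in> ?R\<^sup>*"
    using S \<xi>(2) root by (simp add: finite_complete_subtree_def subtree_def)
  then have "\<forall>\<eta> \<in> ends. \<forall>m. \<eta> m = \<xi> n \<longrightarrow> (\<forall>i \<le> m. \<eta> i \<in> S)"
  proof induction
    case base
    show ?case
    proof (intro ballI allI impI)
      fix \<eta> m i assume "\<eta> \<in> ends" "\<eta> m = troot T" "i \<le> m"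
      then show "\<eta> i \<in> S"
        using ends_level[of \<eta> \<eta> m 0] ends_root root by auto
    qed
  next
    case (step x y)
    show ?case
    proof (intro ballI allI impI)
      fix \<eta> m i assume \<eta>: "\<eta> \<in> ends" "\<eta> m = y" "i \<le> m"
      have yS: "y \<in> S"
        using step by auto
      consider "(x, y) \<in> tedges T" | "(y, x) \<in> tedges T"
        using step by auto
      then show "\<eta> i \<in> S"
      proof cases
        case 1
        then obtain m' where m': "m = Suc m'"
          using \<eta> ends_root not_edge_root by (cases m) auto
        then have "\<eta> m' = x"
          using \<eta> 1 ends_edge[OF \<eta>(1), of m'] parent_unique by auto
        then show ?thesis
          using step.IH \<eta> m' yS by (auto simp: le_Suc_eq)
      next
        case 2
        then obtain \<eta>' where \<eta>': "\<eta>' \<in> ends" "\<forall>i \<le> m. \<eta>' i = \<eta> i" "\<eta>' (Suc m) = x"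
          using ex_end_child[of \<eta> m x] \<eta> by auto
        then have "\<forall>i \<le> Suc m. \<eta>' i \<in> S"
          using step.IH by blast
        then have "\<eta>' i \<in> S"
          using \<eta>(3) by simp
        then show ?thesis
          using \<eta>'(2) \<eta>(3) by simp
      qed
    qed
  qed
  then show ?thesis
    using \<xi> by blast
qed

lemma leaf_Suc:
  assumes "\<xi> \<in> ends" "\<xi> N \<in> leaves T S"
  shows "\<xi> (Suc N) \<notin> S"
  using assms ends_edge[OF assms(1), of N] by (auto simp: leaves_def children_def)

lemma leaf_subset: "leaves T S \<subseteq> S"
  by (auto simp: leaves_def)

lemma leaf_level_unique:
  assumes S: "finite_complete_subtree T S" and \<xi>: "\<xi> \<in> ends"
    and N: "\<xi> N \<in> leaves T S" and M: "\<xi> M \<in> S"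
  shows "M \<le> N"
proof (rule ccontr)
  assume "\<not> M \<le> N"
  then have "\<xi> (Suc N) \<in> S"
    using complete_subtree_closed[OF S \<xi> M, of "Suc N"] by simp
  then show False
    using leaf_Suc[OF \<xi> N] by blast
qed

lemma leaf_unique:
  assumes S: "finite_complete_subtree T S" and \<xi>: "\<xi> \<in> ends"
    and "\<xi> N \<in> leaves T S" "\<xi> M \<in> leaves T S"
  shows "N = M"
  using leaf_level_unique[OF S \<xi>] assms(3,4) leaf_subset by (meson antisym subsetD)

text \<open>
  The last vertex of the end in \<open>S\<close> has a child outside \<open>S\<close>, hence by completeness no child in \<open>S\<close>.
\<close>

lemma ex_leaf:
  assumes S: "finite_complete_subtree T S" and \<xi>: "\<xi> \<in> ends"
  shows "\<exists>N. \<xi> N \<in> leaves T S"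
proof -
  have "inj \<xi>"
    using ends_level[OF \<xi> \<xi>] by (auto simp: inj_def)
  then have "infinite (range \<xi>)"
    by (simp add: finite_image_iff)
  then have "\<exists>n. \<xi> n \<notin> S"
    using S finite_subset[of "range \<xi>" S] by (auto simp: finite_complete_subtree_def)
  then have out: "\<xi> (LEAST n. \<xi> n \<notin> S) \<notin> S"
    by (rule LeastI_ex)
  obtain N where N: "(LEAST n. \<xi> n \<notin> S) = Suc N"
    using out ends_root[OF \<xi>] S by (cases "LEAST n. \<xi> n \<notin> S") (auto simp: finite_complete_subtree_def)
  have NS: "\<xi> N \<in> S"
    using not_less_Least[of N "\<lambda>n. \<xi> n \<notin> S"] N by auto
  moreover have "\<xi> (Suc N) \<in> children T (\<xi> N)"
    using ends_edge[OF \<xi>] by (simp add: children_def)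
  ultimately have "children T (\<xi> N) \<inter> S = {}"
    using S out N unfolding finite_complete_subtree_def by auto
  then show ?thesis
    using NS by (auto simp: leaves_def)
qed

lemma leaf_vert: "\<lbrakk>finite_complete_subtree T S; x \<in> leaves T S\<rbrakk> \<Longrightarrow> x \<in> tverts T"
  by (auto simp: finite_complete_subtree_def subtree_def leaves_def)

lemma forestE:
  assumes S: "finite_complete_subtree T S" and "x \<in> forest T S"
  obtains \<xi> N j where "\<xi> \<in> ends" "\<xi> N \<in> leaves T S" "x = \<xi> (N + j)"
proof -
  obtain v where v: "v \<in> leaves T S" "(v, x) \<in> (tedges T)\<^sup>*"
    using assms(2) by (auto simp: forest_def descendants_def)
  obtain \<xi> N where \<xi>: "\<xi> \<in> ends" "\<xi> N = v"
    using ex_end_vertex[OF leaf_vert[OF S v(1)]] by blast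
  then obtain \<eta> j where "\<eta> \<in> ends" "\<eta> N = \<xi> N" "\<eta> (N + j) = x"
    using ex_end_descendant[of \<xi> N x] v by auto
  then show thesis
    using that[of \<eta> N j] \<xi> v by simp
qed

lemma forestI: "\<lbrakk>\<xi> \<in> ends; \<xi> N \<in> leaves T S\<rbrakk> \<Longrightarrow> \<xi> (N + j) \<in> forest T S"
  using ends_descendant[of \<xi> N j] by (auto simp: forest_def descendants_def)

lemma level_bound:
  assumes "finite S"
  shows "\<exists>n. \<forall>\<xi> \<in> ends. \<forall>N. \<xi> N \<in> S \<longrightarrow> N \<le> n"
  using assms
proof induction
  case empty
  then show ?case by simp
next
  case (insert x S)
  then obtain n where n: "\<forall>\<xi> \<in> ends. \<forall>N. \<xi> N \<in> S \<longrightarrow> N \<le> n"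
    by blast
  show ?case
  proof (cases "\<exists>\<eta> \<in> ends. \<exists>M. \<eta> M = x")
    case True
    then obtain \<eta> M where \<eta>: "\<eta> \<in> ends" "\<eta> M = x"
      by blast
    have "N \<le> max n M" if "\<xi> \<in> ends" "\<xi> N \<in> insert x S" for \<xi> N
      using that n ends_level[OF that(1) \<eta>(1), of N M] \<eta>(2) by (auto simp: le_max_iff_disj)
    then show ?thesis
      by blast
  next
    case False
    then have "N \<le> n" if "\<xi> \<in> ends" "\<xi> N \<in> insert x S" for \<xi> N
      using that n by auto
    then show ?thesis
      by blast
  qed
qed

text \<open>
  The subtree consists of the ancestors of \<open>A\<close>. So finite complete subtrees are the same as finite
  sets of vertices that every end meets exactly once.
\<close>

lemma ex_complete_subtree_with_leaves:
  assumes fin: "finite A" and ex: "\<And>\<xi>. \<xi> \<in> ends \<Longrightarrow> \<exists>N. \<xi> N \<in> A"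
    and unique: "\<And>\<xi> N M. \<lbrakk>\<xi> \<in> ends; \<xi> N \<in> A; \<xi> M \<in> A\<rbrakk> \<Longrightarrow> N = M"
    and verts: "A \<subseteq> tverts T"
  shows "\<exists>S. finite_complete_subtree T S \<and> leaves T S = A"
proof -
  define S where "S = {\<xi> i | \<xi> i N. \<xi> \<in> ends \<and> \<xi> N \<in> A \<and> i \<le> N}"
  \<comment> \<open>The end that witnesses membership in \<open>S\<close> may be replaced by any end through the vertex.\<close>
  have mem: "\<xi> i \<in> S \<longleftrightarrow> (\<exists>N \<ge> i. \<xi> N \<in> A)" if \<xi>: "\<xi> \<in> ends" for \<xi> i
  proof
    assume "\<xi> i \<in> S"
    then obtain \<eta> k N where \<eta>: "\<eta> \<in> ends" "\<xi> i = \<eta> k" "\<eta> N \<in> A" "k \<le> N"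
      unfolding S_def by blast
    have ik: "i = k" and agree: "\<And>j. j \<le> i \<Longrightarrow> \<xi> j = \<eta> j"
      using ends_unique[OF \<xi> \<eta>(1,2)] by auto
    obtain M where M: "\<xi> M \<in> A"
      using ex[OF \<xi>] by blast
    have "i \<le> M"
    proof (rule ccontr)
      assume "\<not> i \<le> M"
      then have "\<eta> M \<in> A"
        using M agree[of M] by simp
      then show False
        using unique[OF \<eta>(1,3)] \<eta>(4) ik \<open>\<not> i \<le> M\<close> by blast
    qed
    then show "\<exists>N \<ge> i. \<xi> N \<in> A"
      using M by blast
  next
    assume "\<exists>N \<ge> i. \<xi> N \<in> A"
    then show "\<xi> i \<in> S"
      using \<xi> by (auto simp: S_def)
  qed
  have on_end: "\<exists>\<xi> \<in> ends. \<exists>i. x = \<xi> i" if "x \<in> S" for x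
    using that by (auto simp: S_def)
  have inner: "c \<in> S" if prems: "\<xi> \<in> ends" "\<xi> i \<in> S" "\<xi> i \<notin> A" "(\<xi> i, c) \<in> tedges T" for \<xi> i c
  proof -
    obtain \<eta> where \<eta>: "\<eta> \<in> ends" "\<forall>k \<le> i. \<eta> k = \<xi> k" "\<eta> (Suc i) = c"
      using ex_end_child[OF prems(1,4)] by blast
    then obtain N where N: "N \<ge> i" "\<eta> N \<in> A"
      using mem[OF \<eta>(1), of i] prems(2) by auto
    then have "N \<ge> Suc i"
      using \<eta>(2) prems(3) by (metis le_refl le_antisym not_less_eq_eq)
    then show ?thesis
      using mem[OF \<eta>(1), of "Suc i"] N \<eta>(3) by auto
  qed
  have outer: "c \<notin> S" if prems: "\<xi> \<in> ends" "\<xi> i \<in> A" "(\<xi> i, c) \<in> tedges T" for \<xi> i c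
  proof
    assume "c \<in> S"
    obtain \<eta> where \<eta>: "\<eta> \<in> ends" "\<forall>k \<le> i. \<eta> k = \<xi> k" "\<eta> (Suc i) = c"
      using ex_end_child[OF prems(1,3)] by blast
    then obtain N where N: "N \<ge> Suc i" "\<eta> N \<in> A"
      using mem[OF \<eta>(1), of "Suc i"] \<open>c \<in> S\<close> by auto
    have "\<eta> i \<in> A"
      using \<eta>(2) prems(2) by simp
    then have "N = i"
      using unique[OF \<eta>(1) N(2)] by blast
    then show False
      using N(1) by simp
  qed
  have AS: "A \<subseteq> S"
  proof
    fix x assume x: "x \<in> A"
    then obtain \<xi> i where "\<xi> \<in> ends" "\<xi> i = x"
      using verts ex_end_vertex by blast
    then show "x \<in> S"
      using mem[of \<xi> i] x by auto
  qed
  have "finite S"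
  proof -
    obtain n where n: "\<forall>\<xi> \<in> ends. \<forall>N. \<xi> N \<in> A \<longrightarrow> N \<le> n"
      using level_bound[OF fin] by blast
    have "S \<subseteq> (\<Union>i \<le> n. sphere i)"
      unfolding S_def sphere_def using n by force
    then show ?thesis
      using finite_sphere finite_subset by blast
  qed
  moreover have "troot T \<in> S"
  proof -
    obtain \<xi> where \<xi>: "\<xi> \<in> ends"
      using ends_nonempty by blast
    then have "\<xi> 0 \<in> S"
      using ex mem by simp
    then show ?thesis
      using ends_root[OF \<xi>] by simp
  qed
  moreover have "subtree T S"
    unfolding subtree_def
  proof (intro conjI ballI)
    show "S \<noteq> {}"
      using \<open>troot T \<in> S\<close> by blast
    show "S \<subseteq> tverts T"
      by (auto simp: S_def ends_vert)
    let ?R = "(tedges T \<union> (tedges T)\<inverse>) \<inter> S \<times> S"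
    have "sym ?R"
      by (auto simp: sym_def)
    then have sym: "sym (?R\<^sup>*)"
      by (rule sym_rtrancl)
    have root: "(troot T, \<xi> i) \<in> ?R\<^sup>*" if "\<xi> \<in> ends" "\<xi> i \<in> S" for \<xi> i
      using that(2)
    proof (induction i)
      case 0
      then show ?case
        using ends_root that(1) by simp
    next
      case (Suc i)
      then have "\<xi> i \<in> S"
        using mem[OF that(1), of i] mem[OF that(1), of "Suc i"] Suc_leD by auto
      then have "(troot T, \<xi> i) \<in> ?R\<^sup>*" "(\<xi> i, \<xi> (Suc i)) \<in> ?R"
        using Suc ends_edge[OF that(1)] by auto
      then show ?case
        by (rule rtrancl.rtrancl_into_rtrancl)
    qed
    fix x y assume "x \<in> S" "y \<in> S"
    then obtain \<xi> i \<eta> j where "\<xi> \<in> ends" "x = \<xi> i" "\<eta> \<in> ends" "y = \<eta> j"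
      using on_end by meson
    then have "(troot T, x) \<in> ?R\<^sup>*" and y: "(troot T, y) \<in> ?R\<^sup>*"
      using root[of \<xi> i] root[of \<eta> j] \<open>x \<in> S\<close> \<open>y \<in> S\<close> by simp_all
    then have "(x, troot T) \<in> ?R\<^sup>*"
      using symD[OF sym] by simp
    from this y show "(x, y) \<in> ?R\<^sup>*"
      by (rule rtrancl_trans)
  qed
  moreover have "children T v \<subseteq> S \<or> children T v \<inter> S = {}" if v: "v \<in> S" for v
  proof -
    obtain \<xi> i where \<xi>: "\<xi> \<in> ends" "v = \<xi> i"
      using on_end[OF v] by blast
    show ?thesis
    proof (cases "v \<in> A")
      case True
      then have "children T v \<inter> S = {}"
        using outer[OF \<xi>(1), of i] \<xi>(2) by (auto simp: children_def)
      then show ?thesis ..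
    next
      case False
      then have "children T v \<subseteq> S"
        using inner[OF \<xi>(1), of i] \<xi>(2) v by (auto simp: children_def)
      then show ?thesis ..
    qed
  qed
  ultimately have "finite_complete_subtree T S"
    by (simp add: finite_complete_subtree_def)
  moreover have "leaves T S = A"
  proof
    show "A \<subseteq> leaves T S"
    proof
      fix x assume x: "x \<in> A"
      then obtain \<xi> i where "\<xi> \<in> ends" "\<xi> i = x"
        using verts ex_end_vertex by blast
      then show "x \<in> leaves T S"
        using x AS outer[of \<xi> i] by (auto simp: leaves_def children_def)
    qed
    show "leaves T S \<subseteq> A"
    proof
      fix x assume x: "x \<in> leaves T S"
      then obtain \<xi> i where \<xi>: "\<xi> \<in> ends" "x = \<xi> i"
        using on_end[of x] leaf_subset by blast
      show "x \<in> A"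
      proof (rule ccontr)
        assume "x \<notin> A"
        then have "\<xi> (Suc i) \<in> S"
          using inner[OF \<xi>(1), of i] ends_edge[OF \<xi>(1)] x \<xi>(2) leaf_subset by blast
        then show False
          using leaf_Suc[OF \<xi>(1)] x \<xi>(2) by blast
      qed
    qed
  qed
  ultimately show ?thesis
    by blast
qed

text \<open>
  Every end has exactly one vertex of depth \<open>n\<close>; the subtree is the ball of radius \<open>n\<close>.
\<close>

lemma ex_ball: "\<exists>S. finite_complete_subtree T S \<and> leaves T S = sphere n"
proof (rule ex_complete_subtree_with_leaves[OF finite_sphere])
  have level: "N = n" if "\<xi> \<in> ends" "\<xi> N \<in> sphere n" for \<xi> N
    using that ends_level[OF that(1)] by (auto simp: sphere_def)
  show "N = M" if "\<xi> \<in> ends" "\<xi> N \<in> sphere n" "\<xi> M \<in> sphere n" for \<xi> N M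
    using that level by blast
qed (auto simp: sphere_def ends_vert)

section \<open>Locally tree-like permutations of the ends\<close>

text \<open>
  This says that \<open>g\<close> comes from an isomorphism of the tree below \<open>\<xi> n\<close> onto the tree below \<open>g \<xi> m\<close>. A
  vertex of depth \<open>n + j\<close> is a class of ends that agree up to this depth, so no map on vertices is
  needed, and composition, inversion and restriction become statements about \<open>g\<close> alone.
\<close>

definition tree_like :: "((nat \<Rightarrow> 'v) \<Rightarrow> nat \<Rightarrow> 'v) \<Rightarrow> nat \<Rightarrow> nat \<Rightarrow> (nat \<Rightarrow> 'v) \<Rightarrow> bool" where
  "tree_like g n m \<xi> \<longleftrightarrow> g ` cyl n (\<xi> n) = cyl m (g \<xi> m) \<and>
     (\<forall>\<eta> \<in> cyl n (\<xi> n). \<forall>\<eta>' \<in> cyl n (\<xi> n). \<forall>j.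
        \<eta> (n + j) = \<eta>' (n + j) \<longleftrightarrow> g \<eta> (m + j) = g \<eta>' (m + j))"

lemma tree_like_image: "tree_like g n m \<xi> \<Longrightarrow> g ` cyl n (\<xi> n) = cyl m (g \<xi> m)"
  by (simp add: tree_like_def)

lemma tree_like_iff:
  "\<lbrakk>tree_like g n m \<xi>; \<eta> \<in> ends; \<eta> n = \<xi> n; \<eta>' \<in> ends; \<eta>' n = \<xi> n\<rbrakk> \<Longrightarrow>
    \<eta> (n + j) = \<eta>' (n + j) \<longleftrightarrow> g \<eta> (m + j) = g \<eta>' (m + j)"
  by (simp add: tree_like_def)

lemma tree_like_base:
  "\<lbrakk>tree_like g n m \<xi>; \<xi> \<in> ends; \<eta> \<in> ends; \<eta> n = \<xi> n\<rbrakk> \<Longrightarrow> g \<eta> m = g \<xi> m"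
  using tree_like_iff[of g n m \<xi> \<eta> \<xi> 0] by simp

lemma tree_like_cong_end:
  assumes "tree_like g n m \<xi>" "\<xi> \<in> ends" "\<eta> \<in> ends" "\<eta> n = \<xi> n"
  shows "tree_like g n m \<eta>"
  using assms tree_like_base[OF assms] by (simp add: tree_like_def)

lemma tree_like_cong_map:
  assumes "tree_like g n m \<xi>" "\<xi> \<in> ends" "\<And>\<eta>. \<eta> \<in> cyl n (\<xi> n) \<Longrightarrow> g \<eta> = h \<eta>"
  shows "tree_like h n m \<xi>"
proof -
  have "g ` cyl n (\<xi> n) = h ` cyl n (\<xi> n)"
    using assms(3) by (intro image_cong) auto
  moreover have "g \<xi> = h \<xi>"
    using assms(2,3) by simp
  ultimately show ?thesis
    using assms by (simp add: tree_like_def)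
qed

lemma tree_like_id: "tree_like id n n \<xi>"
  by (simp add: tree_like_def)

lemma tree_like_comp:
  assumes h: "tree_like h n m \<xi>" and g: "tree_like g m k (h \<xi>)"
  shows "tree_like (g \<circ> h) n k \<xi>"
  unfolding tree_like_def
proof (intro conjI ballI allI)
  show "(g \<circ> h) ` cyl n (\<xi> n) = cyl k ((g \<circ> h) \<xi> k)"
    unfolding image_comp[symmetric] tree_like_image[OF h] tree_like_image[OF g] by simp
  fix \<eta> \<eta>' j assume \<eta>: "\<eta> \<in> cyl n (\<xi> n)" "\<eta>' \<in> cyl n (\<xi> n)"
  have "h \<eta> \<in> cyl m (h \<xi> m)" "h \<eta>' \<in> cyl m (h \<xi> m)"
    using \<eta> tree_like_image[OF h] by blast+
  then show "\<eta> (n + j) = \<eta>' (n + j) \<longleftrightarrow> (g \<circ> h) \<eta> (k + j) = (g \<circ> h) \<eta>' (k + j)"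
    using \<eta> tree_like_iff[OF h, of \<eta> \<eta>' j] tree_like_iff[OF g, of "h \<eta>" "h \<eta>'" j] by simp
qed

lemma tree_like_inv:
  assumes g: "g permutes ends" and tl: "tree_like g n m \<xi>"
  shows "tree_like (perm_inv g) m n (g \<xi>)"
  unfolding tree_like_def
proof (intro conjI ballI allI)
  note inv_g = permutes_inverses[OF g]
  show "perm_inv g ` cyl m (g \<xi> m) = cyl n (perm_inv g (g \<xi>) n)"
    using tree_like_image[OF tl, symmetric] by (simp add: image_comp o_def inv_g)
  fix \<eta> \<eta>' j assume "\<eta> \<in> cyl m (g \<xi> m)" "\<eta>' \<in> cyl m (g \<xi> m)"
  then obtain \<zeta> \<zeta>' where "\<zeta> \<in> cyl n (\<xi> n)" "\<zeta>' \<in> cyl n (\<xi> n)" "\<eta> = g \<zeta>" "\<eta>' = g \<zeta>'"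
    using tree_like_image[OF tl] by blast
  then show "\<eta> (m + j) = \<eta>' (m + j) \<longleftrightarrow> perm_inv g \<eta> (n + j) = perm_inv g \<eta>' (n + j)"
    using tree_like_iff[OF tl, of \<zeta> \<zeta>' j] by (simp add: inv_g)
qed

lemma tree_like_shift:
  assumes g: "g permutes ends" and \<xi>: "\<xi> \<in> ends" and tl: "tree_like g n m \<xi>"
  shows "tree_like g (n + i) (m + i) \<xi>"
  unfolding tree_like_def
proof (intro conjI ballI allI)
  have g_ends: "g \<eta> \<in> ends" if "\<eta> \<in> ends" for \<eta>
    using permutes_in_image[OF g] that by simp
  have base: "\<eta> n = \<xi> n" if "\<eta> \<in> cyl (n + i) (\<xi> (n + i))" for \<eta>
    using that ends_agree[of \<eta> \<xi> "n + i" n] \<xi> by simp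
  show "g ` cyl (n + i) (\<xi> (n + i)) = cyl (m + i) (g \<xi> (m + i))"
  proof
    show "g ` cyl (n + i) (\<xi> (n + i)) \<subseteq> cyl (m + i) (g \<xi> (m + i))"
      using tree_like_iff[OF tl _ _ \<xi> refl, of _ i] base g_ends by fastforce
    show "cyl (m + i) (g \<xi> (m + i)) \<subseteq> g ` cyl (n + i) (\<xi> (n + i))"
    proof
      fix \<zeta> assume \<zeta>: "\<zeta> \<in> cyl (m + i) (g \<xi> (m + i))"
      then have "\<zeta> \<in> cyl m (g \<xi> m)"
        using ends_agree[of \<zeta> "g \<xi>" "m + i" m] \<xi> g_ends by simp
      then obtain \<eta> where \<eta>: "\<eta> \<in> cyl n (\<xi> n)" "\<zeta> = g \<eta>"
        using tree_like_image[OF tl] by blast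
      then have "\<eta> (n + i) = \<xi> (n + i)"
        using tree_like_iff[OF tl _ _ \<xi> refl, of \<eta> i] \<zeta> by simp
      then show "\<zeta> \<in> g ` cyl (n + i) (\<xi> (n + i))"
        using \<eta> by auto
    qed
  qed
  fix \<eta> \<eta>' j assume \<eta>: "\<eta> \<in> cyl (n + i) (\<xi> (n + i))" "\<eta>' \<in> cyl (n + i) (\<xi> (n + i))"
  then show "\<eta> (n + i + j) = \<eta>' (n + i + j) \<longleftrightarrow> g \<eta> (m + i + j) = g \<eta>' (m + i + j)"
    using tree_like_iff[OF tl, of \<eta> \<eta>' "i + j"] base[OF \<eta>(1)] base[OF \<eta>(2)]
    by (simp add: add.assoc)
qed

text \<open>
  The depth \<open>m\<close> can be read off from \<open>g\<close>: two ends that separate just below a branching vertex have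
  images that separate at a depth determined by \<open>m\<close>.
\<close>

lemma tree_like_unique:
  assumes g: "g permutes ends" and \<xi>: "\<xi> \<in> ends"
    and tl: "tree_like g n m \<xi>" "tree_like g n m' \<xi>"
  shows "m = m'"
proof -
  have "\<not> m < m'" if tl: "tree_like g n m \<xi>" "tree_like g n m' \<xi>" for m m'
  proof
    assume "m < m'"
    obtain \<eta> \<eta>' j where \<eta>: "\<eta> \<in> ends" "\<eta>' \<in> ends" "\<eta> n = \<xi> n" "\<eta>' n = \<xi> n"
        "\<eta> (n + j) = \<eta>' (n + j)" "\<eta> (Suc (n + j)) \<noteq> \<eta>' (Suc (n + j))"
      using ex_branching[OF \<xi>] by blast
    have "g \<eta> (m' + j) = g \<eta>' (m' + j)"
      using tree_like_iff[OF tl(2), of \<eta> \<eta>' j] \<eta> by simp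
    moreover have "g \<eta> \<in> ends" "g \<eta>' \<in> ends"
      using \<eta> permutes_in_image[OF g] by auto
    ultimately have "g \<eta> (m + Suc j) = g \<eta>' (m + Suc j)"
      using \<open>m < m'\<close> ends_agree[of "g \<eta>" "g \<eta>'" "m' + j" "m + Suc j"] by simp
    then show False
      using tree_like_iff[OF tl(1), of \<eta> \<eta>' "Suc j"] \<eta> by simp
  qed
  then show ?thesis
    using tl by (metis nat_neq_iff)
qed

section \<open>Almost automorphisms as permutations of the ends\<close>

lemma honest_iff:
  "(S1, S2, \<phi>) \<in> honest_almost_automorphisms T \<longleftrightarrow>
     finite_complete_subtree T S1 \<and> finite_complete_subtree T S2 \<and>
     \<phi> \<in> extensional (forest T S1) \<and> bij_betw \<phi> (forest T S1) (forest T S2) \<and>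
     (\<forall>x \<in> forest T S1. \<forall>y \<in> forest T S1. (x, y) \<in> tedges T \<longleftrightarrow> (\<phi> x, \<phi> y) \<in> tedges T)"
  by (simp add: honest_almost_automorphisms_def)

definition follows :: "'v honest \<Rightarrow> (nat \<Rightarrow> 'v) \<Rightarrow> (nat \<Rightarrow> 'v) \<Rightarrow> bool" where
  "follows = (\<lambda>(S1, S2, \<phi>) \<xi> \<eta>.
     \<exists>N M. \<xi> N \<in> leaves T S1 \<and> \<eta> M \<in> leaves T S2 \<and> (\<forall>j. \<eta> (M + j) = \<phi> (\<xi> (N + j))))"

definition induces :: "'v honest \<Rightarrow> ((nat \<Rightarrow> 'v) \<Rightarrow> nat \<Rightarrow> 'v) \<Rightarrow> bool" where
  "induces p g \<longleftrightarrow> g permutes ends \<and> (\<forall>\<xi> \<in> ends. follows p \<xi> (g \<xi>))"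

lemma followsD:
  "follows (S1, S2, \<phi>) \<xi> \<eta> \<Longrightarrow>
    \<exists>N M. \<xi> N \<in> leaves T S1 \<and> \<eta> M \<in> leaves T S2 \<and> (\<forall>j. \<eta> (M + j) = \<phi> (\<xi> (N + j)))"
  unfolding follows_def by simp

lemma followsI:
  "\<lbrakk>\<xi> N \<in> leaves T S1; \<eta> M \<in> leaves T S2; \<And>j. \<eta> (M + j) = \<phi> (\<xi> (N + j))\<rbrakk> \<Longrightarrow>
    follows (S1, S2, \<phi>) \<xi> \<eta>"
  unfolding follows_def by auto

lemma leaf_in_forest: "x \<in> leaves T S \<Longrightarrow> x \<in> forest T S"
  by (auto simp: forest_def descendants_def)

text \<open>
  The leaves are the vertices of the forest that have no parent in it.
\<close>

lemma honest_leaf: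
  assumes p: "(S1, S2, \<phi>) \<in> honest_almost_automorphisms T" and x: "x \<in> leaves T S1"
  shows "\<phi> x \<in> leaves T S2"
proof -
  have S1: "finite_complete_subtree T S1" and S2: "finite_complete_subtree T S2"
    and bij: "bij_betw \<phi> (forest T S1) (forest T S2)"
    and edges: "\<And>x y. \<lbrakk>x \<in> forest T S1; y \<in> forest T S1\<rbrakk> \<Longrightarrow> (x, y) \<in> tedges T \<longleftrightarrow> (\<phi> x, \<phi> y) \<in> tedges T"
    using p by (auto simp: honest_iff)
  have xf: "x \<in> forest T S1"
    by (rule leaf_in_forest[OF x])
  then have "\<phi> x \<in> forest T S2"
    using bij by (auto simp: bij_betw_def)
  then obtain \<zeta> K j where \<zeta>: "\<zeta> \<in> ends" "\<zeta> K \<in> leaves T S2" "\<phi> x = \<zeta> (K + j)"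
    using forestE[OF S2] by blast
  show ?thesis
  proof (cases j)
    case 0
    then show ?thesis
      using \<zeta> by simp
  next
    case (Suc i)
    have "\<zeta> (K + i) \<in> \<phi> ` forest T S1"
      using forestI[OF \<zeta>(1,2)] bij by (auto simp: bij_betw_def)
    then obtain z where z: "z \<in> forest T S1" "\<phi> z = \<zeta> (K + i)"
      by fastforce
    have "(\<phi> z, \<phi> x) \<in> tedges T"
      using ends_edge[OF \<zeta>(1), of "K + i"] z \<zeta>(3) Suc by simp
    then have zx: "(z, x) \<in> tedges T"
      using edges z xf by blast
    obtain \<eta> N k where \<eta>: "\<eta> \<in> ends" "\<eta> N \<in> leaves T S1" "z = \<eta> (N + k)"
      using forestE[OF S1 z(1)] by blast
    obtain \<eta>' where \<eta>': "\<eta>' \<in> ends" "\<forall>i \<le> N + k. \<eta>' i = \<eta> i" "\<eta>' (Suc (N + k)) = x"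
      using ex_end_child[of \<eta> "N + k" x] \<eta> zx by auto
    have "N = Suc (N + k)"
      using leaf_unique[OF S1 \<eta>'(1)] \<eta>'(2,3) \<eta>(2) x by simp
    then show ?thesis
      by simp
  qed
qed

lemma follows_total:
  assumes p: "(S1, S2, \<phi>) \<in> honest_almost_automorphisms T" and \<xi>: "\<xi> \<in> ends"
  shows "\<exists>\<eta> \<in> ends. follows (S1, S2, \<phi>) \<xi> \<eta>"
proof -
  have S1: "finite_complete_subtree T S1" and S2: "finite_complete_subtree T S2"
    and edges: "\<And>x y. \<lbrakk>x \<in> forest T S1; y \<in> forest T S1\<rbrakk> \<Longrightarrow> (x, y) \<in> tedges T \<longleftrightarrow> (\<phi> x, \<phi> y) \<in> tedges T"
    using p by (auto simp: honest_iff)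
  obtain N where N: "\<xi> N \<in> leaves T S1"
    using ex_leaf[OF S1 \<xi>] by blast
  have leaf: "\<phi> (\<xi> N) \<in> leaves T S2"
    by (rule honest_leaf[OF p N])
  then obtain \<zeta> M where \<zeta>: "\<zeta> \<in> ends" "\<zeta> M = \<phi> (\<xi> N)"
    using ex_end_vertex leaf_vert[OF S2] by blast
  have "\<exists>\<eta> \<in> ends. (\<forall>i \<le> M. \<eta> i = \<zeta> i) \<and> (\<forall>k. \<eta> (M + k) = \<phi> (\<xi> (N + k)))"
  proof (rule splice[OF \<zeta>(1)])
    show "\<phi> (\<xi> (N + 0)) = \<zeta> M"
      using \<zeta> by simp
    show "(\<phi> (\<xi> (N + k)), \<phi> (\<xi> (N + Suc k))) \<in> tedges T" for k
      using edges[OF forestI[OF \<xi> N, of k] forestI[OF \<xi> N, of "Suc k"]] ends_edge[OF \<xi>, of "N + k"]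
      by simp
  qed
  then obtain \<eta> where \<eta>: "\<eta> \<in> ends" "\<forall>i \<le> M. \<eta> i = \<zeta> i" "\<forall>k. \<eta> (M + k) = \<phi> (\<xi> (N + k))"
    by blast
  have "follows (S1, S2, \<phi>) \<xi> \<eta>"
    by (rule followsI[where N = N and M = M]) (use N \<eta> \<zeta> leaf in auto)
  then show ?thesis
    using \<eta>(1) by blast
qed

lemma follows_unique:
  assumes S1: "finite_complete_subtree T S1" and \<xi>: "\<xi> \<in> ends" and \<eta>: "\<eta> \<in> ends" "\<eta>' \<in> ends"
    and f: "follows (S1, S2, \<phi>) \<xi> \<eta>" "follows (S1, S2', \<phi>) \<xi> \<eta>'"
  shows "\<eta> = \<eta>'"
proof -
  obtain N M where N: "\<xi> N \<in> leaves T S1" "\<forall>j. \<eta> (M + j) = \<phi> (\<xi> (N + j))"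
    using followsD[OF f(1)] by blast
  obtain N' M' where N': "\<xi> N' \<in> leaves T S1" "\<forall>j. \<eta>' (M' + j) = \<phi> (\<xi> (N' + j))"
    using followsD[OF f(2)] by blast
  have NN: "N = N'"
    using leaf_unique[OF S1 \<xi> N(1) N'(1)] .
  have "M = M'"
    using ends_level[OF \<eta>, of M M'] N(2)[rule_format, of 0] N'(2)[rule_format, of 0] NN by simp
  then show ?thesis
    using ends_eqI[OF \<eta>, of M] N(2) N'(2) NN by simp
qed

lemma honest_inverse:
  assumes p: "(S1, S2, \<phi>) \<in> honest_almost_automorphisms T"
  defines "\<psi> \<equiv> restrict (inv_into (forest T S1) \<phi>) (forest T S2)"
  shows "(S2, S1, \<psi>) \<in> honest_almost_automorphisms T"
    and "\<And>\<xi> \<eta>. \<lbrakk>\<xi> \<in> ends; \<eta> \<in> ends\<rbrakk> \<Longrightarrow> follows (S2, S1, \<psi>) \<eta> \<xi> \<longleftrightarrow> follows (S1, S2, \<phi>) \<xi> \<eta>"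
proof -
  have S1: "finite_complete_subtree T S1" and S2: "finite_complete_subtree T S2"
    and bij: "bij_betw \<phi> (forest T S1) (forest T S2)"
    and edges: "\<And>x y. \<lbrakk>x \<in> forest T S1; y \<in> forest T S1\<rbrakk> \<Longrightarrow> (x, y) \<in> tedges T \<longleftrightarrow> (\<phi> x, \<phi> y) \<in> tedges T"
    using p by (auto simp: honest_iff)
  have l: "\<psi> (\<phi> x) = x" if "x \<in> forest T S1" for x
    using that bij by (auto simp: \<psi>_def bij_betw_def inv_into_f_f)
  have r: "\<phi> (\<psi> y) = y" "\<psi> y \<in> forest T S1" if "y \<in> forest T S2" for y
  proof -
    have "y \<in> \<phi> ` forest T S1"
      using that bij by (simp add: bij_betw_def)
    then show "\<phi> (\<psi> y) = y" "\<psi> y \<in> forest T S1"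
      using that by (auto simp: \<psi>_def f_inv_into_f inv_into_into)
  qed
  have "bij_betw \<psi> (forest T S2) (forest T S1)"
    using bij_betw_inv_into[OF bij] by (simp add: \<psi>_def bij_betw_restrict_eq)
  moreover have "(x, y) \<in> tedges T \<longleftrightarrow> (\<psi> x, \<psi> y) \<in> tedges T"
    if "x \<in> forest T S2" "y \<in> forest T S2" for x y
    using edges[OF r(2)[OF that(1)] r(2)[OF that(2)]] r(1) that by simp
  ultimately show h: "(S2, S1, \<psi>) \<in> honest_almost_automorphisms T"
    using S1 S2 by (simp add: honest_iff \<psi>_def)
  fix \<xi> \<eta> assume \<xi>: "\<xi> \<in> ends" and \<eta>: "\<eta> \<in> ends"
  show "follows (S2, S1, \<psi>) \<eta> \<xi> \<longleftrightarrow> follows (S1, S2, \<phi>) \<xi> \<eta>"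
  proof
    assume "follows (S2, S1, \<psi>) \<eta> \<xi>"
    then obtain N M where N: "\<eta> N \<in> leaves T S2" "\<xi> M \<in> leaves T S1" "\<forall>j. \<xi> (M + j) = \<psi> (\<eta> (N + j))"
      using followsD by blast
    show "follows (S1, S2, \<phi>) \<xi> \<eta>"
      by (rule followsI[where N = M and M = N]) (use N in \<open>auto simp: r(1) forestI[OF \<eta> N(1)]\<close>)
  next
    assume "follows (S1, S2, \<phi>) \<xi> \<eta>"
    then obtain N M where N: "\<xi> N \<in> leaves T S1" "\<eta> M \<in> leaves T S2" "\<forall>j. \<eta> (M + j) = \<phi> (\<xi> (N + j))"
      using followsD by blast
    show "follows (S2, S1, \<psi>) \<eta> \<xi>"
      by (rule followsI[where N = M and M = N]) (use N in \<open>auto simp: l forestI[OF \<xi> N(1)]\<close>)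
  qed
qed

lemma ex_induces:
  assumes p: "p \<in> honest_almost_automorphisms T"
  shows "\<exists>g. induces p g"
proof -
  obtain S1 S2 \<phi> where pdef: "p = (S1, S2, \<phi>)"
    by (cases p)
  note p = p[unfolded pdef]
  define \<psi> where "\<psi> = restrict (inv_into (forest T S1) \<phi>) (forest T S2)"
  note inv = honest_inverse[OF p, folded \<psi>_def]
  have S1: "finite_complete_subtree T S1" and S2: "finite_complete_subtree T S2"
    using p by (auto simp: honest_iff)
  define g where "g \<xi> = (if \<xi> \<in> ends then SOME \<eta>. \<eta> \<in> ends \<and> follows p \<xi> \<eta> else \<xi>)" for \<xi>
  have g: "g \<xi> \<in> ends \<and> follows p \<xi> (g \<xi>)" if "\<xi> \<in> ends" for \<xi>
  proof -
    have "\<exists>\<eta>. \<eta> \<in> ends \<and> follows p \<xi> \<eta>"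
      using follows_total[OF p that] pdef by blast
    then have "(SOME \<eta>. \<eta> \<in> ends \<and> follows p \<xi> \<eta>) \<in> ends \<and>
        follows p \<xi> (SOME \<eta>. \<eta> \<in> ends \<and> follows p \<xi> \<eta>)"
      by (rule someI_ex)
    then show ?thesis
      unfolding g_def using that by simp
  qed
  have "bij_betw g ends ends"
    unfolding bij_betw_def
  proof
    show "inj_on g ends"
    proof (rule inj_onI)
      fix \<xi> \<xi>' assume \<xi>: "\<xi> \<in> ends" "\<xi>' \<in> ends" "g \<xi> = g \<xi>'"
      then have "follows (S2, S1, \<psi>) (g \<xi>) \<xi>" "follows (S2, S1, \<psi>) (g \<xi>) \<xi>'"
        using g inv(2) pdef by metis+
      then show "\<xi> = \<xi>'"
        using follows_unique[OF S2 _ \<xi>(1,2)] g \<xi>(1) by blast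
    qed
    show "g ` ends = ends"
    proof
      show "g ` ends \<subseteq> ends"
        using g by blast
      show "ends \<subseteq> g ` ends"
      proof
        fix \<eta> assume \<eta>: "\<eta> \<in> ends"
        then obtain \<xi> where \<xi>: "\<xi> \<in> ends" "follows (S2, S1, \<psi>) \<eta> \<xi>"
          using follows_total[OF inv(1)] by blast
        then have "follows (S1, S2, \<phi>) \<xi> \<eta>"
          using inv(2) \<eta> by blast
        then have "\<eta> = g \<xi>"
          using follows_unique[OF S1 \<xi>(1) \<eta>] g[OF \<xi>(1)] pdef by blast
        then show "\<eta> \<in> g ` ends"
          using \<xi>(1) by blast
      qed
    qed
  qed
  then have "g permutes ends"
    by (rule bij_imp_permutes) (simp add: g_def)
  then show ?thesis
    using g by (auto simp: induces_def)
qed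

lemma induces_tree_like:
  assumes p: "(S1, S2, \<phi>) \<in> honest_almost_automorphisms T" and g: "induces (S1, S2, \<phi>) g"
    and \<xi>: "\<xi> \<in> ends" "\<xi> N \<in> leaves T S1"
  shows "\<exists>M. g \<xi> M \<in> leaves T S2 \<and> tree_like g N M \<xi> \<and>
    (\<forall>\<eta> \<in> cyl N (\<xi> N). \<forall>j. g \<eta> (M + j) = \<phi> (\<eta> (N + j)))"
proof -
  have S1: "finite_complete_subtree T S1" and S2: "finite_complete_subtree T S2"
    and inj: "inj_on \<phi> (forest T S1)"
    using p by (auto simp: honest_iff bij_betw_def)
  have perm: "g permutes ends" and fol: "\<And>\<xi>. \<xi> \<in> ends \<Longrightarrow> follows (S1, S2, \<phi>) \<xi> (g \<xi>)"
    using g by (auto simp: induces_def)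
  have g_ends: "g \<eta> \<in> ends" if "\<eta> \<in> ends" for \<eta>
    using permutes_in_image[OF perm] that by simp
  have at: "\<exists>M. g \<eta> M \<in> leaves T S2 \<and> (\<forall>j. g \<eta> (M + j) = \<phi> (\<eta> (N + j)))"
    if \<eta>: "\<eta> \<in> ends" "\<eta> N \<in> leaves T S1" for \<eta> N
  proof -
    obtain N' M where N': "\<eta> N' \<in> leaves T S1" "g \<eta> M \<in> leaves T S2"
        "\<forall>j. g \<eta> (M + j) = \<phi> (\<eta> (N' + j))"
      using followsD[OF fol[OF \<eta>(1)]] by blast
    then have "N = N'"
      using leaf_unique[OF S1 \<eta>] by blast
    then show ?thesis
      using N' by blast
  qed
  obtain M where M: "g \<xi> M \<in> leaves T S2" "\<forall>j. g \<xi> (M + j) = \<phi> (\<xi> (N + j))"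
    using at[OF \<xi>] by blast
  have formula: "g \<eta> (M + j) = \<phi> (\<eta> (N + j))" if \<eta>: "\<eta> \<in> ends" "\<eta> N = \<xi> N" for \<eta> j
  proof -
    obtain M' where M': "\<forall>j. g \<eta> (M' + j) = \<phi> (\<eta> (N + j))"
      using at[OF \<eta>(1), of N] \<eta>(2) \<xi>(2) by auto
    have "g \<eta> M' = g \<xi> M"
      using M'[rule_format, of 0] M(2)[rule_format, of 0] \<eta>(2) by simp
    then have "M' = M"
      using ends_level[OF g_ends g_ends] \<eta>(1) \<xi>(1) by blast
    then show ?thesis
      using M' by blast
  qed
  have "tree_like g N M \<xi>"
    unfolding tree_like_def
  proof (intro conjI ballI allI)
    show "g ` cyl N (\<xi> N) = cyl M (g \<xi> M)"
    proof
      show "g ` cyl N (\<xi> N) \<subseteq> cyl M (g \<xi> M)"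
        using formula[of _ 0] M(2)[rule_format, of 0] g_ends by auto
      show "cyl M (g \<xi> M) \<subseteq> g ` cyl N (\<xi> N)"
      proof
        fix \<zeta> assume \<zeta>: "\<zeta> \<in> cyl M (g \<xi> M)"
        then have "\<zeta> \<in> g ` ends"
          using permutes_image[OF perm] by simp
        then obtain \<eta> where \<eta>: "\<eta> \<in> ends" "\<zeta> = g \<eta>"
          by blast
        obtain K where K: "\<eta> K \<in> leaves T S1"
          using ex_leaf[OF S1 \<eta>(1)] by blast
        obtain M' where M': "g \<eta> M' \<in> leaves T S2" "\<forall>j. g \<eta> (M' + j) = \<phi> (\<eta> (K + j))"
          using at[OF \<eta>(1) K] by blast
        have "g \<eta> M \<in> leaves T S2"
          using \<zeta> \<eta>(2) M(1) by simp
        then have "M' = M"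
          using leaf_unique[OF S2 g_ends[OF \<eta>(1)] M'(1)] by blast
        then have "\<phi> (\<eta> K) = \<phi> (\<xi> N)"
          using M'(2)[rule_format, of 0] M(2)[rule_format, of 0] \<zeta> \<eta>(2) by simp
        then have "\<eta> K = \<xi> N"
          using inj_onD[OF inj] leaf_in_forest K \<xi>(2) by blast
        then have "\<eta> N = \<xi> N"
          using ends_level[OF \<eta>(1) \<xi>(1)] by blast
        then show "\<zeta> \<in> g ` cyl N (\<xi> N)"
          using \<eta> by auto
      qed
    qed
    fix \<eta> \<eta>' j assume \<eta>: "\<eta> \<in> cyl N (\<xi> N)" "\<eta>' \<in> cyl N (\<xi> N)"
    have "\<eta> (N + j) \<in> forest T S1" "\<eta>' (N + j) \<in> forest T S1"
      using \<eta> \<xi>(2) by (auto intro!: forestI)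
    then show "\<eta> (N + j) = \<eta>' (N + j) \<longleftrightarrow> g \<eta> (M + j) = g \<eta>' (M + j)"
      using \<eta> formula inj_onD[OF inj] by auto
  qed
  then show ?thesis
    using M(1) formula by (intro exI[of _ M]) simp
qed

lemma induces_unique:
  assumes p: "p \<in> honest_almost_automorphisms T" and g: "induces p g" "induces p h"
  shows "g = h"
proof
  fix \<xi>
  obtain S1 S2 \<phi> where pdef: "p = (S1, S2, \<phi>)"
    by (cases p)
  have S1: "finite_complete_subtree T S1"
    using p by (simp add: pdef honest_iff)
  have perm: "g permutes ends" "h permutes ends"
    using g by (auto simp: induces_def)
  show "g \<xi> = h \<xi>"
  proof (cases "\<xi> \<in> ends")
    case True
    moreover have "g \<xi> \<in> ends" "h \<xi> \<in> ends"
      using permutes_in_image[OF perm(1)] permutes_in_image[OF perm(2)] True by auto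
    ultimately show ?thesis
      using follows_unique[OF S1] g pdef unfolding induces_def by blast
  next
    case False
    then show ?thesis
      using perm by (simp add: permutes_not_in)
  qed
qed

lemma leaf_bound:
  assumes S: "finite_complete_subtree T S"
  shows "\<exists>n0. \<forall>n \<ge> n0. \<forall>\<xi> \<in> ends. \<exists>N \<le> n. \<xi> N \<in> leaves T S"
proof -
  have "finite S"
    using S by (simp add: finite_complete_subtree_def)
  then obtain n0 where n0: "\<forall>\<xi> \<in> ends. \<forall>N. \<xi> N \<in> S \<longrightarrow> N \<le> n0"
    using level_bound by blast
  have "\<exists>N \<le> n. \<xi> N \<in> leaves T S" if prems: "n \<ge> n0" "\<xi> \<in> ends" for n \<xi>
  proof -
    obtain N where N: "\<xi> N \<in> leaves T S"
      using ex_leaf[OF S prems(2)] by blast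
    then have "N \<le> n0"
      using n0 prems(2) leaf_subset by blast
    then show ?thesis
      using N prems(1) by (intro exI[of _ N]) simp
  qed
  then show ?thesis
    by blast
qed

lemma induces_tree_like_below:
  assumes p: "(S1, S2, \<phi>) \<in> honest_almost_automorphisms T" and g: "induces (S1, S2, \<phi>) g"
    and \<xi>: "\<xi> \<in> ends" "\<xi> N \<in> leaves T S1" "N \<le> n"
  shows "\<exists>m \<ge> n - N. tree_like g n m \<xi> \<and>
    (\<forall>\<eta> \<in> cyl n (\<xi> n). \<forall>j. g \<eta> (m + j) = \<phi> (\<eta> (n + j)))"
proof -
  obtain M where M: "tree_like g N M \<xi>"
    "\<forall>\<eta> \<in> cyl N (\<xi> N). \<forall>j. g \<eta> (M + j) = \<phi> (\<eta> (N + j))"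
    using induces_tree_like[OF p g \<xi>(1,2)] by blast
  have perm: "g permutes ends"
    using g by (simp add: induces_def)
  have "tree_like g n (M + (n - N)) \<xi>"
    using tree_like_shift[OF perm \<xi>(1) M(1), of "n - N"] \<xi>(3) by simp
  moreover have "g \<eta> (M + (n - N) + j) = \<phi> (\<eta> (n + j))" if \<eta>: "\<eta> \<in> cyl n (\<xi> n)" for \<eta> j
  proof -
    have "\<eta> \<in> cyl N (\<xi> N)"
      using \<eta> ends_agree[OF _ \<xi>(1), of \<eta> n N] \<xi>(3) by simp
    then have "g \<eta> (M + (n - N + j)) = \<phi> (\<eta> (N + (n - N + j)))"
      using M(2) by blast
    then show ?thesis
      using \<xi>(3) by (simp add: add.assoc)
  qed
  ultimately show ?thesis
    by (intro exI[of _ "M + (n - N)"]) simp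
qed

text \<open>
  An almost automorphism is the same as its action on the ends. If two representatives induce the same
  permutation, then on each branch far enough down they shift depth by the same amount, because the
  shift is determined by the permutation; hence they agree there.
\<close>

lemma honest_equiv_iff:
  assumes p: "p \<in> honest_almost_automorphisms T" and q: "q \<in> honest_almost_automorphisms T"
    and g: "induces p g" and h: "induces q h"
  shows "(p, q) \<in> honest_equiv T \<longleftrightarrow> g = h"
proof -
  obtain S1 S2 \<phi> where pdef: "p = (S1, S2, \<phi>)"
    by (cases p)
  obtain R1 R2 \<psi> where qdef: "q = (R1, R2, \<psi>)"
    by (cases q)
  note p = p[unfolded pdef] and q = q[unfolded qdef] and g = g[unfolded pdef] and h = h[unfolded qdef]
  have S1: "finite_complete_subtree T S1" and R1: "finite_complete_subtree T R1"
    using p q by (auto simp: honest_iff)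
  have perm: "g permutes ends" "h permutes ends"
    using g h by (auto simp: induces_def)
  show ?thesis
  proof
    assume "(p, q) \<in> honest_equiv T"
    then obtain S where S: "finite_complete_subtree T S" "S1 \<union> R1 \<subseteq> S" "\<forall>x \<in> forest T S. \<phi> x = \<psi> x"
      by (auto simp: honest_equiv_def pdef qdef)
    show "g = h"
    proof
      fix \<xi>
      show "g \<xi> = h \<xi>"
      proof (cases "\<xi> \<in> ends")
        case True
        obtain K N N' where K: "\<xi> K \<in> leaves T S" and N: "\<xi> N \<in> leaves T S1" and N': "\<xi> N' \<in> leaves T R1"
          using ex_leaf[OF S(1) True] ex_leaf[OF S1 True] ex_leaf[OF R1 True] by blast
        have "\<xi> N \<in> S" "\<xi> N' \<in> S"
          using N N' S(2) leaf_subset by blast+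
        then have NK: "N \<le> K" "N' \<le> K"
          using leaf_level_unique[OF S(1) True K] by auto
        have \<xi>: "\<xi> \<in> cyl K (\<xi> K)"
          using True by simp
        obtain m where m: "\<forall>j. g \<xi> (m + j) = \<phi> (\<xi> (K + j))"
          using induces_tree_like_below[OF p g True N NK(1)] \<xi> by blast
        obtain m' where m': "\<forall>j. h \<xi> (m' + j) = \<psi> (\<xi> (K + j))"
          using induces_tree_like_below[OF q h True N' NK(2)] \<xi> by blast
        have eq: "g \<xi> (m + j) = h \<xi> (m' + j)" for j
          using m m' S(3) forestI[OF True K] by simp
        have ends: "g \<xi> \<in> ends" "h \<xi> \<in> ends"
          using permutes_in_image[OF perm(1)] permutes_in_image[OF perm(2)] True by auto
        have "m = m'"
          using ends_level[OF ends, of m m'] eq[of 0] by simp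
        then show ?thesis
          using ends_eqI[OF ends, of m] eq by simp
      next
        case False
        then show ?thesis
          using perm by (simp add: permutes_not_in)
      qed
    qed
  next
    assume gh: "g = h"
    have "finite (S1 \<union> R1)"
      using S1 R1 by (simp add: finite_complete_subtree_def)
    then obtain n where n: "\<forall>\<xi> \<in> ends. \<forall>N. \<xi> N \<in> S1 \<union> R1 \<longrightarrow> N \<le> n"
      using level_bound by blast
    obtain S where S: "finite_complete_subtree T S" "leaves T S = sphere n"
      using ex_ball by blast
    have leaf: "\<xi> n \<in> leaves T S" if "\<xi> \<in> ends" for \<xi>
      using that S(2) by (simp add: sphere_def)
    have "S1 \<union> R1 \<subseteq> S"
    proof
      fix x assume x: "x \<in> S1 \<union> R1"
      then have "x \<in> tverts T"
        using S1 R1 by (auto simp: finite_complete_subtree_def subtree_def)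
      then obtain \<xi> i where \<xi>: "\<xi> \<in> ends" "\<xi> i = x"
        using ex_end_vertex by blast
      then have "i \<le> n"
        using n x by blast
      moreover have "\<xi> n \<in> S"
        using leaf[OF \<xi>(1)] leaf_subset by blast
      ultimately show "x \<in> S"
        using complete_subtree_closed[OF S(1) \<xi>(1), of n i] \<xi>(2) by simp
    qed
    moreover have "\<phi> x = \<psi> x" if x: "x \<in> forest T S" for x
    proof -
      obtain \<xi> K j where \<xi>: "\<xi> \<in> ends" "\<xi> K \<in> leaves T S" "x = \<xi> (K + j)"
        using forestE[OF S(1) x] by blast
      have K: "K = n"
        using leaf_unique[OF S(1) \<xi>(1,2) leaf[OF \<xi>(1)]] .
      obtain N N' where N: "\<xi> N \<in> leaves T S1" and N': "\<xi> N' \<in> leaves T R1"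
        using ex_leaf[OF S1 \<xi>(1)] ex_leaf[OF R1 \<xi>(1)] by blast
      have Nn: "N \<le> n" "N' \<le> n"
        using n N N' \<xi>(1) leaf_subset by blast+
      have \<xi>n: "\<xi> \<in> cyl n (\<xi> n)"
        using \<xi>(1) by simp
      obtain m where m: "tree_like g n m \<xi>" "\<forall>j. g \<xi> (m + j) = \<phi> (\<xi> (n + j))"
        using induces_tree_like_below[OF p g \<xi>(1) N Nn(1)] \<xi>n by blast
      obtain m' where m': "tree_like h n m' \<xi>" "\<forall>j. h \<xi> (m' + j) = \<psi> (\<xi> (n + j))"
        using induces_tree_like_below[OF q h \<xi>(1) N' Nn(2)] \<xi>n by blast
      have "m = m'"
        using tree_like_unique[OF perm(1) \<xi>(1) m(1)] m'(1) gh by blast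
      then show ?thesis
        using m(2) m'(2) gh K \<xi>(3) by simp
    qed
    ultimately show "(p, q) \<in> honest_equiv T"
      using S(1) p q by (auto simp: honest_equiv_def pdef qdef)
  qed
qed

text \<open>
  The leaves of the subtree removed from the range have to be the images \<open>g \<xi> m\<close>; they form a cut
  because \<open>g\<close> is a bijection of the ends that maps cylinders onto cylinders.
\<close>

lemma ex_representative:
  assumes perm: "g permutes ends" and S: "finite_complete_subtree T S"
    and tl: "\<And>\<xi> N. \<lbrakk>\<xi> \<in> ends; \<xi> N \<in> leaves T S\<rbrakk> \<Longrightarrow> \<exists>m. tree_like g N m \<xi>"
  shows "\<exists>S2 \<phi>. (S, S2, \<phi>) \<in> honest_almost_automorphisms T \<and> induces (S, S2, \<phi>) g \<and>
    (\<forall>\<xi> \<in> ends. \<forall>N m. \<xi> N \<in> leaves T S \<longrightarrow> tree_like g N m \<xi> \<longrightarrow>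
       g \<xi> m \<in> leaves T S2 \<and> (\<forall>j. \<phi> (\<xi> (N + j)) = g \<xi> (m + j)))"
proof -
  have g_ends: "g \<eta> \<in> ends" if "\<eta> \<in> ends" for \<eta>
    using permutes_in_image[OF perm] that by simp
  have "\<exists>m. \<forall>\<xi> \<in> ends. \<forall>N. \<xi> N = x \<longrightarrow> tree_like g N m \<xi>" if x: "x \<in> leaves T S" for x
  proof -
    obtain \<xi> N where \<xi>: "\<xi> \<in> ends" "\<xi> N = x"
      using ex_end_vertex leaf_vert[OF S x] by blast
    then obtain m where m: "tree_like g N m \<xi>"
      using tl[of \<xi> N] x by blast
    have "tree_like g K m \<eta>" if \<eta>: "\<eta> \<in> ends" "\<eta> K = x" for \<eta> K
    proof -
      have "K = N"
        using ends_level[OF \<eta>(1) \<xi>(1)] \<eta>(2) \<xi>(2) by simp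
      then show ?thesis
        using tree_like_cong_end[OF m \<xi>(1) \<eta>(1)] \<eta>(2) \<xi>(2) by simp
    qed
    then show ?thesis
      by blast
  qed
  then obtain lev where "\<forall>x \<in> leaves T S. \<forall>\<xi> \<in> ends. \<forall>N. \<xi> N = x \<longrightarrow> tree_like g N (lev x) \<xi>"
    by metis
  then have lev: "tree_like g N (lev (\<xi> N)) \<xi>" if "\<xi> \<in> ends" "\<xi> N \<in> leaves T S" for \<xi> N
    using that by blast
  \<comment> \<open>The graph of the isomorphism: the vertices of an end are sent to the vertices of its image.\<close>
  define R where "R x y \<longleftrightarrow> (\<exists>\<xi> \<in> ends. \<exists>N j. \<xi> N \<in> leaves T S \<and> x = \<xi> (N + j) \<and> y = g \<xi> (lev (\<xi> N) + j))" for x y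
  have R_unique: "y = y'" if "R x y" "R x y'" for x y y'
  proof -
    obtain \<xi> N j where 1: "\<xi> \<in> ends" "\<xi> N \<in> leaves T S" "x = \<xi> (N + j)" "y = g \<xi> (lev (\<xi> N) + j)"
      using \<open>R x y\<close> unfolding R_def by blast
    obtain \<eta> K i where 2: "\<eta> \<in> ends" "\<eta> K \<in> leaves T S" "x = \<eta> (K + i)" "y' = g \<eta> (lev (\<eta> K) + i)"
      using \<open>R x y'\<close> unfolding R_def by blast
    have "\<xi> (N + j) = \<eta> (K + i)"
      using 1(3) 2(3) by simp
    then have agree: "N + j = K + i" "\<And>k. k \<le> N + j \<Longrightarrow> \<xi> k = \<eta> k"
      using ends_unique[OF 1(1) 2(1)] by auto
    then have "\<eta> N = \<xi> N"
      by simp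
    then have NK: "N = K"
      using leaf_unique[OF S 2(1) _ 2(2), of N] 1(2) by simp
    then have "j = i"
      using agree(1) by simp
    then show ?thesis
      using tree_like_iff[OF lev[OF 1(1,2)] 1(1) refl 2(1) \<open>\<eta> N = \<xi> N\<close>, of j] 1 2 NK \<open>\<eta> N = \<xi> N\<close> by simp
  qed
  define \<phi> where "\<phi> = (\<lambda>x \<in> forest T S. SOME y. R x y)"
  have \<phi>: "\<phi> (\<xi> (N + j)) = g \<xi> (lev (\<xi> N) + j)" if \<xi>: "\<xi> \<in> ends" "\<xi> N \<in> leaves T S" for \<xi> N j
  proof -
    have R: "R (\<xi> (N + j)) (g \<xi> (lev (\<xi> N) + j))"
      unfolding R_def using \<xi> by blast
    then have "R (\<xi> (N + j)) (SOME y. R (\<xi> (N + j)) y)"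
      by (rule someI)
    then have "(SOME y. R (\<xi> (N + j)) y) = g \<xi> (lev (\<xi> N) + j)"
      using R_unique R by blast
    then show ?thesis
      using forestI[OF \<xi>] by (simp add: \<phi>_def)
  qed
  define A where "A = {g \<xi> (lev (\<xi> N)) | \<xi> N. \<xi> \<in> ends \<and> \<xi> N \<in> leaves T S}"
  have A_level: "\<exists>N. \<eta> N \<in> leaves T S \<and> k = lev (\<eta> N)" if \<eta>: "\<eta> \<in> ends" "g \<eta> k \<in> A" for \<eta> k
  proof -
    obtain \<xi> N where \<xi>: "g \<eta> k = g \<xi> (lev (\<xi> N))" "\<xi> \<in> ends" "\<xi> N \<in> leaves T S"
      using \<eta>(2) unfolding A_def by blast
    have k: "k = lev (\<xi> N)"
      using ends_level[OF g_ends[OF \<eta>(1)] g_ends[OF \<xi>(2)] \<xi>(1)] .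
    then have "g \<eta> \<in> cyl (lev (\<xi> N)) (g \<xi> (lev (\<xi> N)))"
      using g_ends[OF \<eta>(1)] \<xi>(1) by simp
    then obtain \<zeta> where "\<zeta> \<in> cyl N (\<xi> N)" "g \<eta> = g \<zeta>"
      using tree_like_image[OF lev[OF \<xi>(2,3)]] by blast
    then have "\<eta> N = \<xi> N"
      using injD[OF permutes_inj[OF perm]] by auto
    then show ?thesis
      using \<xi>(3) k by (intro exI[of _ N]) simp
  qed
  have A_mem: "g \<eta> (lev (\<eta> N)) \<in> A" if "\<eta> \<in> ends" "\<eta> N \<in> leaves T S" for \<eta> N
    using that by (auto simp: A_def)
  have surj: "\<exists>\<eta> \<in> ends. \<zeta> = g \<eta>" if "\<zeta> \<in> ends" for \<zeta>
    using that permutes_image[OF perm] by blast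
  have "\<exists>S2. finite_complete_subtree T S2 \<and> leaves T S2 = A"
  proof (rule ex_complete_subtree_with_leaves)
    have "A \<subseteq> \<phi> ` leaves T S"
    proof
      fix y assume "y \<in> A"
      then obtain \<xi> N where "\<xi> \<in> ends" "\<xi> N \<in> leaves T S" "y = g \<xi> (lev (\<xi> N))"
        unfolding A_def by blast
      then show "y \<in> \<phi> ` leaves T S"
        using \<phi>[of \<xi> N 0] by force
    qed
    moreover have "finite (leaves T S)"
      using S finite_subset[OF leaf_subset] by (auto simp: finite_complete_subtree_def)
    ultimately show "finite A"
      using finite_surj by blast
    show "A \<subseteq> tverts T"
      using g_ends ends_vert by (auto simp: A_def)
    show "\<exists>N. \<zeta> N \<in> A" if \<zeta>: "\<zeta> \<in> ends" for \<zeta>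
    proof -
      obtain \<eta> where \<eta>: "\<eta> \<in> ends" "\<zeta> = g \<eta>"
        using surj[OF \<zeta>] by blast
      obtain N where N: "\<eta> N \<in> leaves T S"
        using ex_leaf[OF S \<eta>(1)] by blast
      show ?thesis
        using A_mem[OF \<eta>(1) N] \<eta>(2) by blast
    qed
    show "N = M" if \<zeta>: "\<zeta> \<in> ends" "\<zeta> N \<in> A" "\<zeta> M \<in> A" for \<zeta> N M
    proof -
      obtain \<eta> where \<eta>: "\<eta> \<in> ends" "\<zeta> = g \<eta>"
        using surj[OF \<zeta>(1)] by blast
      obtain N' M' where "\<eta> N' \<in> leaves T S" "N = lev (\<eta> N')" "\<eta> M' \<in> leaves T S" "M = lev (\<eta> M')"
        using A_level[OF \<eta>(1), of N] A_level[OF \<eta>(1), of M] \<zeta>(2,3) \<eta>(2) by blast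
      then show ?thesis
        using leaf_unique[OF S \<eta>(1)] by blast
    qed
  qed
  then obtain S2 where S2: "finite_complete_subtree T S2" "leaves T S2 = A"
    by blast
  have inj: "inj_on \<phi> (forest T S)"
  proof (rule inj_onI)
    fix x x' assume x: "x \<in> forest T S" "x' \<in> forest T S" "\<phi> x = \<phi> x'"
    obtain \<xi> N j where 1: "\<xi> \<in> ends" "\<xi> N \<in> leaves T S" "x = \<xi> (N + j)"
      using forestE[OF S x(1)] by blast
    obtain \<eta> K i where 2: "\<eta> \<in> ends" "\<eta> K \<in> leaves T S" "x' = \<eta> (K + i)"
      using forestE[OF S x(2)] by blast
    have eq: "g \<xi> (lev (\<xi> N) + j) = g \<eta> (lev (\<eta> K) + i)"
      using x(3) \<phi>[OF 1(1,2)] \<phi>[OF 2(1,2)] 1(3) 2(3) by simp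
    have lev_eq: "lev (\<xi> N) + j = lev (\<eta> K) + i"
      and agree: "\<And>k. k \<le> lev (\<xi> N) + j \<Longrightarrow> g \<xi> k = g \<eta> k"
      using ends_unique[OF g_ends[OF 1(1)] g_ends[OF 2(1)] eq] by auto
    have "g \<eta> (lev (\<xi> N)) = g \<xi> (lev (\<xi> N))"
      using agree by simp
    then have "g \<eta> \<in> cyl (lev (\<xi> N)) (g \<xi> (lev (\<xi> N)))"
      using g_ends[OF 2(1)] by simp
    then obtain \<zeta> where "\<zeta> \<in> cyl N (\<xi> N)" "g \<eta> = g \<zeta>"
      using tree_like_image[OF lev[OF 1(1,2)]] by blast
    then have \<eta>N: "\<eta> N = \<xi> N"
      using injD[OF permutes_inj[OF perm]] by auto
    then have NK: "N = K"
      using leaf_unique[OF S 2(1) _ 2(2), of N] 1(2) by simp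
    then have "j = i"
      using lev_eq \<eta>N by simp
    then show "x = x'"
      using tree_like_iff[OF lev[OF 1(1,2)] 1(1) refl 2(1) \<eta>N, of j] eq 1 2 NK \<eta>N by simp
  qed
  have im: "\<phi> ` forest T S = forest T S2"
  proof
    show "\<phi> ` forest T S \<subseteq> forest T S2"
    proof
      fix y assume "y \<in> \<phi> ` forest T S"
      then obtain x where x: "x \<in> forest T S" "y = \<phi> x"
        by blast
      obtain \<xi> N j where "\<xi> \<in> ends" "\<xi> N \<in> leaves T S" "x = \<xi> (N + j)"
        using forestE[OF S x(1)] by blast
      then show "y \<in> forest T S2"
        using x(2) \<phi> A_mem S2(2) g_ends forestI by simp
    qed
    show "forest T S2 \<subseteq> \<phi> ` forest T S"
    proof
      fix y assume "y \<in> forest T S2"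
      then obtain \<zeta> K j where \<zeta>: "\<zeta> \<in> ends" "\<zeta> K \<in> A" "y = \<zeta> (K + j)"
        using forestE[OF S2(1)] S2(2) by metis
      obtain \<eta> where \<eta>: "\<eta> \<in> ends" "\<zeta> = g \<eta>"
        using surj[OF \<zeta>(1)] by blast
      obtain N where N: "\<eta> N \<in> leaves T S" "K = lev (\<eta> N)"
        using A_level[OF \<eta>(1), of K] \<zeta>(2) \<eta>(2) by blast
      then have "y = \<phi> (\<eta> (N + j))"
        using \<phi>[OF \<eta>(1) N(1)] \<zeta>(3) \<eta>(2) by simp
      then show "y \<in> \<phi> ` forest T S"
        using forestI[OF \<eta>(1) N(1)] by blast
    qed
  qed
  have edges: "(x, y) \<in> tedges T \<longleftrightarrow> (\<phi> x, \<phi> y) \<in> tedges T"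
    if xy: "x \<in> forest T S" "y \<in> forest T S" for x y
  proof -
    obtain \<xi> N j where \<xi>: "\<xi> \<in> ends" "\<xi> N \<in> leaves T S" "x = \<xi> (N + j)"
      using forestE[OF S xy(1)] by blast
    show ?thesis
    proof
      assume "(x, y) \<in> tedges T"
      then obtain \<eta> where \<eta>: "\<eta> \<in> ends" "\<forall>i \<le> N + j. \<eta> i = \<xi> i" "\<eta> (Suc (N + j)) = y"
        using ex_end_child[OF \<xi>(1), of "N + j" y] \<xi>(3) by blast
      have \<eta>N: "\<eta> N \<in> leaves T S" "x = \<eta> (N + j)"
        using \<eta>(2) \<xi>(2,3) by auto
      have "\<phi> x = g \<eta> (lev (\<eta> N) + j)" "\<phi> y = g \<eta> (Suc (lev (\<eta> N) + j))"
        using \<phi>[OF \<eta>(1) \<eta>N(1), of j] \<phi>[OF \<eta>(1) \<eta>N(1), of "Suc j"] \<eta>N(2) \<eta>(3) by auto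
      then show "(\<phi> x, \<phi> y) \<in> tedges T"
        using ends_edge[OF g_ends[OF \<eta>(1)]] by simp
    next
      assume e: "(\<phi> x, \<phi> y) \<in> tedges T"
      let ?m = "lev (\<xi> N)"
      have "\<phi> x = g \<xi> (?m + j)"
        using \<phi>[OF \<xi>(1,2)] \<xi>(3) by simp
      then obtain \<zeta> where \<zeta>: "\<zeta> \<in> ends" "\<forall>i \<le> ?m + j. \<zeta> i = g \<xi> i" "\<zeta> (Suc (?m + j)) = \<phi> y"
        using ex_end_child[OF g_ends[OF \<xi>(1)], of "?m + j" "\<phi> y"] e by auto
      then have "\<zeta> \<in> cyl ?m (g \<xi> ?m)"
        by simp
      then obtain \<eta> where "\<eta> \<in> cyl N (\<xi> N)" "\<zeta> = g \<eta>"
        using tree_like_image[OF lev[OF \<xi>(1,2)]] by blast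
      then have \<eta>: "\<eta> \<in> ends" "\<eta> N = \<xi> N" "\<zeta> = g \<eta>"
        by simp_all
      have "\<phi> (\<eta> (N + Suc j)) = \<phi> y"
        using \<phi>[OF \<eta>(1), of N "Suc j"] \<eta> \<xi>(2) \<zeta>(3) by simp
      then have y: "\<eta> (N + Suc j) = y"
        using inj_onD[OF inj] forestI[OF \<eta>(1), of N S "Suc j"] \<eta>(2) \<xi>(2) xy(2) by auto
      have "\<eta> (N + j) = \<xi> (N + j)"
        using tree_like_iff[OF lev[OF \<xi>(1,2)] \<eta>(1,2) \<xi>(1) refl, of j] \<zeta>(2) \<eta>(3) by simp
      then show "(x, y) \<in> tedges T"
        using ends_edge[OF \<eta>(1), of "N + j"] y \<xi>(3) by simp
    qed
  qed
  have honest: "(S, S2, \<phi>) \<in> honest_almost_automorphisms T"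
    unfolding honest_iff using S S2(1) inj im edges by (auto simp: \<phi>_def bij_betw_def)
  have ind: "induces (S, S2, \<phi>) g"
    unfolding induces_def
  proof (intro conjI ballI perm)
    fix \<xi> assume \<xi>: "\<xi> \<in> ends"
    obtain N where N: "\<xi> N \<in> leaves T S"
      using ex_leaf[OF S \<xi>] by blast
    show "follows (S, S2, \<phi>) \<xi> (g \<xi>)"
      by (rule followsI[where N = N and M = "lev (\<xi> N)"]) (use N \<phi>[OF \<xi> N] A_mem[OF \<xi> N] S2(2) in auto)
  qed
  have "\<forall>\<xi> \<in> ends. \<forall>N m. \<xi> N \<in> leaves T S \<longrightarrow> tree_like g N m \<xi> \<longrightarrow>
      g \<xi> m \<in> leaves T S2 \<and> (\<forall>j. \<phi> (\<xi> (N + j)) = g \<xi> (m + j))"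
  proof (intro ballI allI impI)
    fix \<xi> N m assume \<xi>: "\<xi> \<in> ends" "\<xi> N \<in> leaves T S" and m: "tree_like g N m \<xi>"
    have "m = lev (\<xi> N)"
      using tree_like_unique[OF perm \<xi>(1) m lev[OF \<xi>]] .
    then show "g \<xi> m \<in> leaves T S2 \<and> (\<forall>j. \<phi> (\<xi> (N + j)) = g \<xi> (m + j))"
      using \<phi>[OF \<xi>] A_mem[OF \<xi>] S2(2) by simp
  qed
  then show ?thesis
    using honest ind by blast
qed

lemma tree_like_at_leaf:
  assumes perm: "g permutes ends" and \<xi>: "\<xi> \<in> ends"
    and tl: "tree_like g n m \<xi>" and N: "n \<le> N"
  shows "tree_like g N (m + (N - n)) \<xi>"
  using tree_like_shift[OF perm \<xi> tl, of "N - n"] N by simp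

definition tree_like_perms :: "((nat \<Rightarrow> 'v) \<Rightarrow> nat \<Rightarrow> 'v) set" where
  "tree_like_perms = {g. g permutes ends \<and> (\<exists>n. \<forall>\<xi> \<in> ends. \<exists>m. tree_like g n m \<xi>)}"

definition almost_of :: "((nat \<Rightarrow> 'v) \<Rightarrow> nat \<Rightarrow> 'v) \<Rightarrow> 'v honest set" where
  "almost_of g = {p \<in> honest_almost_automorphisms T. induces p g}"

lemma induces_tree_like_perm:
  assumes p: "p \<in> honest_almost_automorphisms T" and g: "induces p g"
  shows "g \<in> tree_like_perms"
proof -
  obtain S1 S2 \<phi> where pdef: "p = (S1, S2, \<phi>)"
    by (cases p)
  have S1: "finite_complete_subtree T S1"
    using p by (simp add: pdef honest_iff)
  obtain n where n: "\<forall>k \<ge> n. \<forall>\<xi> \<in> ends. \<exists>N \<le> k. \<xi> N \<in> leaves T S1"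
    using leaf_bound[OF S1] by blast
  have "\<exists>m. tree_like g n m \<xi>" if "\<xi> \<in> ends" for \<xi>
  proof -
    obtain N where "N \<le> n" "\<xi> N \<in> leaves T S1"
      using n \<open>\<xi> \<in> ends\<close> by blast
    then show ?thesis
      using induces_tree_like_below[of S1 S2 \<phi> g \<xi> N n] p g \<open>\<xi> \<in> ends\<close> pdef by blast
  qed
  then show ?thesis
    using g by (auto simp: tree_like_perms_def induces_def)
qed

lemma ex_representative_on_sphere:
  assumes perm: "g permutes ends" and tl: "\<forall>\<xi> \<in> ends. \<exists>m. tree_like g n m \<xi>"
  shows "\<exists>S1 S2 \<phi>. leaves T S1 = sphere n \<and> (S1, S2, \<phi>) \<in> honest_almost_automorphisms T \<and>
    induces (S1, S2, \<phi>) g \<and>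
    (\<forall>\<xi> \<in> ends. \<forall>m. tree_like g n m \<xi> \<longrightarrow> g \<xi> m \<in> leaves T S2 \<and> (\<forall>j. \<phi> (\<xi> (n + j)) = g \<xi> (m + j)))"
proof -
  obtain S1 where S1: "finite_complete_subtree T S1" "leaves T S1 = sphere n"
    using ex_ball by blast
  have level: "N = n" if "\<xi> \<in> ends" "\<xi> N \<in> leaves T S1" for \<xi> N
    using that S1(2) ends_level[OF that(1)] by (auto simp: sphere_def)
  have "\<exists>m. tree_like g N m \<xi>" if "\<xi> \<in> ends" "\<xi> N \<in> leaves T S1" for \<xi> N
    using level[OF that] tl that(1) by blast
  then obtain S2 \<phi> where 1: "(S1, S2, \<phi>) \<in> honest_almost_automorphisms T" "induces (S1, S2, \<phi>) g"
      "\<forall>\<xi> \<in> ends. \<forall>N m. \<xi> N \<in> leaves T S1 \<longrightarrow> tree_like g N m \<xi> \<longrightarrow>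
        g \<xi> m \<in> leaves T S2 \<and> (\<forall>j. \<phi> (\<xi> (N + j)) = g \<xi> (m + j))"
    using ex_representative[OF perm S1(1)] by blast
  moreover have "\<xi> n \<in> leaves T S1" if "\<xi> \<in> ends" for \<xi>
    using that S1(2) by (simp add: sphere_def)
  ultimately show ?thesis
    using S1(2) by blast
qed

lemma almost_of_nonempty: "g \<in> tree_like_perms \<Longrightarrow> almost_of g \<noteq> {}"
  using ex_representative_on_sphere[of g] by (force simp: tree_like_perms_def almost_of_def)

lemma almost_class_eq:
  assumes p: "p \<in> honest_almost_automorphisms T" and g: "induces p g"
  shows "almost_class T p = almost_of g"
proof -
  have "q \<in> almost_class T p \<longleftrightarrow> q \<in> almost_of g" for q
  proof (cases "q \<in> honest_almost_automorphisms T")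
    case True
    obtain h where h: "induces q h"
      using ex_induces[OF True] by blast
    have "induces q g \<longleftrightarrow> g = h"
      using induces_unique[OF True _ h] h by blast
    then show ?thesis
      using honest_equiv_iff[OF p True g h] True by (simp add: almost_class_def almost_of_def)
  next
    case False
    then have "(p, q) \<notin> honest_equiv T"
      by (auto simp: honest_equiv_def)
    then show ?thesis
      using False by (simp add: almost_class_def almost_of_def)
  qed
  then show ?thesis
    by blast
qed

lemma carrier_AAut: "carrier (AAut T) = almost_of ` tree_like_perms"
proof -
  have "carrier (AAut T) = almost_class T ` honest_almost_automorphisms T"
    by (auto simp: AAut_def quotient_def almost_class_def)
  also have "\<dots> = almost_of ` tree_like_perms"
  proof
    show "almost_class T ` honest_almost_automorphisms T \<subseteq> almost_of ` tree_like_perms"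
      using ex_induces almost_class_eq induces_tree_like_perm by blast
    show "almost_of ` tree_like_perms \<subseteq> almost_class T ` honest_almost_automorphisms T"
    proof
      fix A assume "A \<in> almost_of ` tree_like_perms"
      then obtain g where g: "g \<in> tree_like_perms" "A = almost_of g"
        by blast
      then obtain p where "p \<in> almost_of g"
        using almost_of_nonempty by blast
      then have "p \<in> honest_almost_automorphisms T" "induces p g"
        by (auto simp: almost_of_def)
      then show "A \<in> almost_class T ` honest_almost_automorphisms T"
        using almost_class_eq g(2) by blast
    qed
  qed
  finally show ?thesis .
qed

lemma almost_of_inj: "inj_on almost_of tree_like_perms"
proof (rule inj_onI)
  fix g h assume "g \<in> tree_like_perms" "h \<in> tree_like_perms" "almost_of g = almost_of h"
  moreover from this obtain p where "p \<in> almost_of g"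
    using almost_of_nonempty by blast
  ultimately have "p \<in> almost_of g" "p \<in> almost_of h"
    by auto
  then show "g = h"
    using induces_unique[of p g h] by (simp add: almost_of_def)
qed

lemma honest_compose:
  assumes q: "(S1, S2, \<psi>) \<in> honest_almost_automorphisms T" "induces (S1, S2, \<psi>) h"
    and p: "(S2, S3, \<phi>) \<in> honest_almost_automorphisms T" "induces (S2, S3, \<phi>) g"
  shows "(S1, S3, compose (forest T S1) \<phi> \<psi>) \<in> honest_almost_automorphisms T"
    and "induces (S1, S3, compose (forest T S1) \<phi> \<psi>) (g \<circ> h)"
proof -
  have S1: "finite_complete_subtree T S1"
    and bij: "bij_betw \<psi> (forest T S1) (forest T S2)" "bij_betw \<phi> (forest T S2) (forest T S3)"
    using p q by (auto simp: honest_iff)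
  have im: "\<psi> x \<in> forest T S2" if "x \<in> forest T S1" for x
    using that bij(1) by (auto simp: bij_betw_def)
  have "bij_betw (compose (forest T S1) \<phi> \<psi>) (forest T S1) (forest T S3)"
    using bij_betw_trans[OF bij] by (rule bij_betw_cong[THEN iffD1, rotated]) (simp add: compose_def)
  then show "(S1, S3, compose (forest T S1) \<phi> \<psi>) \<in> honest_almost_automorphisms T"
    using p(1) q(1) im by (auto simp: honest_iff compose_def)
  have perm: "g permutes ends" "h permutes ends"
    using p(2) q(2) by (auto simp: induces_def)
  show "induces (S1, S3, compose (forest T S1) \<phi> \<psi>) (g \<circ> h)"
    unfolding induces_def
  proof (intro conjI ballI)
    show "g \<circ> h permutes ends"
      using perm by (intro permutes_compose)
    fix \<xi> assume \<xi>: "\<xi> \<in> ends"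
    obtain N where N: "\<xi> N \<in> leaves T S1"
      using ex_leaf[OF S1 \<xi>] by blast
    obtain M where M: "h \<xi> M \<in> leaves T S2" "\<forall>\<eta> \<in> cyl N (\<xi> N). \<forall>j. h \<eta> (M + j) = \<psi> (\<eta> (N + j))"
      using induces_tree_like[OF q \<xi> N] by blast
    have h\<xi>: "h \<xi> \<in> ends"
      using permutes_in_image[OF perm(2)] \<xi> by simp
    obtain K where K: "g (h \<xi>) K \<in> leaves T S3"
        "\<forall>\<eta> \<in> cyl M (h \<xi> M). \<forall>j. g \<eta> (K + j) = \<phi> (\<eta> (M + j))"
      using induces_tree_like[OF p h\<xi> M(1)] by blast
    show "follows (S1, S3, compose (forest T S1) \<phi> \<psi>) \<xi> ((g \<circ> h) \<xi>)"
      by (rule followsI[where N = N and M = K])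
        (use N K M \<xi> h\<xi> forestI[OF \<xi> N] in \<open>auto simp: compose_def\<close>)
  qed
qed

text \<open>
  Composable representatives exist: a representative of the inner factor on a sufficiently large ball
  has a range so deep that the outer factor is tree-like below each of its leaves. All composites
  induce the same permutation, so the union in the definition of the product has a single member.
\<close>

lemma mult_AAut:
  assumes g: "g \<in> tree_like_perms" and h: "h \<in> tree_like_perms"
  shows "almost_of g \<otimes>\<^bsub>AAut T\<^esub> almost_of h = almost_of (g \<circ> h)"
proof -
  define \<K> where "\<K> = {almost_class T (S1, S3, compose (forest T S1) \<phi> \<psi>) | S1 S2 S3 \<phi> \<psi>.
      (S1, S2, \<psi>) \<in> almost_of h \<and> (S2, S3, \<phi>) \<in> almost_of g}"
  have "A = almost_of (g \<circ> h)" if "A \<in> \<K>" for A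
    using that honest_compose almost_class_eq unfolding \<K>_def almost_of_def by blast
  moreover have "\<K> \<noteq> {}"
  proof -
    have perm: "g permutes ends" "h permutes ends"
      using g h by (auto simp: tree_like_perms_def)
    obtain n where n: "\<forall>\<xi> \<in> ends. \<exists>m. tree_like g n m \<xi>"
      using g by (auto simp: tree_like_perms_def)
    obtain k where k: "\<forall>\<xi> \<in> ends. \<exists>m. tree_like h k m \<xi>"
      using h by (auto simp: tree_like_perms_def)
    have kn: "\<exists>m \<ge> n. tree_like h (k + n) m \<xi>" if "\<xi> \<in> ends" for \<xi>
    proof -
      obtain m where "tree_like h k m \<xi>"
        using k \<open>\<xi> \<in> ends\<close> by blast
      then have "tree_like h (k + n) (m + n) \<xi>"
        using tree_like_shift[OF perm(2) \<open>\<xi> \<in> ends\<close>] by blast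
      then show ?thesis
        using le_add2 by blast
    qed
    then have "\<forall>\<xi> \<in> ends. \<exists>m. tree_like h (k + n) m \<xi>"
      by blast
    then obtain S1 S2 \<psi> where q: "leaves T S1 = sphere (k + n)"
        "(S1, S2, \<psi>) \<in> honest_almost_automorphisms T" "induces (S1, S2, \<psi>) h"
        "\<forall>\<xi> \<in> ends. \<forall>m. tree_like h (k + n) m \<xi> \<longrightarrow> h \<xi> m \<in> leaves T S2 \<and> (\<forall>j. \<psi> (\<xi> (k + n + j)) = h \<xi> (m + j))"
      using ex_representative_on_sphere[OF perm(2)] by blast
    have S2: "finite_complete_subtree T S2"
      using q(2) by (simp add: honest_iff)
    have "\<exists>m. tree_like g N m \<eta>" if \<eta>: "\<eta> \<in> ends" "\<eta> N \<in> leaves T S2" for \<eta> N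
    proof -
      obtain \<xi> where \<xi>: "\<xi> \<in> ends" "\<eta> = h \<xi>"
        using \<eta>(1) permutes_image[OF perm(2)] by blast
      obtain m where m: "m \<ge> n" "tree_like h (k + n) m \<xi>"
        using kn[OF \<xi>(1)] by blast
      then have "\<eta> m \<in> leaves T S2"
        using q(4) \<xi> by blast
      then have "N = m"
        using leaf_unique[OF S2 \<eta>] by blast
      moreover obtain m' where "tree_like g n m' \<eta>"
        using n \<eta>(1) by blast
      ultimately show ?thesis
        using tree_like_at_leaf[OF perm(1) \<eta>(1)] m(1) by blast
    qed
    then obtain S3 \<phi> where "(S2, S3, \<phi>) \<in> honest_almost_automorphisms T" "induces (S2, S3, \<phi>) g"
      using ex_representative[OF perm(1) S2] by blast
    then have "(S2, S3, \<phi>) \<in> almost_of g" "(S1, S2, \<psi>) \<in> almost_of h"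
      using q by (auto simp: almost_of_def)
    then show ?thesis
      unfolding \<K>_def by blast
  qed
  ultimately have "\<Union>\<K> = almost_of (g \<circ> h)"
    by blast
  then show ?thesis
    by (simp add: AAut_def \<K>_def)
qed

section \<open>Automorphisms fixing a ball\<close>

lemma complete_subtree_root: "finite_complete_subtree T {troot T}"
  using root_vert not_edge_root by (auto simp: finite_complete_subtree_def subtree_def children_def)

lemma leaves_root: "leaves T {troot T} = {troot T}"
  using not_edge_root by (auto simp: leaves_def children_def)

lemma forest_root: "forest T {troot T} = tverts T"
proof
  show "forest T {troot T} \<subseteq> tverts T"
  proof
    fix x assume "x \<in> forest T {troot T}"
    then obtain \<xi> N j where "\<xi> \<in> ends" "x = \<xi> (N + j)"
      using forestE[OF complete_subtree_root] by blast
    then show "x \<in> tverts T"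
      using ends_vert by simp
  qed
  show "tverts T \<subseteq> forest T {troot T}"
    using locally_finite by (auto simp: forest_def leaves_root locally_finite_tree_def)
qed

lemma honest_of_automorphism:
  assumes "\<alpha> \<in> tree_automorphisms T"
  shows "({troot T}, {troot T}, \<alpha>) \<in> honest_almost_automorphisms T"
  using assms complete_subtree_root
  by (auto simp: honest_iff forest_root tree_automorphisms_def Bij_def)

definition acts_as :: "('v \<Rightarrow> 'v) \<Rightarrow> ((nat \<Rightarrow> 'v) \<Rightarrow> nat \<Rightarrow> 'v) \<Rightarrow> bool" where
  "acts_as \<alpha> g \<longleftrightarrow> g permutes ends \<and> (\<forall>\<xi> \<in> ends. \<forall>i. g \<xi> i = \<alpha> (\<xi> i))"

lemma automorphism_induces_iff:
  assumes \<alpha>: "\<alpha> \<in> tree_automorphisms T"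
  shows "induces ({troot T}, {troot T}, \<alpha>) g \<longleftrightarrow> acts_as \<alpha> g"
proof
  assume g: "induces ({troot T}, {troot T}, \<alpha>) g"
  have perm: "g permutes ends"
    using g by (simp add: induces_def)
  have "g \<xi> i = \<alpha> (\<xi> i)" if \<xi>: "\<xi> \<in> ends" for \<xi> i
  proof -
    obtain N M where N: "\<xi> N = troot T" "g \<xi> M = troot T" "\<forall>j. g \<xi> (M + j) = \<alpha> (\<xi> (N + j))"
      using g \<xi> followsD unfolding induces_def leaves_root by (metis leaves_root singletonD)
    have g\<xi>: "g \<xi> \<in> ends"
      using permutes_in_image[OF perm] \<xi> by simp
    have "N = 0" "M = 0"
      using ends_level[OF \<xi> \<xi>, of N 0] ends_level[OF g\<xi> g\<xi>, of M 0] N \<xi> g\<xi> by (auto simp: ends_root)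
    then show ?thesis
      using N(3) by simp
  qed
  then show "acts_as \<alpha> g"
    using perm by (simp add: acts_as_def)
next
  assume g: "acts_as \<alpha> g"
  have "follows ({troot T}, {troot T}, \<alpha>) \<xi> (g \<xi>)" if \<xi>: "\<xi> \<in> ends" for \<xi>
  proof (rule followsI[where N = 0 and M = 0])
    have "g \<xi> \<in> ends"
      using permutes_in_image[of g ends \<xi>] g \<xi> by (auto simp: acts_as_def)
    then show "\<xi> 0 \<in> leaves T {troot T}" "g \<xi> 0 \<in> leaves T {troot T}"
      using \<xi> by (auto simp: leaves_root ends_root)
    show "g \<xi> (0 + j) = \<alpha> (\<xi> (0 + j))" for j
      using g \<xi> by (simp add: acts_as_def)
  qed
  then show "induces ({troot T}, {troot T}, \<alpha>) g"
    using g by (simp add: induces_def acts_as_def)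
qed

lemma aut_to_almost_eq:
  assumes "\<alpha> \<in> tree_automorphisms T" "acts_as \<alpha> g"
  shows "aut_to_almost T \<alpha> = almost_of g"
  unfolding aut_to_almost_def
  using almost_class_eq[OF honest_of_automorphism] automorphism_induces_iff assms by blast

lemma ex_acts_as:
  assumes "\<alpha> \<in> tree_automorphisms T"
  shows "\<exists>g \<in> tree_like_perms. acts_as \<alpha> g"
  using ex_induces[OF honest_of_automorphism[OF assms]] automorphism_induces_iff[OF assms]
    induces_tree_like_perm[OF honest_of_automorphism[OF assms]] by blast

lemma automorphism_unique:
  assumes "\<alpha> \<in> tree_automorphisms T" "\<beta> \<in> tree_automorphisms T" "acts_as \<alpha> g" "acts_as \<beta> g"
  shows "\<alpha> = \<beta>"
proof (rule extensionalityI[of _ "tverts T"])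
  show "\<alpha> \<in> extensional (tverts T)" "\<beta> \<in> extensional (tverts T)"
    using assms by (auto simp: tree_automorphisms_def Bij_def)
  fix x assume "x \<in> tverts T"
  then obtain \<xi> n where "\<xi> \<in> ends" "\<xi> n = x"
    using ex_end_vertex by blast
  then show "\<alpha> x = \<beta> x"
    using assms by (auto simp: acts_as_def)
qed

text \<open>
  There is no condition on local permutations here: an automorphism of the tree that is patterned as an
  almost automorphism may violate the pattern at finitely many vertices.
\<close>

definition ball_fixing :: "nat \<Rightarrow> ((nat \<Rightarrow> 'v) \<Rightarrow> nat \<Rightarrow> 'v) set" where
  "ball_fixing n = {g. g permutes ends \<and> (\<forall>\<xi> \<in> ends. tree_like g n n \<xi> \<and> g \<xi> n = \<xi> n)}"

lemma ball_fixing_below: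
  assumes g: "g \<in> ball_fixing n" and \<xi>: "\<xi> \<in> ends" and i: "i \<le> n"
  shows "g \<xi> i = \<xi> i"
proof -
  have "g permutes ends" "g \<xi> n = \<xi> n"
    using g \<xi> by (auto simp: ball_fixing_def)
  then have "g \<xi> \<in> ends" "g \<xi> n = \<xi> n"
    using permutes_in_image[of g ends \<xi>] \<xi> by auto
  then show ?thesis
    using ends_agree \<xi> i by blast
qed

lemma ball_fixing_tree_like:
  assumes g: "g \<in> ball_fixing n" and \<xi>: "\<xi> \<in> ends"
  shows "tree_like g k k \<xi>"
proof -
  have perm: "g permutes ends" and tl: "\<And>\<eta>. \<eta> \<in> ends \<Longrightarrow> tree_like g n n \<eta>"
    using g by (auto simp: ball_fixing_def)
  have g_ends: "g \<eta> \<in> ends" if "\<eta> \<in> ends" for \<eta>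
    using permutes_in_image[OF perm] that by simp
  have iff: "\<eta> i = \<eta>' i \<longleftrightarrow> g \<eta> i = g \<eta>' i" if \<eta>: "\<eta> \<in> ends" "\<eta>' \<in> ends" for \<eta> \<eta>' i
  proof (cases "i \<le> n")
    case True
    then show ?thesis
      using ball_fixing_below[OF g] \<eta> by simp
  next
    case False
    have "\<eta>' n = \<eta> n" if "\<eta> i = \<eta>' i \<or> g \<eta> i = g \<eta>' i"
    proof -
      have "\<eta> n = \<eta>' n \<or> g \<eta> n = g \<eta>' n"
        using that False ends_agree[OF \<eta>, of i n] ends_agree[OF g_ends[OF \<eta>(1)] g_ends[OF \<eta>(2)], of i n]
        by auto
      then show ?thesis
        using ball_fixing_below[OF g] \<eta> by auto
    qed
    then show ?thesis
      using tree_like_iff[OF tl[OF \<eta>(1)] \<eta>(1) refl \<eta>(2), of "i - n"] False by auto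
  qed
  have "g ` cyl k (\<xi> k) = cyl k (g \<xi> k)"
  proof
    show "g ` cyl k (\<xi> k) \<subseteq> cyl k (g \<xi> k)"
      using iff \<xi> g_ends by auto
    show "cyl k (g \<xi> k) \<subseteq> g ` cyl k (\<xi> k)"
    proof
      fix \<zeta> assume \<zeta>: "\<zeta> \<in> cyl k (g \<xi> k)"
      then obtain \<eta> where "\<eta> \<in> ends" "\<zeta> = g \<eta>"
        using permutes_image[OF perm] by auto
      then show "\<zeta> \<in> g ` cyl k (\<xi> k)"
        using iff[of \<eta> \<xi> k] \<zeta> \<xi> by auto
    qed
  qed
  then show ?thesis
    unfolding tree_like_def using iff by simp
qed

text \<open>
  An automorphism that fixes the vertices of depth \<open>n\<close> also fixes their ancestors, that is, the whole
  ball of radius \<open>n\<close>.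
\<close>

lemma ball_fixing_iff:
  "g \<in> ball_fixing n \<longleftrightarrow>
     (\<exists>\<alpha> \<in> tree_automorphisms T. acts_as \<alpha> g \<and> (\<forall>\<xi> \<in> ends. \<alpha> (\<xi> n) = \<xi> n))"
proof
  assume g: "g \<in> ball_fixing n"
  have perm: "g permutes ends"
    using g by (simp add: ball_fixing_def)
  have level: "N = 0" if "\<xi> \<in> ends" "\<xi> N \<in> leaves T {troot T}" for \<xi> N
    using that ends_level[OF that(1) that(1), of N 0] by (simp add: leaves_root ends_root)
  have tl: "tree_like g 0 0 \<xi>" if "\<xi> \<in> ends" for \<xi>
    using ball_fixing_tree_like[OF g that] .
  have "\<exists>m. tree_like g N m \<xi>" if "\<xi> \<in> ends" "\<xi> N \<in> leaves T {troot T}" for \<xi> N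
    using level[OF that] tl[OF that(1)] by blast
  then obtain S2 \<alpha> where \<alpha>: "({troot T}, S2, \<alpha>) \<in> honest_almost_automorphisms T"
      "induces ({troot T}, S2, \<alpha>) g"
      "\<forall>\<xi> \<in> ends. \<forall>N m. \<xi> N \<in> leaves T {troot T} \<longrightarrow> tree_like g N m \<xi> \<longrightarrow>
         g \<xi> m \<in> leaves T S2 \<and> (\<forall>j. \<alpha> (\<xi> (N + j)) = g \<xi> (m + j))"
    using ex_representative[OF perm complete_subtree_root] by blast
  have S2: "finite_complete_subtree T S2"
    using \<alpha>(1) by (simp add: honest_iff)
  have eq: "g \<xi> 0 \<in> leaves T S2" "\<alpha> (\<xi> j) = g \<xi> j" if "\<xi> \<in> ends" for \<xi> j
    using \<alpha>(3)[rule_format, OF that _ tl[OF that]] that by (auto simp: leaves_root ends_root)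
  have root: "troot T \<in> leaves T S2"
  proof -
    obtain \<xi> where \<xi>: "\<xi> \<in> ends"
      using ends_nonempty by blast
    then have "g \<xi> \<in> ends"
      using permutes_in_image[OF perm] by simp
    then show ?thesis
      using eq(1)[OF \<xi>] by (simp add: ends_root)
  qed
  have "S2 \<subseteq> {troot T}"
  proof
    fix x assume x: "x \<in> S2"
    then have "x \<in> tverts T"
      using S2 by (auto simp: finite_complete_subtree_def subtree_def)
    then obtain \<xi> i where \<xi>: "\<xi> \<in> ends" "\<xi> i = x"
      using ex_end_vertex by blast
    have "\<xi> 0 \<in> leaves T S2"
      using root ends_root[OF \<xi>(1)] by simp
    then have "i \<le> 0"
      using leaf_level_unique[OF S2 \<xi>(1)] \<xi>(2) x by blast
    then show "x \<in> {troot T}"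
      using \<xi> by (simp add: ends_root)
  qed
  then have S2: "S2 = {troot T}"
    using root leaf_subset by blast
  have "\<alpha> (troot T) = troot T"
  proof -
    obtain \<xi> where \<xi>: "\<xi> \<in> ends"
      using ends_nonempty by blast
    then have "g \<xi> \<in> ends"
      using permutes_in_image[OF perm] by simp
    then show ?thesis
      using eq(2)[OF \<xi>, of 0] \<xi> by (simp add: ends_root)
  qed
  then have "\<alpha> \<in> tree_automorphisms T"
    using \<alpha>(1) S2 by (auto simp: tree_automorphisms_def honest_iff forest_root Bij_def)
  moreover have "acts_as \<alpha> g"
    using eq(2) perm by (simp add: acts_as_def)
  moreover have "\<alpha> (\<xi> n) = \<xi> n" if "\<xi> \<in> ends" for \<xi>
    using eq(2)[OF that] g that by (simp add: ball_fixing_def)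
  ultimately show "\<exists>\<alpha> \<in> tree_automorphisms T. acts_as \<alpha> g \<and> (\<forall>\<xi> \<in> ends. \<alpha> (\<xi> n) = \<xi> n)"
    by blast
next
  assume "\<exists>\<alpha> \<in> tree_automorphisms T. acts_as \<alpha> g \<and> (\<forall>\<xi> \<in> ends. \<alpha> (\<xi> n) = \<xi> n)"
  then obtain \<alpha> where \<alpha>: "\<alpha> \<in> tree_automorphisms T" "acts_as \<alpha> g" "\<forall>\<xi> \<in> ends. \<alpha> (\<xi> n) = \<xi> n"
    by blast
  have perm: "g permutes ends"
    using \<alpha>(2) by (simp add: acts_as_def)
  have ind: "induces ({troot T}, {troot T}, \<alpha>) g"
    using automorphism_induces_iff[OF \<alpha>(1)] \<alpha>(2) by blast
  have tl: "tree_like g n n \<xi>" if \<xi>: "\<xi> \<in> ends" for \<xi>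
  proof -
    have root: "\<xi> 0 \<in> leaves T {troot T}"
      using \<xi> by (simp add: leaves_root ends_root)
    obtain M where M: "g \<xi> M \<in> leaves T {troot T}" "tree_like g 0 M \<xi>"
      using induces_tree_like[OF honest_of_automorphism[OF \<alpha>(1)] ind \<xi> root] by blast
    have g\<xi>: "g \<xi> \<in> ends"
      using permutes_in_image[OF perm] \<xi> by simp
    have "M = 0"
      using M(1) ends_level[OF g\<xi> g\<xi>, of M 0] g\<xi> by (simp add: leaves_root ends_root)
    then show ?thesis
      using tree_like_shift[OF perm \<xi> M(2), of n] by simp
  qed
  then show "g \<in> ball_fixing n"
    using \<alpha> perm by (simp add: ball_fixing_def acts_as_def)
qed

end

section \<open>Coloured trees\<close>

text \<open>
  Otherwise the label would occur only outside the tree below \<open>v\<close>, and the complement of that tree is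
  a proper subtree.
\<close>

lemma colouring_label_below:
  assumes T: "locally_finite_tree T" and C: "colouring_structure T C"
    and v: "v \<in> tverts T - {troot T}" and l: "l \<in> labels C"
  shows "\<exists>w \<in> descendants T v. w \<in> tverts T - {troot T} \<and> lab C w = l"
proof -
  define S where "S = tverts T - descendants T v"
  let ?R = "(tedges T \<union> (tedges T)\<inverse>) \<inter> S \<times> S"
  have no_root: "(x, troot T) \<notin> tedges T" for x
    using T by (simp add: locally_finite_tree_def)
  have verts: "x \<in> tverts T \<and> y \<in> tverts T" if "(x, y) \<in> tedges T" for x y
    using T that by (auto simp: locally_finite_tree_def)
  have "(v, troot T) \<notin> (tedges T)\<^sup>*"
    using v no_root by (auto elim: rtranclE)
  then have root: "troot T \<in> S"
    using T by (simp add: S_def descendants_def locally_finite_tree_def)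
  have conn: "x \<in> S \<longrightarrow> (troot T, x) \<in> ?R\<^sup>*" if "(troot T, x) \<in> (tedges T)\<^sup>*" for x
    using that
  proof induction
    case base
    then show ?case by simp
  next
    case (step y z)
    show ?case
    proof
      assume z: "z \<in> S"
      have "y \<in> S"
      proof (rule ccontr)
        assume "y \<notin> S"
        then have "(v, y) \<in> (tedges T)\<^sup>*"
          using verts[OF step(2)] by (simp add: S_def descendants_def)
        then have "(v, z) \<in> (tedges T)\<^sup>*"
          using step(2) by (rule rtrancl.rtrancl_into_rtrancl)
        then show False
          using z by (simp add: S_def descendants_def)
      qed
      then have "(troot T, y) \<in> ?R\<^sup>*" "(y, z) \<in> ?R"
        using step z by auto
      then show "(troot T, z) \<in> ?R\<^sup>*"
        by (rule rtrancl.rtrancl_into_rtrancl)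
    qed
  qed
  have "sym ?R"
    by (auto simp: sym_def)
  then have sym: "sym (?R\<^sup>*)"
    by (rule sym_rtrancl)
  have "subtree T S"
    unfolding subtree_def
  proof (intro conjI ballI)
    show "S \<noteq> {}" "S \<subseteq> tverts T"
      using root by (auto simp: S_def)
    fix x y assume "x \<in> S" "y \<in> S"
    moreover have "(troot T, z) \<in> (tedges T)\<^sup>*" if "z \<in> S" for z
      using T that by (simp add: S_def locally_finite_tree_def descendants_def)
    ultimately have "(troot T, x) \<in> ?R\<^sup>*" and y: "(troot T, y) \<in> ?R\<^sup>*"
      using conn by simp_all
    then have "(x, troot T) \<in> ?R\<^sup>*"
      using symD[OF sym] by simp
    from this y show "(x, y) \<in> ?R\<^sup>*"
      by (rule rtrancl_trans)
  qed
  moreover have "S \<noteq> tverts T"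
    using v by (auto simp: S_def descendants_def)
  moreover have "\<not> (\<exists>S. subtree T S \<and> S \<noteq> tverts T \<and> {v \<in> tverts T - {troot T}. lab C v = l} \<subseteq> S)"
    using C l by (simp add: colouring_structure_def)
  ultimately have "\<not> {v \<in> tverts T - {troot T}. lab C v = l} \<subseteq> S"
    by blast
  then show ?thesis
    by (auto simp: S_def)
qed

locale coloured_tree = branching_tree T for T :: "'v rooted_tree" +
  fixes C :: "('v, 'l, 'c) colouring"
  assumes colouring: "colouring_structure T C"

text \<open>
  The label of \<open>b\<close> recurs below every vertex, and vertices with the same label have equally many
  children.
\<close>

lemma coloured_tree_if_branching_vertex:
  assumes T: "locally_finite_tree T" and C: "colouring_structure T C"
    and b: "b \<in> tverts T - {troot T}" "2 \<le> card (children T b)"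
  shows "coloured_tree T C"
proof
  show "locally_finite_tree T" "colouring_structure T C"
    by fact+
  fix v assume v: "v \<in> tverts T"
  show "\<exists>w \<in> descendants T v. 2 \<le> card (children T w)"
  proof (cases "v = troot T")
    case True
    then show ?thesis
      using T b by (auto simp: locally_finite_tree_def)
  next
    case False
    have "lab C b \<in> labels C"
      using C b by (simp add: colouring_structure_def)
    then obtain w where w: "w \<in> descendants T v" "w \<in> tverts T - {troot T}" "lab C b = lab C w"
      using colouring_label_below[OF T C, of v "lab C b"] v False by auto
    moreover have "\<forall>v \<in> tverts T - {troot T}. \<forall>w \<in> tverts T - {troot T}. lab C v = lab C w \<longrightarrow>
        (\<exists>f. bij_betw f (children T v) (children T w) \<and> (\<forall>x \<in> children T v. lab C (f x) = lab C x))"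
      using C unfolding colouring_structure_def by (elim conjE)
    ultimately obtain f where "bij_betw f (children T b) (children T w)"
      using b(1) by blast
    then have "card (children T w) = card (children T b)"
      using bij_betw_same_card by metis
    then show ?thesis
      using w(1) b(2) by (intro bexI[of _ w]) simp_all
  qed
qed

context coloured_tree
begin

abbreviation inner_verts :: "'v set" where
  "inner_verts \<equiv> tverts T - {troot T}"

lemma ends_inner: assumes "\<xi> \<in> ends" "1 \<le> n" shows "\<xi> n \<in> inner_verts"
  using assms ends_vert ends_level[OF assms(1) assms(1), of n 0] by (auto simp: ends_root)

lemma child_inner: "(x, y) \<in> tedges T \<Longrightarrow> y \<in> inner_verts"
  using edge_verts not_edge_root by auto

lemma lab_in_labels: "v \<in> inner_verts \<Longrightarrow> lab C v \<in> labels C"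
  using colouring by (simp add: colouring_structure_def)

lemma ccol_bij:
  assumes "v \<in> inner_verts" "l \<in> labels C"
  shows "bij_betw (ccol C) {e \<in> tedges T. fst e = v \<and> lab C (snd e) = l} (cols C (lab C v) l)"
proof -
  have "\<forall>v \<in> tverts T - {troot T}. \<forall>l' \<in> labels C.
      bij_betw (ccol C) {e \<in> tedges T. fst e = v \<and> lab C (snd e) = l'} (cols C (lab C v) l')"
    using colouring unfolding colouring_structure_def by (elim conjE)
  then show ?thesis
    using assms by blast
qed

lemma ccol_in_cols:
  assumes "v \<in> inner_verts" "(v, w) \<in> tedges T"
  shows "ccol C (v, w) \<in> cols C (lab C v) (lab C w)"
proof -
  have "lab C w \<in> labels C"
    using lab_in_labels child_inner assms(2) by blast
  then have "bij_betw (ccol C) {e \<in> tedges T. fst e = v \<and> lab C (snd e) = lab C w}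
      (cols C (lab C v) (lab C w))"
    by (rule ccol_bij[OF assms(1)])
  then show ?thesis
    using assms(2) by (auto simp: bij_betw_def)
qed

lemma cols_disjoint:
  assumes "d \<in> cols C l m" "d \<in> cols C l' m'" "l \<in> labels C" "m \<in> labels C" "l' \<in> labels C" "m' \<in> labels C"
  shows "l = l' \<and> m = m'"
proof -
  have "(l, m) \<noteq> (l', m') \<longrightarrow> cols C l m \<inter> cols C l' m' = {}"
  proof -
    have "\<forall>l \<in> labels C. \<forall>l' \<in> labels C. \<forall>m \<in> labels C. \<forall>m' \<in> labels C.
        (l, l') \<noteq> (m, m') \<longrightarrow> cols C l l' \<inter> cols C m m' = {}"
      using colouring unfolding colouring_structure_def by (elim conjE)
    then show ?thesis
      using assms(3-6) by blast
  qed
  then show ?thesis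
    using assms(1,2) by blast
qed

lemma ccol_eq_labels:
  assumes "v \<in> inner_verts" "(v, w) \<in> tedges T" "v' \<in> inner_verts" "(v', w') \<in> tedges T"
    and "ccol C (v, w) = ccol C (v', w')"
  shows "lab C v = lab C v' \<and> lab C w = lab C w'"
  using cols_disjoint ccol_in_cols[OF assms(1,2)] ccol_in_cols[OF assms(3,4)] assms(5)
    lab_in_labels child_inner assms(1-4) by metis

lemma ccol_in_all_cols:
  assumes "v \<in> inner_verts" "(v, w) \<in> tedges T"
  shows "ccol C (v, w) \<in> all_cols C (lab C v)"
  using ccol_in_cols[OF assms] lab_in_labels child_inner[OF assms(2)] by (auto simp: all_cols_def)

lemma all_cols_disjoint:
  "\<lbrakk>d \<in> all_cols C l; d \<in> all_cols C m; l \<in> labels C; m \<in> labels C\<rbrakk> \<Longrightarrow> l = m"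
  using cols_disjoint by (fastforce simp: all_cols_def)

lemma ccol_inj:
  assumes "v \<in> inner_verts" "(v, w) \<in> tedges T" "(v, w') \<in> tedges T" "ccol C (v, w) = ccol C (v, w')"
  shows "w = w'"
proof -
  have eq: "lab C w = lab C w'"
    using ccol_eq_labels assms by blast
  have "bij_betw (ccol C) {e \<in> tedges T. fst e = v \<and> lab C (snd e) = lab C w}
      (cols C (lab C v) (lab C w))"
    using ccol_bij[OF assms(1)] lab_in_labels child_inner[OF assms(2)] by blast
  then have "inj_on (ccol C) {e \<in> tedges T. fst e = v \<and> lab C (snd e) = lab C w}"
    by (simp add: bij_betw_def)
  then have "(v, w) = (v, w')"
    by (rule inj_onD) (use assms eq in auto)
  then show ?thesis
    by simp
qed

lemma ex_child_coloured:
  assumes "v \<in> inner_verts" "d \<in> all_cols C (lab C v)"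
  shows "\<exists>w. (v, w) \<in> tedges T \<and> ccol C (v, w) = d"
proof -
  obtain l where l: "l \<in> labels C" "d \<in> cols C (lab C v) l"
    using assms(2) by (auto simp: all_cols_def)
  have "bij_betw (ccol C) {e \<in> tedges T. fst e = v \<and> lab C (snd e) = l} (cols C (lab C v) l)"
    by (rule ccol_bij[OF assms(1) l(1)])
  then have "d \<in> ccol C ` {e \<in> tedges T. fst e = v \<and> lab C (snd e) = l}"
    using l(2) by (simp add: bij_betw_def)
  then show ?thesis
    by force
qed

lemma ex_label_below:
  assumes "\<xi> \<in> ends" "1 \<le> n" "l \<in> labels C"
  shows "\<exists>\<eta> \<in> ends. \<exists>j. \<eta> n = \<xi> n \<and> lab C (\<eta> (n + j)) = l"
proof -
  obtain w where "(\<xi> n, w) \<in> (tedges T)\<^sup>*" "lab C w = l"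
    using colouring_label_below[OF locally_finite colouring ends_inner[OF assms(1,2)] assms(3)]
    by (auto simp: descendants_def)
  then show ?thesis
    using ex_end_descendant[OF assms(1)] by blast
qed

section \<open>Patterned permutations of the ends\<close>

definition locally_patterned ::
  "('l \<Rightarrow> ('c \<Rightarrow> 'c) set) \<Rightarrow> ((nat \<Rightarrow> 'v) \<Rightarrow> nat \<Rightarrow> 'v) \<Rightarrow> nat \<Rightarrow> nat \<Rightarrow> (nat \<Rightarrow> 'v) \<Rightarrow> bool" where
  "locally_patterned F g i k \<eta> \<longleftrightarrow> lab C (g \<eta> k) = lab C (\<eta> i) \<and>
     (\<exists>f \<in> F (lab C (\<eta> i)). \<forall>\<zeta> \<in> cyl i (\<eta> i).
        ccol C (g \<zeta> k, g \<zeta> (Suc k)) = f (ccol C (\<zeta> i, \<zeta> (Suc i))))"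

text \<open>
  Depths start at 1 because labels and colours carry no meaning at the root.
\<close>

definition pattern_like ::
  "('l \<Rightarrow> ('c \<Rightarrow> 'c) set) \<Rightarrow> ((nat \<Rightarrow> 'v) \<Rightarrow> nat \<Rightarrow> 'v) \<Rightarrow> nat \<Rightarrow> nat \<Rightarrow> (nat \<Rightarrow> 'v) \<Rightarrow> bool" where
  "pattern_like F g n m \<xi> \<longleftrightarrow> 1 \<le> n \<and> 1 \<le> m \<and> tree_like g n m \<xi> \<and>
     (\<forall>\<eta> \<in> cyl n (\<xi> n). \<forall>j. locally_patterned F g (n + j) (m + j) \<eta>)"

definition patterned_perms ::
  "('l \<Rightarrow> ('c \<Rightarrow> 'c) set) \<Rightarrow> ((nat \<Rightarrow> 'v) \<Rightarrow> nat \<Rightarrow> 'v) set" where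
  "patterned_perms F =
     {g. g permutes ends \<and> (\<exists>n. \<forall>\<xi> \<in> ends. \<exists>m. pattern_like F g n m \<xi>)}"

lemma pattern_like_tree_like: "pattern_like F g n m \<xi> \<Longrightarrow> tree_like g n m \<xi>"
  by (simp add: pattern_like_def)

lemma pattern_like_locally:
  "\<lbrakk>pattern_like F g n m \<xi>; \<eta> \<in> ends; \<eta> n = \<xi> n\<rbrakk> \<Longrightarrow> locally_patterned F g (n + j) (m + j) \<eta>"
  by (simp add: pattern_like_def)

lemma patterned_perms_tree_like: "patterned_perms F \<subseteq> tree_like_perms"
  using pattern_like_tree_like by (fastforce simp: patterned_perms_def tree_like_perms_def)

lemma pattern_like_cong_end:
  assumes "pattern_like F g n m \<xi>" "\<xi> \<in> ends" "\<eta> \<in> ends" "\<eta> n = \<xi> n"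
  shows "pattern_like F g n m \<eta>"
  using assms tree_like_cong_end[of g n m \<xi> \<eta>] by (simp add: pattern_like_def)

lemma pattern_like_cong_map:
  assumes g: "pattern_like F g n m \<xi>" and \<xi>: "\<xi> \<in> ends"
    and eq: "\<And>\<eta>. \<eta> \<in> cyl n (\<xi> n) \<Longrightarrow> g \<eta> = h \<eta>"
  shows "pattern_like F h n m \<xi>"
proof -
  have "locally_patterned F h (n + j) (m + j) \<eta>" if \<eta>: "\<eta> \<in> cyl n (\<xi> n)" for \<eta> j
  proof -
    have "g \<zeta> = h \<zeta>" if "\<zeta> \<in> cyl (n + j) (\<eta> (n + j))" for \<zeta>
      using that \<eta> ends_agree[of \<zeta> \<eta> "n + j" n] by (intro eq) simp
    moreover have "locally_patterned F g (n + j) (m + j) \<eta>"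
      using g \<eta> by (simp add: pattern_like_def)
    ultimately show ?thesis
      using eq[OF \<eta>] by (simp add: locally_patterned_def)
  qed
  then show ?thesis
    using g tree_like_cong_map[OF pattern_like_tree_like[OF g] \<xi> eq] by (simp add: pattern_like_def)
qed

lemma pattern_like_shift:
  assumes g: "g permutes ends" and \<xi>: "\<xi> \<in> ends" and tl: "pattern_like F g n m \<xi>"
  shows "pattern_like F g (n + i) (m + i) \<xi>"
proof -
  have "locally_patterned F g (n + i + j) (m + i + j) \<eta>" if \<eta>: "\<eta> \<in> cyl (n + i) (\<xi> (n + i))" for \<eta> j
  proof -
    have "\<eta> \<in> ends" "\<eta> n = \<xi> n"
      using \<eta> ends_agree[OF _ \<xi>, of \<eta> "n + i" n] by auto
    then show ?thesis
      using pattern_like_locally[OF tl, of \<eta> "i + j"] by (simp add: add.assoc)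
  qed
  then show ?thesis
    using tl tree_like_shift[OF g \<xi> pattern_like_tree_like[OF tl], of i] by (simp add: pattern_like_def)
qed

lemma pattern_like_mono:
  assumes "pattern_like F g n m \<xi>" "\<xi> \<in> ends" "\<And>l. l \<in> labels C \<Longrightarrow> F l \<subseteq> F' l"
  shows "pattern_like F' g n m \<xi>"
proof -
  have "locally_patterned F' g (n + j) (m + j) \<eta>" if \<eta>: "\<eta> \<in> cyl n (\<xi> n)" for \<eta> j
  proof -
    have "lab C (\<eta> (n + j)) \<in> labels C"
      using \<eta> assms(1) ends_inner lab_in_labels by (simp add: pattern_like_def)
    then show ?thesis
      using assms(1,3) \<eta> unfolding pattern_like_def locally_patterned_def by blast
  qed
  then show ?thesis
    using assms(1) by (simp add: pattern_like_def)
qed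

lemma patterned_perms_mono:
  assumes "\<And>l. l \<in> labels C \<Longrightarrow> F l \<subseteq> F' l"
  shows "patterned_perms F \<subseteq> patterned_perms F'"
  using pattern_like_mono[OF _ _ assms] by (fastforce simp: patterned_perms_def)

text \<open>
  The finiteness of the spheres plays the role of compactness of the space of ends.
\<close>

lemma finite_level_choice:
  fixes P :: "(nat \<Rightarrow> 'v) \<Rightarrow> nat \<Rightarrow> bool"
  assumes "\<And>\<xi>. \<xi> \<in> ends \<Longrightarrow> \<exists>m. P \<xi> m" and "\<And>\<xi> \<eta> m. \<lbrakk>P \<xi> m; \<xi> \<in> ends; \<eta> \<in> ends; \<eta> n = \<xi> n\<rbrakk> \<Longrightarrow> P \<eta> m"
  shows "\<exists>M. \<forall>\<xi> \<in> ends. \<exists>m \<le> M. P \<xi> m"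
proof -
  have "\<exists>m. \<forall>\<xi> \<in> ends. \<xi> n = x \<longrightarrow> P \<xi> m" if "x \<in> sphere n" for x
    using that assms unfolding sphere_def by blast
  then obtain f where f: "\<forall>x \<in> sphere n. \<forall>\<xi> \<in> ends. \<xi> n = x \<longrightarrow> P \<xi> (f x)"
    by metis
  have "\<exists>m \<le> Max (f ` sphere n). P \<xi> m" if \<xi>: "\<xi> \<in> ends" for \<xi>
  proof -
    have "\<xi> n \<in> sphere n"
      using \<xi> by (simp add: sphere_def)
    then have "f (\<xi> n) \<le> Max (f ` sphere n)" "P \<xi> (f (\<xi> n))"
      using f \<xi> finite_sphere by auto
    then show ?thesis
      by blast
  qed
  then show ?thesis
    by blast
qed

subsection \<open>Closure under composition and inverses\<close>

lemma pattern_bij: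
  assumes F: "patterning T C F" and l: "l \<in> labels C" and f: "f \<in> F l"
  shows "f \<in> Bij (all_cols C l)"
proof -
  have "subgroup (F l) (BijGroup (all_cols C l))"
    using F l by (simp add: patterning_def)
  then show ?thesis
    using f subgroup.subset[of "F l" "BijGroup (all_cols C l)"] by (auto simp: BijGroup_def)
qed

lemma pattern_maps:
  assumes F: "patterning T C F" and l: "l \<in> labels C" and f: "f \<in> F l" and d: "d \<in> all_cols C l"
  shows "f d \<in> all_cols C l"
  using pattern_bij[OF F l f] d by (auto simp: Bij_def bij_betw_def)

lemma pattern_comp:
  assumes F: "patterning T C F" and l: "l \<in> labels C" and f: "f \<in> F l" "f' \<in> F l"
  shows "\<exists>f'' \<in> F l. \<forall>d \<in> all_cols C l. f'' d = f (f' d)"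
proof -
  have "subgroup (F l) (BijGroup (all_cols C l))"
    using F l by (simp add: patterning_def)
  then have "f \<otimes>\<^bsub>BijGroup (all_cols C l)\<^esub> f' \<in> F l"
    using f by (rule subgroup.m_closed)
  moreover have "(f \<otimes>\<^bsub>BijGroup (all_cols C l)\<^esub> f') d = f (f' d)" if "d \<in> all_cols C l" for d
    using that pattern_bij[OF F l] f by (simp add: BijGroup_def compose_def)
  ultimately show ?thesis
    by blast
qed

lemma pattern_id:
  assumes F: "patterning T C F" and l: "l \<in> labels C"
  shows "(\<lambda>d \<in> all_cols C l. d) \<in> F l"
proof -
  have "subgroup (F l) (BijGroup (all_cols C l))"
    using F l by (simp add: patterning_def)
  then show ?thesis
    using subgroup.one_closed[of "F l" "BijGroup (all_cols C l)"] by (simp add: BijGroup_def)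
qed

lemma pattern_inv:
  assumes F: "patterning T C F" and l: "l \<in> labels C" and f: "f \<in> F l"
  shows "\<exists>f' \<in> F l. \<forall>d \<in> all_cols C l. f' (f d) = d"
proof -
  have sub: "subgroup (F l) (BijGroup (all_cols C l))"
    using F l by (simp add: patterning_def)
  have bij: "f \<in> Bij (all_cols C l)"
    by (rule pattern_bij[OF F l f])
  have "m_inv (BijGroup (all_cols C l)) f \<in> F l"
    using sub f by (rule subgroup.m_inv_closed)
  moreover have "m_inv (BijGroup (all_cols C l)) f (f d) = d" if "d \<in> all_cols C l" for d
    using that bij pattern_maps[OF F l f that]
    by (simp add: inv_BijGroup inv_into_f_f Bij_def bij_betw_def)
  ultimately show ?thesis
    by blast
qed

lemma locally_patterned_id:
  assumes F: "patterning T C F" and \<eta>: "\<eta> \<in> ends" "1 \<le> i"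
    and g: "\<And>\<zeta>. \<zeta> \<in> cyl i (\<eta> i) \<Longrightarrow> g \<zeta> i = \<zeta> i \<and> g \<zeta> (Suc i) = \<zeta> (Suc i)"
  shows "locally_patterned F g i i \<eta>"
proof -
  have l: "lab C (\<eta> i) \<in> labels C"
    using ends_inner[OF \<eta>] lab_in_labels by blast
  have "ccol C (g \<zeta> i, g \<zeta> (Suc i)) = (\<lambda>d \<in> all_cols C (lab C (\<eta> i)). d) (ccol C (\<zeta> i, \<zeta> (Suc i)))"
    if \<zeta>: "\<zeta> \<in> cyl i (\<eta> i)" for \<zeta>
    using ccol_in_all_cols[of "\<zeta> i" "\<zeta> (Suc i)"] ends_edge[of \<zeta> i] ends_inner[of \<zeta> i] g[OF \<zeta>] \<zeta> \<eta>(2)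
    by auto
  moreover have "g \<eta> i = \<eta> i"
    using g[of \<eta>] \<eta>(1) by simp
  ultimately show ?thesis
    unfolding locally_patterned_def using pattern_id[OF F l]
    by (intro conjI bexI[of _ "\<lambda>d \<in> all_cols C (lab C (\<eta> i)). d"] ballI) simp_all
qed

lemma pattern_like_id:
  assumes F: "patterning T C F" and \<xi>: "\<xi> \<in> ends" "1 \<le> n"
  shows "pattern_like F id n n \<xi>"
  using \<xi> tree_like_id locally_patterned_id[OF F] by (simp add: pattern_like_def)

lemma pattern_like_comp:
  assumes F: "patterning T C F" and \<xi>: "\<xi> \<in> ends" and perm: "h permutes ends"
    and h: "pattern_like F h n m \<xi>" and g: "pattern_like F g m k (h \<xi>)"
  shows "pattern_like F (g \<circ> h) n k \<xi>"
proof -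
  have nm: "1 \<le> n" "1 \<le> m" "1 \<le> k"
    using g h by (auto simp: pattern_like_def)
  note tl = pattern_like_tree_like[OF h] pattern_like_tree_like[OF g]
  have "locally_patterned F (g \<circ> h) (n + j) (k + j) \<eta>" if \<eta>: "\<eta> \<in> cyl n (\<xi> n)" for \<eta> j
  proof -
    have \<eta>': "\<eta> \<in> ends" "\<eta> n = \<xi> n"
      using \<eta> by auto
    have h\<eta>: "h \<eta> \<in> ends" "h \<eta> m = h \<xi> m"
      using tree_like_base[OF tl(1) \<xi>] \<eta> permutes_in_image[OF perm] by auto
    have 1: "locally_patterned F h (n + j) (m + j) \<eta>"
      by (rule pattern_like_locally[OF h \<eta>'])
    have 2: "locally_patterned F g (m + j) (k + j) (h \<eta>)"
      by (rule pattern_like_locally[OF g h\<eta>])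
    let ?l = "lab C (\<eta> (n + j))"
    have l: "?l \<in> labels C"
      using ends_inner[OF \<eta>'(1), of "n + j"] nm lab_in_labels by simp
    have lab: "lab C (h \<eta> (m + j)) = ?l" "lab C (g (h \<eta>) (k + j)) = ?l"
      using 1 2 by (auto simp: locally_patterned_def)
    obtain f where f: "f \<in> F ?l" "\<forall>\<zeta> \<in> cyl (n + j) (\<eta> (n + j)).
        ccol C (h \<zeta> (m + j), h \<zeta> (Suc (m + j))) = f (ccol C (\<zeta> (n + j), \<zeta> (Suc (n + j))))"
      using 1 by (auto simp: locally_patterned_def)
    obtain f' where f': "f' \<in> F ?l" "\<forall>\<zeta> \<in> cyl (m + j) (h \<eta> (m + j)).
        ccol C (g \<zeta> (k + j), g \<zeta> (Suc (k + j))) = f' (ccol C (\<zeta> (m + j), \<zeta> (Suc (m + j))))"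
      using 2 lab(1) by (auto simp: locally_patterned_def)
    obtain f'' where f'': "f'' \<in> F ?l" "\<forall>d \<in> all_cols C ?l. f'' d = f' (f d)"
      using pattern_comp[OF F l f'(1) f(1)] by blast
    have "ccol C ((g \<circ> h) \<zeta> (k + j), (g \<circ> h) \<zeta> (Suc (k + j))) = f'' (ccol C (\<zeta> (n + j), \<zeta> (Suc (n + j))))"
      if \<zeta>: "\<zeta> \<in> cyl (n + j) (\<eta> (n + j))" for \<zeta>
    proof -
      have \<zeta>': "\<zeta> \<in> ends" "\<zeta> n = \<xi> n" "\<zeta> (n + j) = \<eta> (n + j)"
        using \<zeta> \<eta>' ends_agree[OF _ \<eta>'(1), of \<zeta> "n + j" n] by auto
      have "h \<zeta> (m + j) = h \<eta> (m + j)"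
        using tree_like_iff[OF tl(1) \<zeta>'(1,2) \<eta>'] \<zeta>'(3) by blast
      then have h\<zeta>: "h \<zeta> \<in> cyl (m + j) (h \<eta> (m + j))"
        using permutes_in_image[OF perm] \<zeta>'(1) by simp
      have "ccol C (g (h \<zeta>) (k + j), g (h \<zeta>) (Suc (k + j))) = f' (f (ccol C (\<zeta> (n + j), \<zeta> (Suc (n + j)))))"
        by (simp only: bspec[OF f'(2) h\<zeta>] bspec[OF f(2) \<zeta>])
      moreover have "ccol C (\<zeta> (n + j), \<zeta> (Suc (n + j))) \<in> all_cols C ?l"
        using ccol_in_all_cols[OF ends_inner[OF \<zeta>'(1)] ends_edge[OF \<zeta>'(1)], of "n + j"] nm \<zeta>'(3) by simp
      ultimately show ?thesis
        using f''(2) by simp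
    qed
    then show ?thesis
      unfolding locally_patterned_def using f''(1) lab by auto
  qed
  then show ?thesis
    using tree_like_comp[OF tl] nm by (simp add: pattern_like_def)
qed

lemma pattern_like_inv:
  assumes F: "patterning T C F" and \<xi>: "\<xi> \<in> ends" and perm: "g permutes ends"
    and g: "pattern_like F g n m \<xi>"
  shows "pattern_like F (perm_inv g) m n (g \<xi>)"
proof -
  have nm: "1 \<le> n" "1 \<le> m"
    using g by (auto simp: pattern_like_def)
  note tl = pattern_like_tree_like[OF g]
  note inv = permutes_inverses[OF perm]
  have "locally_patterned F (perm_inv g) (m + j) (n + j) \<eta>" if \<eta>: "\<eta> \<in> cyl m (g \<xi> m)" for \<eta> j
  proof -
    obtain \<zeta> where \<zeta>: "\<zeta> \<in> cyl n (\<xi> n)" "\<eta> = g \<zeta>"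
      using \<eta> tree_like_image[OF tl] by blast
    then have \<zeta>': "\<zeta> \<in> ends" "\<zeta> n = \<xi> n"
      by auto
    let ?l = "lab C (\<zeta> (n + j))"
    have l: "?l \<in> labels C"
      using ends_inner[OF \<zeta>'(1), of "n + j"] nm lab_in_labels by simp
    have lp: "locally_patterned F g (n + j) (m + j) \<zeta>"
      by (rule pattern_like_locally[OF g \<zeta>'])
    then have lab: "lab C (\<eta> (m + j)) = ?l"
      using \<zeta>(2) by (simp add: locally_patterned_def)
    obtain f where f: "f \<in> F ?l" "\<forall>\<theta> \<in> cyl (n + j) (\<zeta> (n + j)).
        ccol C (g \<theta> (m + j), g \<theta> (Suc (m + j))) = f (ccol C (\<theta> (n + j), \<theta> (Suc (n + j))))"
      using lp by (auto simp: locally_patterned_def)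
    obtain f' where f': "f' \<in> F ?l" "\<forall>d \<in> all_cols C ?l. f' (f d) = d"
      using pattern_inv[OF F l f(1)] by blast
    have img: "g ` cyl (n + j) (\<zeta> (n + j)) = cyl (m + j) (\<eta> (m + j))"
      using tree_like_image[OF tree_like_shift[OF perm \<zeta>'(1) tree_like_cong_end[OF tl \<xi> \<zeta>']], of j] \<zeta>(2)
      by simp
    have "ccol C (perm_inv g \<theta> (n + j), perm_inv g \<theta> (Suc (n + j))) = f' (ccol C (\<theta> (m + j), \<theta> (Suc (m + j))))"
      if \<theta>: "\<theta> \<in> cyl (m + j) (\<eta> (m + j))" for \<theta>
    proof -
      obtain \<kappa> where \<kappa>: "\<kappa> \<in> cyl (n + j) (\<zeta> (n + j))" "\<theta> = g \<kappa>"
        using \<theta> img by blast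
      have "ccol C (\<kappa> (n + j), \<kappa> (Suc (n + j))) \<in> all_cols C ?l"
        using ccol_in_all_cols[of "\<kappa> (n + j)" "\<kappa> (Suc (n + j))"] ends_inner[of \<kappa> "n + j"]
          ends_edge[of \<kappa> "n + j"] nm \<kappa>(1) by simp
      then show ?thesis
        using bspec[OF f(2) \<kappa>(1)] f'(2) \<kappa>(2) by (simp add: inv)
    qed
    then show ?thesis
      unfolding locally_patterned_def using f'(1) lab \<zeta>(2) by (auto simp: inv)
  qed
  then show ?thesis
    using tree_like_inv[OF perm tl] nm by (simp add: pattern_like_def)
qed

text \<open>
  The bounds state that the depth of images grows with \<open>k\<close> and, for fixed \<open>k\<close>, is bounded; the former
  serves for composition and the latter for inversion.
\<close>

lemma patterned_perms_levels:
  assumes g: "g \<in> patterned_perms F"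
  shows "\<exists>n. \<forall>k \<ge> n. \<exists>M. \<forall>\<xi> \<in> ends. \<exists>m. pattern_like F g k m \<xi> \<and> k \<le> m + n \<and> m \<le> M"
proof -
  have perm: "g permutes ends"
    using g by (simp add: patterned_perms_def)
  obtain n where n: "\<forall>\<xi> \<in> ends. \<exists>m. pattern_like F g n m \<xi>"
    using g by (auto simp: patterned_perms_def)
  have "\<exists>M. \<forall>\<xi> \<in> ends. \<exists>m \<le> M. pattern_like F g n m \<xi>"
    by (rule finite_level_choice[where n = n]) (use n pattern_like_cong_end in auto)
  then obtain M where M: "\<forall>\<xi> \<in> ends. \<exists>m \<le> M. pattern_like F g n m \<xi>"
    by blast
  have "\<exists>m. pattern_like F g k m \<xi> \<and> k \<le> m + n \<and> m \<le> M + k" if k: "k \<ge> n" and \<xi>: "\<xi> \<in> ends" for k \<xi>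
  proof -
    obtain m where m: "m \<le> M" "pattern_like F g n m \<xi>"
      using M \<xi> by blast
    have "pattern_like F g k (m + (k - n)) \<xi>"
      using pattern_like_shift[OF perm \<xi> m(2), of "k - n"] k by simp
    then show ?thesis
      using m(1) k by (intro exI[of _ "m + (k - n)"]) simp
  qed
  then show ?thesis
    by blast
qed

lemma id_patterned: "patterning T C F \<Longrightarrow> id \<in> patterned_perms F"
  using pattern_like_id[of F _ 1] permutes_id by (auto simp: patterned_perms_def)

lemma comp_patterned:
  assumes F: "patterning T C F" and g: "g \<in> patterned_perms F" and h: "h \<in> patterned_perms F"
  shows "g \<circ> h \<in> patterned_perms F"
proof -
  have perm: "g permutes ends" "h permutes ends"
    using g h by (auto simp: patterned_perms_def)
  obtain n where n: "\<forall>k \<ge> n. \<exists>M. \<forall>\<xi> \<in> ends. \<exists>m. pattern_like F g k m \<xi> \<and> k \<le> m + n \<and> m \<le> M"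
    using patterned_perms_levels[OF g] by blast
  obtain n' where n': "\<forall>k \<ge> n'. \<exists>M. \<forall>\<xi> \<in> ends. \<exists>m. pattern_like F h k m \<xi> \<and> k \<le> m + n' \<and> m \<le> M"
    using patterned_perms_levels[OF h] by blast
  have "\<exists>m. pattern_like F (g \<circ> h) (n + n') m \<xi>" if \<xi>: "\<xi> \<in> ends" for \<xi>
  proof -
    obtain m where m: "pattern_like F h (n + n') m \<xi>" "n + n' \<le> m + n'"
      using n' \<xi> le_add2 by meson
    have "h \<xi> \<in> ends"
      using permutes_in_image[OF perm(2)] \<xi> by simp
    then obtain k where "pattern_like F g m k (h \<xi>)"
      using n m(2) by (metis add_le_cancel_right)
    then show ?thesis
      using pattern_like_comp[OF F \<xi> perm(2) m(1)] by blast
  qed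
  then show ?thesis
    using permutes_compose[OF perm(2,1)] by (auto simp: patterned_perms_def)
qed

lemma inv_patterned:
  assumes F: "patterning T C F" and g: "g \<in> patterned_perms F"
  shows "perm_inv g \<in> patterned_perms F"
proof -
  have perm: "g permutes ends"
    using g by (simp add: patterned_perms_def)
  obtain n M where M: "\<forall>\<xi> \<in> ends. \<exists>m. pattern_like F g n m \<xi> \<and> m \<le> M"
    using patterned_perms_levels[OF g] by (meson le_refl)
  have "\<exists>k. pattern_like F (perm_inv g) M k \<zeta>" if \<zeta>: "\<zeta> \<in> ends" for \<zeta>
  proof -
    obtain \<xi> where \<xi>: "\<xi> \<in> ends" "\<zeta> = g \<xi>"
      using \<zeta> permutes_image[OF perm] by blast
    obtain m where m: "pattern_like F g n m \<xi>" "m \<le> M"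
      using M \<xi>(1) by blast
    have "pattern_like F (perm_inv g) m n \<zeta>"
      using pattern_like_inv[OF F \<xi>(1) perm m(1)] \<xi>(2) by simp
    then show ?thesis
      using pattern_like_shift[OF permutes_inv[OF perm] \<zeta>, of F m n "M - m"] m(2) by auto
  qed
  then show ?thesis
    using permutes_inv[OF perm] by (auto simp: patterned_perms_def)
qed

section \<open>Patterned almost automorphisms\<close>

text \<open>
  With these permutation groups, patterned means child colour preserving, so the Thompson-like group of
  the colouring structure is a special case of a group of patterned almost automorphisms.
\<close>

definition trivial_pattern :: "'l \<Rightarrow> ('c \<Rightarrow> 'c) set" where
  "trivial_pattern l = {\<lambda>d \<in> all_cols C l. d}"

lemma patterning_trivial: "patterning T C trivial_pattern"
  unfolding patterning_def
proof (intro conjI ballI)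
  show "colouring_structure T C"
    by (rule colouring)
  fix l assume l: "l \<in> labels C"
  interpret B: group "BijGroup (all_cols C l)"
    by (rule group_BijGroup)
  show "subgroup (trivial_pattern l) (BijGroup (all_cols C l))"
    using B.triv_subgroup by (simp add: trivial_pattern_def BijGroup_def)
  fix f l' assume "f \<in> trivial_pattern l" "l' \<in> labels C"
  then show "f ` cols C l l' = cols C l l'"
    by (force simp: trivial_pattern_def all_cols_def)
qed

lemma trivial_patterned_subset:
  assumes F: "patterning T C F"
  shows "patterned_perms trivial_pattern \<subseteq> patterned_perms F"
  by (rule patterned_perms_mono) (use pattern_id[OF F] in \<open>auto simp: trivial_pattern_def\<close>)

lemma local_permutation_ccol:
  assumes x: "x \<in> inner_verts" and xy: "(x, y) \<in> tedges T"
  shows "local_permutation T C \<phi> x (ccol C (x, y)) = ccol C (\<phi> x, \<phi> y)"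
proof -
  have "inj_on (ccol C) {e \<in> tedges T. fst e = x}"
    using ccol_inj[OF x] by (auto simp: inj_on_def)
  then have "inv_into {e \<in> tedges T. fst e = x} (ccol C) (ccol C (x, y)) = (x, y)"
    by (rule inv_into_f_f) (simp add: xy)
  then show ?thesis
    using ccol_in_all_cols[OF x xy] by (simp add: local_permutation_def)
qed

text \<open>
  Labels are preserved because the local permutation at a vertex maps its colours to
  colours for the same label, and colours for different labels are disjoint. To stay away from the
  root, the pattern is read off one level below the leaves.
\<close>

lemma patterned_if_representative:
  assumes F: "patterning T C F"
    and p: "(S1, S2, \<phi>) \<in> honest_almost_automorphisms T" "induces (S1, S2, \<phi>) g"
    and pat: "\<And>x. x \<in> forest T S1 - {troot T} \<Longrightarrow>
      \<exists>f \<in> F (lab C x). \<forall>y. (x, y) \<in> tedges T \<longrightarrow> ccol C (\<phi> x, \<phi> y) = f (ccol C (x, y))"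
  shows "g \<in> patterned_perms F"
proof -
  have perm: "g permutes ends"
    using p(2) by (simp add: induces_def)
  have S1: "finite_complete_subtree T S1"
    using p(1) by (simp add: honest_iff)
  obtain n0 where n0: "\<forall>n \<ge> n0. \<forall>\<xi> \<in> ends. \<exists>N \<le> n. \<xi> N \<in> leaves T S1"
    using leaf_bound[OF S1] by blast
  have "\<exists>m. pattern_like F g (Suc n0) m \<xi>" if \<xi>: "\<xi> \<in> ends" for \<xi>
  proof -
    obtain N where N: "N \<le> n0" "\<xi> N \<in> leaves T S1"
      using n0 \<xi> by blast
    then have NS: "N \<le> Suc n0"
      by simp
    obtain m where m: "Suc n0 - N \<le> m" "tree_like g (Suc n0) m \<xi>"
        "\<forall>\<eta> \<in> cyl (Suc n0) (\<xi> (Suc n0)). \<forall>j. g \<eta> (m + j) = \<phi> (\<eta> (Suc n0 + j))"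
      using induces_tree_like_below[OF p \<xi> N(2) NS] by blast
    have m1: "1 \<le> m"
      using m(1) N(1) by simp
    have "locally_patterned F g (Suc n0 + j) (m + j) \<eta>" if \<eta>: "\<eta> \<in> cyl (Suc n0) (\<xi> (Suc n0))" for \<eta> j
    proof -
      let ?x = "\<eta> (Suc n0 + j)"
      have \<eta>': "\<eta> \<in> ends" "\<eta> (Suc n0) = \<xi> (Suc n0)"
        using \<eta> by auto
      have "\<eta> N \<in> leaves T S1"
        using ends_agree[OF \<eta>'(1) \<xi> \<eta>'(2) NS] N(2) by simp
      then have "?x \<in> forest T S1"
        using forestI[OF \<eta>'(1), of N S1 "Suc n0 + j - N"] N(1) by simp
      moreover have x: "?x \<in> inner_verts"
        using ends_inner[OF \<eta>'(1)] by simp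
      ultimately obtain f where f: "f \<in> F (lab C ?x)"
          "\<forall>y. (?x, y) \<in> tedges T \<longrightarrow> ccol C (\<phi> ?x, \<phi> y) = f (ccol C (?x, y))"
        using pat[of ?x] by blast
      have cyl: "\<zeta> \<in> cyl (Suc n0) (\<xi> (Suc n0))" if \<zeta>: "\<zeta> \<in> cyl (Suc n0 + j) ?x" for \<zeta>
        using \<zeta> \<eta>' ends_agree[OF _ \<eta>'(1), of \<zeta> "Suc n0 + j" "Suc n0"] by simp
      have col: "ccol C (g \<zeta> (m + j), g \<zeta> (Suc (m + j))) = f (ccol C (\<zeta> (Suc n0 + j), \<zeta> (Suc (Suc n0 + j))))"
        if \<zeta>: "\<zeta> \<in> cyl (Suc n0 + j) ?x" for \<zeta>
      proof -
        have "g \<zeta> (m + j) = \<phi> (\<zeta> (Suc n0 + j))" "g \<zeta> (m + Suc j) = \<phi> (\<zeta> (Suc n0 + Suc j))"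
          using m(3) cyl[OF \<zeta>] by blast+
        then show ?thesis
          using f(2) \<zeta> ends_edge[of \<zeta> "Suc n0 + j"] by simp
      qed
      have "lab C (g \<eta> (m + j)) = lab C ?x"
      proof -
        have g\<eta>: "g \<eta> \<in> ends"
          using permutes_in_image[OF perm] \<eta>'(1) by simp
        have gx: "g \<eta> (m + j) \<in> inner_verts"
          using ends_inner[OF g\<eta>] m1 by simp
        have "f (ccol C (?x, \<eta> (Suc (Suc n0 + j)))) \<in> all_cols C (lab C ?x)"
          using pattern_maps[OF F lab_in_labels[OF x] f(1)] ccol_in_all_cols[OF x] ends_edge[OF \<eta>'(1)]
          by blast
        then have "ccol C (g \<eta> (m + j), g \<eta> (Suc (m + j))) \<in> all_cols C (lab C ?x)"
          using col[of \<eta>] \<eta>'(1) by simp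
        then show ?thesis
          using ccol_in_all_cols[OF gx ends_edge[OF g\<eta>]] all_cols_disjoint lab_in_labels[OF x]
            lab_in_labels[OF gx] by blast
      qed
      then show ?thesis
        unfolding locally_patterned_def using f(1) col by blast
    qed
    then show ?thesis
      using m(2) m1 by (auto simp: pattern_like_def)
  qed
  then show ?thesis
    using perm by (auto simp: patterned_perms_def)
qed

lemma ex_patterned_representative:
  assumes g: "g \<in> patterned_perms F"
  shows "\<exists>S1 S2 \<phi>. (S1, S2, \<phi>) \<in> honest_almost_automorphisms T \<and> induces (S1, S2, \<phi>) g \<and>
    (\<forall>v \<in> leaves T S1. lab C (\<phi> v) = lab C v) \<and>
    (\<forall>x \<in> forest T S1. x \<in> inner_verts \<and> (\<exists>f \<in> F (lab C x). \<forall>y.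
       (x, y) \<in> tedges T \<longrightarrow> ccol C (\<phi> x, \<phi> y) = f (ccol C (x, y))))"
proof -
  have perm: "g permutes ends"
    using g by (simp add: patterned_perms_def)
  obtain n where n: "\<forall>\<xi> \<in> ends. \<exists>m. pattern_like F g n m \<xi>"
    using g by (auto simp: patterned_perms_def)
  then have "\<forall>\<xi> \<in> ends. \<exists>m. tree_like g n m \<xi>"
    using pattern_like_tree_like by blast
  then obtain S1 S2 \<phi> where p: "leaves T S1 = sphere n" "(S1, S2, \<phi>) \<in> honest_almost_automorphisms T"
      "induces (S1, S2, \<phi>) g"
      "\<forall>\<xi> \<in> ends. \<forall>m. tree_like g n m \<xi> \<longrightarrow> g \<xi> m \<in> leaves T S2 \<and> (\<forall>j. \<phi> (\<xi> (n + j)) = g \<xi> (m + j))"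
    using ex_representative_on_sphere[OF perm] by blast
  have S1: "finite_complete_subtree T S1"
    using p(2) by (simp add: honest_iff)
  have \<phi>: "\<phi> (\<xi> (n + j)) = g \<xi> (m + j)" if "\<xi> \<in> ends" "pattern_like F g n m \<xi>" for \<xi> m j
    using p(4) that pattern_like_tree_like by blast
  have "lab C (\<phi> v) = lab C v" if v: "v \<in> leaves T S1" for v
  proof -
    obtain \<xi> where \<xi>: "\<xi> \<in> ends" "v = \<xi> n"
      using v p(1) by (auto simp: sphere_def)
    obtain m where m: "pattern_like F g n m \<xi>"
      using n \<xi>(1) by blast
    then show ?thesis
      using pattern_like_locally[OF m \<xi>(1) refl, of 0] \<phi>[OF \<xi>(1) m, of 0] \<xi>(2)
      by (simp add: locally_patterned_def)
  qed
  moreover have "x \<in> inner_verts \<and> (\<exists>f \<in> F (lab C x). \<forall>y.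
       (x, y) \<in> tedges T \<longrightarrow> ccol C (\<phi> x, \<phi> y) = f (ccol C (x, y)))" if x: "x \<in> forest T S1" for x
  proof -
    obtain \<xi> N j where \<xi>: "\<xi> \<in> ends" "\<xi> N \<in> leaves T S1" "x = \<xi> (N + j)"
      using forestE[OF S1 x] by blast
    have N: "N = n"
      using \<xi>(1,2) p(1) ends_level[OF \<xi>(1)] by (auto simp: sphere_def)
    obtain m where m: "pattern_like F g n m \<xi>"
      using n \<xi>(1) by blast
    have n1: "1 \<le> n"
      using m by (simp add: pattern_like_def)
    obtain f where f: "f \<in> F (lab C x)" "\<forall>\<zeta> \<in> cyl (n + j) x.
        ccol C (g \<zeta> (m + j), g \<zeta> (Suc (m + j))) = f (ccol C (\<zeta> (n + j), \<zeta> (Suc (n + j))))"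
      using pattern_like_locally[OF m \<xi>(1) refl, of j] \<xi>(3) N by (auto simp: locally_patterned_def)
    have "ccol C (\<phi> x, \<phi> y) = f (ccol C (x, y))" if xy: "(x, y) \<in> tedges T" for y
    proof -
      obtain \<zeta> where \<zeta>: "\<zeta> \<in> ends" "\<forall>i \<le> n + j. \<zeta> i = \<xi> i" "\<zeta> (Suc (n + j)) = y"
        using ex_end_child[OF \<xi>(1), of "n + j" y] xy \<xi>(3) N by blast
      have "pattern_like F g n m \<zeta>"
        using pattern_like_cong_end[OF m \<xi>(1) \<zeta>(1)] \<zeta>(2) by simp
      then have "\<phi> (\<zeta> (n + j)) = g \<zeta> (m + j)" "\<phi> (\<zeta> (n + Suc j)) = g \<zeta> (m + Suc j)"
        using \<phi>[OF \<zeta>(1)] by blast+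
      moreover have "\<zeta> (n + j) = x"
        using \<zeta>(2) \<xi>(3) N by simp
      ultimately show ?thesis
        using bspec[OF f(2), of \<zeta>] \<zeta>(1,3) by simp
    qed
    moreover have "x \<in> inner_verts"
      using ends_inner[OF \<xi>(1), of "N + j"] \<xi>(3) N n1 by simp
    ultimately show ?thesis
      using f(1) by blast
  qed
  ultimately show ?thesis
    using p(2,3) by blast
qed

lemma carrier_AAut_pat:
  assumes F: "patterning T C F"
  shows "carrier (AAut_pat T C F) = almost_of ` patterned_perms F"
proof
  show "carrier (AAut_pat T C F) \<subseteq> almost_of ` patterned_perms F"
  proof
    fix A assume "A \<in> carrier (AAut_pat T C F)"
    then obtain p where A: "A \<in> carrier (AAut T)" "p \<in> A" "honest_patterning T C F p"
      by (auto simp: AAut_pat_def)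
    then obtain g where g: "A = almost_of g"
      by (auto simp: carrier_AAut)
    obtain S1 S2 \<phi> where p: "p = (S1, S2, \<phi>)"
      by (cases p)
    have "g \<in> patterned_perms F"
    proof (rule patterned_if_representative[OF F])
      show "(S1, S2, \<phi>) \<in> honest_almost_automorphisms T" "induces (S1, S2, \<phi>) g"
        using A(2) g p by (auto simp: almost_of_def)
      then have S1: "finite_complete_subtree T S1"
        by (simp add: honest_iff)
      fix x assume x: "x \<in> forest T S1 - {troot T}"
      then have "x \<in> inner_verts"
        using forestE[OF S1, of x] ends_vert by auto
      then show "\<exists>f \<in> F (lab C x). \<forall>y. (x, y) \<in> tedges T \<longrightarrow> ccol C (\<phi> x, \<phi> y) = f (ccol C (x, y))"
        using A(3) x local_permutation_ccol unfolding p honest_patterning_def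
        by (intro bexI[of _ "local_permutation T C \<phi> x"]) auto
    qed
    then show "A \<in> almost_of ` patterned_perms F"
      using g by blast
  qed
  show "almost_of ` patterned_perms F \<subseteq> carrier (AAut_pat T C F)"
  proof
    fix A assume "A \<in> almost_of ` patterned_perms F"
    then obtain g where g: "g \<in> patterned_perms F" "A = almost_of g"
      by blast
    obtain S1 S2 \<phi> where p: "(S1, S2, \<phi>) \<in> honest_almost_automorphisms T" "induces (S1, S2, \<phi>) g"
        "\<forall>v \<in> leaves T S1. lab C (\<phi> v) = lab C v"
        "\<forall>x \<in> forest T S1. x \<in> inner_verts \<and> (\<exists>f \<in> F (lab C x). \<forall>y.
          (x, y) \<in> tedges T \<longrightarrow> ccol C (\<phi> x, \<phi> y) = f (ccol C (x, y)))"
      using ex_patterned_representative[OF g(1)] by blast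
    have "local_permutation T C \<phi> x \<in> F (lab C x)" if x: "x \<in> forest T S1" for x
    proof -
      have xi: "x \<in> inner_verts"
        using p(4) x by blast
      obtain f where f: "f \<in> F (lab C x)"
          "\<forall>y. (x, y) \<in> tedges T \<longrightarrow> ccol C (\<phi> x, \<phi> y) = f (ccol C (x, y))"
        using p(4) x by blast
      have "local_permutation T C \<phi> x = f"
      proof (rule extensionalityI[of _ "all_cols C (lab C x)"])
        show "local_permutation T C \<phi> x \<in> extensional (all_cols C (lab C x))"
          by (simp add: local_permutation_def)
        show "f \<in> extensional (all_cols C (lab C x))"
          using pattern_bij[OF F lab_in_labels[OF xi] f(1)] by (simp add: Bij_def)
        fix d assume "d \<in> all_cols C (lab C x)"
        then obtain y where "(x, y) \<in> tedges T" "ccol C (x, y) = d"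
          using ex_child_coloured[OF xi] by blast
        then show "local_permutation T C \<phi> x d = f d"
          using local_permutation_ccol[OF xi, of y \<phi>] f(2) by auto
      qed
      then show ?thesis
        using f(1) by simp
    qed
    then have "honest_patterning T C F (S1, S2, \<phi>)"
      using p(3) by (simp add: honest_patterning_def)
    moreover have "(S1, S2, \<phi>) \<in> A"
      using p g(2) by (simp add: almost_of_def)
    moreover have "A \<in> carrier (AAut T)"
      using g patterned_perms_tree_like by (auto simp: carrier_AAut)
    ultimately show "A \<in> carrier (AAut_pat T C F)"
      by (auto simp: AAut_pat_def)
  qed
qed

lemma V_group_eq: "V_group T C = almost_of ` patterned_perms trivial_pattern"
proof
  show "V_group T C \<subseteq> almost_of ` patterned_perms trivial_pattern"
  proof
    fix A assume "A \<in> V_group T C"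
    then obtain p where A: "A \<in> carrier (AAut T)" "p \<in> A" "child_colour_preserving T C p"
      by (auto simp: V_group_def)
    then obtain g where g: "A = almost_of g"
      by (auto simp: carrier_AAut)
    obtain S1 S2 \<phi> where p: "p = (S1, S2, \<phi>)"
      by (cases p)
    have "g \<in> patterned_perms trivial_pattern"
    proof (rule patterned_if_representative[OF patterning_trivial])
      show "(S1, S2, \<phi>) \<in> honest_almost_automorphisms T" "induces (S1, S2, \<phi>) g"
        using A(2) g p by (auto simp: almost_of_def)
      then have S1: "finite_complete_subtree T S1"
        by (simp add: honest_iff)
      fix x assume x: "x \<in> forest T S1 - {troot T}"
      then have xi: "x \<in> inner_verts"
        using forestE[OF S1, of x] ends_vert by auto
      have "ccol C (\<phi> x, \<phi> y) = (\<lambda>d \<in> all_cols C (lab C x). d) (ccol C (x, y))" if "(x, y) \<in> tedges T" for y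
        using A(3) x that ccol_in_all_cols[OF xi that] unfolding p child_colour_preserving_def by force
      then show "\<exists>f \<in> trivial_pattern (lab C x). \<forall>y. (x, y) \<in> tedges T \<longrightarrow> ccol C (\<phi> x, \<phi> y) = f (ccol C (x, y))"
        by (simp add: trivial_pattern_def)
    qed
    then show "A \<in> almost_of ` patterned_perms trivial_pattern"
      using g by blast
  qed
  show "almost_of ` patterned_perms trivial_pattern \<subseteq> V_group T C"
  proof
    fix A assume "A \<in> almost_of ` patterned_perms trivial_pattern"
    then obtain g where g: "g \<in> patterned_perms trivial_pattern" "A = almost_of g"
      by blast
    obtain S1 S2 \<phi> where p: "(S1, S2, \<phi>) \<in> honest_almost_automorphisms T" "induces (S1, S2, \<phi>) g"
        "\<forall>x \<in> forest T S1. x \<in> inner_verts \<and> (\<exists>f \<in> trivial_pattern (lab C x). \<forall>y.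
          (x, y) \<in> tedges T \<longrightarrow> ccol C (\<phi> x, \<phi> y) = f (ccol C (x, y)))"
      using ex_patterned_representative[OF g(1)] by blast
    have "ccol C (\<phi> x, \<phi> y) = ccol C (x, y)" if "x \<in> forest T S1" "(x, y) \<in> tedges T" for x y
      using p(3) that ccol_in_all_cols by (auto simp: trivial_pattern_def)
    then have "child_colour_preserving T C (S1, S2, \<phi>)"
      by (auto simp: child_colour_preserving_def)
    moreover have "(S1, S2, \<phi>) \<in> A"
      using p g(2) by (simp add: almost_of_def)
    moreover have "A \<in> carrier (AAut T)"
      using g patterned_perms_tree_like by (auto simp: carrier_AAut)
    ultimately show "A \<in> V_group T C"
      by (auto simp: V_group_def)
  qed
qed

section \<open>Colour preserving maps between cylinders\<close>

text \<open>
  The edges of \<open>\<eta>\<close> below depth \<open>n\<close> and those of \<open>\<zeta>\<close> below depth \<open>k\<close> spell the same word of colours.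
\<close>

definition same_colours :: "nat \<Rightarrow> nat \<Rightarrow> (nat \<Rightarrow> 'v) \<Rightarrow> (nat \<Rightarrow> 'v) \<Rightarrow> bool" where
  "same_colours n k \<eta> \<zeta> \<longleftrightarrow>
     (\<forall>j. ccol C (\<zeta> (k + j), \<zeta> (Suc (k + j))) = ccol C (\<eta> (n + j), \<eta> (Suc (n + j))))"

lemma same_colours_sym: "same_colours n k \<eta> \<zeta> \<Longrightarrow> same_colours k n \<zeta> \<eta>"
  by (simp add: same_colours_def)

lemma same_colours_labels:
  assumes "\<eta> \<in> ends" "\<zeta> \<in> ends" "1 \<le> n" "1 \<le> k" "same_colours n k \<eta> \<zeta>"
  shows "lab C (\<zeta> (k + j)) = lab C (\<eta> (n + j))"
  using ccol_eq_labels[of "\<zeta> (k + j)" "\<zeta> (Suc (k + j))" "\<eta> (n + j)" "\<eta> (Suc (n + j))"]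
    ends_inner[OF assms(1), of "n + j"] ends_inner[OF assms(2), of "k + j"] ends_edge assms
  by (simp add: same_colours_def)

lemma same_colours_agree:
  assumes ends: "\<eta> \<in> ends" "\<eta>' \<in> ends" "\<zeta> \<in> ends" "\<zeta>' \<in> ends" and nk: "1 \<le> n" "1 \<le> k"
    and base: "\<eta> n = \<eta>' n" "\<zeta> k = \<zeta>' k"
    and col: "same_colours n k \<eta> \<zeta>" "same_colours n k \<eta>' \<zeta>'"
  shows "\<eta> (n + j) = \<eta>' (n + j) \<longleftrightarrow> \<zeta> (k + j) = \<zeta>' (k + j)"
proof -
  have imp: "\<zeta> (k + j) = \<zeta>' (k + j)"
    if ends: "\<eta> \<in> ends" "\<eta>' \<in> ends" "\<zeta> \<in> ends" "\<zeta>' \<in> ends" and nk: "1 \<le> n" "1 \<le> k"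
      and base: "\<zeta> k = \<zeta>' k"
      and col: "same_colours n k \<eta> \<zeta>" "same_colours n k \<eta>' \<zeta>'"
      and eq: "\<eta> (n + j) = \<eta>' (n + j)" for \<eta> \<eta>' \<zeta> \<zeta>' n k j
    using eq
  proof (induction j)
    case 0
    then show ?case
      using base by simp
  next
    case (Suc j)
    have "\<eta> (n + j) = \<eta>' (n + j)"
      using Suc.prems ends_agree[OF ends(1,2), of "n + Suc j" "n + j"] by simp
    then have \<zeta>: "\<zeta> (k + j) = \<zeta>' (k + j)"
      by (rule Suc.IH)
    have "ccol C (\<zeta> (k + j), \<zeta> (Suc (k + j))) = ccol C (\<zeta>' (k + j), \<zeta>' (Suc (k + j)))"
      using col Suc.prems \<open>\<eta> (n + j) = \<eta>' (n + j)\<close> by (simp add: same_colours_def)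
    then show ?case
      using ccol_inj[of "\<zeta> (k + j)" "\<zeta> (Suc (k + j))" "\<zeta>' (Suc (k + j))"] \<zeta> nk
        ends_inner[OF ends(3), of "k + j"] ends_edge[OF ends(3), of "k + j"] ends_edge[OF ends(4), of "k + j"]
      by simp
  qed
  show ?thesis
    using imp[OF ends nk base(2) col] imp[OF ends(3,4,1,2) nk(2,1) base(1) col[THEN same_colours_sym]]
    by blast
qed

text \<open>
  Vertices with the same label have the same colours on the edges to their children, so a word of
  colours that can be read below one vertex can be read below the other, letter by letter.
\<close>

lemma ex_same_colours:
  assumes \<eta>: "\<eta> \<in> ends" and \<omega>: "\<omega> \<in> ends" and nk: "1 \<le> n" "1 \<le> k" and lab: "lab C (\<omega> k) = lab C (\<eta> n)"
  shows "\<exists>\<zeta> \<in> cyl k (\<omega> k). same_colours n k \<eta> \<zeta>"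
proof -
  \<comment> \<open>The last conjunct of \<open>P\<close> makes the chosen path start at \<open>\<omega> k\<close>.\<close>
  define P where "P j w \<longleftrightarrow> w \<in> inner_verts \<and> lab C w = lab C (\<eta> (n + j)) \<and> (j = 0 \<longrightarrow> w = \<omega> k)" for j w
  define Q where "Q j w w' \<longleftrightarrow> (w, w') \<in> tedges T \<and> ccol C (w, w') = ccol C (\<eta> (n + j), \<eta> (Suc (n + j)))" for j w w'
  have inner: "\<eta> (n + j) \<in> inner_verts" for j
    using ends_inner[OF \<eta>] nk by simp
  have "\<exists>\<tau>. \<forall>j. P j (\<tau> j) \<and> Q j (\<tau> j) (\<tau> (Suc j))"
  proof (rule dependent_nat_choice)
    show "\<exists>w. P 0 w"
      using ends_inner[OF \<omega> nk(2)] lab by (simp add: P_def)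
    fix w j assume w: "P j w"
    have "ccol C (\<eta> (n + j), \<eta> (Suc (n + j))) \<in> all_cols C (lab C w)"
      using ccol_in_all_cols[OF inner ends_edge[OF \<eta>]] w by (simp add: P_def)
    moreover have "w \<in> inner_verts"
      using w by (simp add: P_def)
    ultimately obtain w' where w': "(w, w') \<in> tedges T"
        "ccol C (w, w') = ccol C (\<eta> (n + j), \<eta> (Suc (n + j)))"
      using ex_child_coloured by blast
    have "lab C w' = lab C (\<eta> (Suc (n + j)))"
      using ccol_eq_labels[OF _ w'(1) inner ends_edge[OF \<eta>] w'(2)] w by (simp add: P_def)
    then have "P (Suc j) w'"
      using child_inner[OF w'(1)] by (simp add: P_def)
    then show "\<exists>w'. P (Suc j) w' \<and> Q j w w'"
      using w' by (auto simp: Q_def)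
  qed
  then obtain \<tau> where \<tau>: "\<forall>j. P j (\<tau> j) \<and> Q j (\<tau> j) (\<tau> (Suc j))"
    by blast
  have "\<exists>\<zeta> \<in> ends. (\<forall>i \<le> k. \<zeta> i = \<omega> i) \<and> (\<forall>j. \<zeta> (k + j) = \<tau> j)"
    by (rule splice[OF \<omega>]) (use \<tau> in \<open>auto simp: P_def Q_def\<close>)
  then obtain \<zeta> where \<zeta>: "\<zeta> \<in> ends" "\<forall>i \<le> k. \<zeta> i = \<omega> i" "\<forall>j. \<zeta> (k + j) = \<tau> j"
    by blast
  have "same_colours n k \<eta> \<zeta>"
    unfolding same_colours_def
  proof
    fix j
    have "\<zeta> (k + j) = \<tau> j" "\<zeta> (Suc (k + j)) = \<tau> (Suc j)"
      using \<zeta>(3) add_Suc_right by metis+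
    then show "ccol C (\<zeta> (k + j), \<zeta> (Suc (k + j))) = ccol C (\<eta> (n + j), \<eta> (Suc (n + j)))"
      using \<tau> by (simp add: Q_def)
  qed
  then show ?thesis
    using \<zeta>(1,2) by (intro bexI[of _ \<zeta>]) auto
qed

text \<open>
  Below vertices with equal labels, reading colours gives a canonical isomorphism of the two trees.
\<close>

lemma ex_cylinder_map:
  assumes \<xi>: "\<xi> \<in> ends" and \<omega>: "\<omega> \<in> ends" and nk: "1 \<le> n" "1 \<le> k" and lab: "lab C (\<omega> k) = lab C (\<xi> n)"
  shows "\<exists>h. bij_betw h (cyl n (\<xi> n)) (cyl k (\<omega> k)) \<and> (\<forall>\<eta> \<in> cyl n (\<xi> n). same_colours n k \<eta> (h \<eta>))"
proof -
  have "\<forall>\<eta> \<in> cyl n (\<xi> n). \<exists>\<zeta>. \<zeta> \<in> cyl k (\<omega> k) \<and> same_colours n k \<eta> \<zeta>"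
  proof
    fix \<eta> assume "\<eta> \<in> cyl n (\<xi> n)"
    then show "\<exists>\<zeta>. \<zeta> \<in> cyl k (\<omega> k) \<and> same_colours n k \<eta> \<zeta>"
      using ex_same_colours[of \<eta> \<omega> n k] \<omega> nk lab by auto
  qed
  then obtain h where h: "\<forall>\<eta> \<in> cyl n (\<xi> n). h \<eta> \<in> cyl k (\<omega> k) \<and> same_colours n k \<eta> (h \<eta>)"
    by (rule bchoice[THEN exE])
  have "inj_on h (cyl n (\<xi> n))"
  proof (rule inj_onI)
    fix \<eta> \<eta>' assume \<eta>: "\<eta> \<in> cyl n (\<xi> n)" "\<eta>' \<in> cyl n (\<xi> n)" "h \<eta> = h \<eta>'"
    have h\<eta>: "h \<eta> \<in> ends" "same_colours n k \<eta> (h \<eta>)" "same_colours n k \<eta>' (h \<eta>)"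
      using bspec[OF h \<eta>(1)] bspec[OF h \<eta>(2)] \<eta>(3) by simp_all
    have "\<eta> (n + j) = \<eta>' (n + j)" for j
      using same_colours_agree[OF _ _ h\<eta>(1) h\<eta>(1) nk _ refl h\<eta>(2,3), of j] \<eta>(1,2) by simp
    then show "\<eta> = \<eta>'"
      using ends_eqI \<eta> by auto
  qed
  moreover have "h ` cyl n (\<xi> n) = cyl k (\<omega> k)"
  proof
    show "h ` cyl n (\<xi> n) \<subseteq> cyl k (\<omega> k)"
      using h by blast
    show "cyl k (\<omega> k) \<subseteq> h ` cyl n (\<xi> n)"
    proof
      fix \<zeta> assume \<zeta>: "\<zeta> \<in> cyl k (\<omega> k)"
      then obtain \<eta> where \<eta>: "\<eta> \<in> cyl n (\<xi> n)" "same_colours n k \<eta> \<zeta>"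
        using ex_same_colours[of \<zeta> \<xi> k n] \<xi> nk lab same_colours_sym by fastforce
      have h\<eta>: "h \<eta> \<in> ends" "h \<eta> k = \<omega> k" "same_colours n k \<eta> (h \<eta>)"
        using bspec[OF h \<eta>(1)] by simp_all
      have "h \<eta> (k + j) = \<zeta> (k + j)" for j
        using same_colours_agree[of \<eta> \<eta> "h \<eta>" \<zeta> n k j] h\<eta> \<eta> \<zeta> nk by simp
      then have "h \<eta> = \<zeta>"
        using ends_eqI[of "h \<eta>" \<zeta> k] h\<eta>(1) \<zeta> by simp
      then show "\<zeta> \<in> h ` cyl n (\<xi> n)"
        using \<eta>(1) by blast
    qed
  qed
  ultimately show ?thesis
    using h by (auto simp: bij_betw_def)
qed

lemma pattern_like_if_same_colours:
  assumes F: "patterning T C F" and \<xi>: "\<xi> \<in> ends" and nm: "1 \<le> n" "1 \<le> m"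
    and img: "g ` cyl n (\<xi> n) = cyl m (g \<xi> m)"
    and col: "\<And>\<eta>. \<eta> \<in> cyl n (\<xi> n) \<Longrightarrow> same_colours n m \<eta> (g \<eta>)"
  shows "pattern_like F g n m \<xi>"
proof -
  have g: "g \<eta> \<in> ends" "g \<eta> m = g \<xi> m" if "\<eta> \<in> cyl n (\<xi> n)" for \<eta>
    using that img by auto
  have "\<eta> (n + j) = \<eta>' (n + j) \<longleftrightarrow> g \<eta> (m + j) = g \<eta>' (m + j)"
    if "\<eta> \<in> cyl n (\<xi> n)" "\<eta>' \<in> cyl n (\<xi> n)" for \<eta> \<eta>' j
    using that by (intro same_colours_agree g col nm) (auto simp: g)
  moreover have "locally_patterned F g (n + j) (m + j) \<eta>" if \<eta>: "\<eta> \<in> cyl n (\<xi> n)" for \<eta> j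
    unfolding locally_patterned_def
  proof (intro conjI bexI ballI)
    have \<eta>': "\<eta> \<in> ends" "\<eta> n = \<xi> n"
      using \<eta> by auto
    show "lab C (g \<eta> (m + j)) = lab C (\<eta> (n + j))"
      by (rule same_colours_labels[OF \<eta>'(1) g(1)[OF \<eta>] nm col[OF \<eta>]])
    have x: "\<eta> (n + j) \<in> inner_verts"
      using ends_inner[OF \<eta>'(1)] nm by simp
    show "(\<lambda>d \<in> all_cols C (lab C (\<eta> (n + j))). d) \<in> F (lab C (\<eta> (n + j)))"
      by (rule pattern_id[OF F lab_in_labels[OF x]])
    fix \<zeta> assume \<zeta>: "\<zeta> \<in> cyl (n + j) (\<eta> (n + j))"
    then have "\<zeta> \<in> cyl n (\<xi> n)"
      using \<eta>' ends_agree[OF _ \<eta>'(1), of \<zeta> "n + j" n] by simp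
    then have "ccol C (g \<zeta> (m + j), g \<zeta> (Suc (m + j))) = ccol C (\<zeta> (n + j), \<zeta> (Suc (n + j)))"
      using col by (simp add: same_colours_def)
    moreover have "ccol C (\<zeta> (n + j), \<zeta> (Suc (n + j))) \<in> all_cols C (lab C (\<eta> (n + j)))"
      using ccol_in_all_cols[OF x, of "\<zeta> (Suc (n + j))"] \<zeta> ends_edge[of \<zeta> "n + j"] by simp
    ultimately show "ccol C (g \<zeta> (m + j), g \<zeta> (Suc (m + j))) =
        (\<lambda>d \<in> all_cols C (lab C (\<eta> (n + j))). d) (ccol C (\<zeta> (n + j), \<zeta> (Suc (n + j))))"
      by simp
  qed
  ultimately show ?thesis
    using img nm by (simp add: pattern_like_def tree_like_def)
qed

section \<open>Clopen sets of ends\<close>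

definition depends_on_level :: "nat \<Rightarrow> (nat \<Rightarrow> 'v) set \<Rightarrow> bool" where
  "depends_on_level n U \<longleftrightarrow> (\<forall>\<xi> \<in> ends. \<forall>\<eta> \<in> ends. \<xi> n = \<eta> n \<longrightarrow> (\<xi> \<in> U \<longleftrightarrow> \<eta> \<in> U))"

definition clopens :: "(nat \<Rightarrow> 'v) set set" where
  "clopens = {U. U \<subseteq> ends \<and> (\<exists>n. depends_on_level n U)}"

lemma depends_on_level_iff:
  "\<lbrakk>depends_on_level n U; \<xi> \<in> ends; \<eta> \<in> ends; \<xi> n = \<eta> n\<rbrakk> \<Longrightarrow> \<xi> \<in> U \<longleftrightarrow> \<eta> \<in> U"
  unfolding depends_on_level_def by blast

lemma depends_on_levelI:
  "(\<And>\<xi> \<eta>. \<lbrakk>\<xi> \<in> ends; \<eta> \<in> ends; \<xi> n = \<eta> n; \<xi> \<in> U\<rbrakk> \<Longrightarrow> \<eta> \<in> U) \<Longrightarrow> depends_on_level n U"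
  unfolding depends_on_level_def by (intro ballI impI iffI) metis+

lemma depends_on_levelD:
  "\<lbrakk>depends_on_level n U; \<xi> \<in> U; \<xi> \<in> ends; \<eta> \<in> ends; \<xi> n = \<eta> n\<rbrakk> \<Longrightarrow> \<eta> \<in> U"
  using depends_on_level_iff by blast

lemma depends_on_level_mono:
  assumes "depends_on_level n U" "n \<le> k"
  shows "depends_on_level k U"
proof (rule depends_on_levelI)
  fix \<xi> \<eta> assume \<xi>: "\<xi> \<in> ends" "\<eta> \<in> ends" "\<xi> k = \<eta> k" "\<xi> \<in> U"
  then have "\<xi> n = \<eta> n"
    using ends_agree assms(2) by blast
  then show "\<eta> \<in> U"
    by (rule depends_on_levelD[OF assms(1) \<xi>(4,1,2)])
qed

lemma clopen_subset: "U \<in> clopens \<Longrightarrow> U \<subseteq> ends"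
  unfolding clopens_def by blast

lemma clopenI: "\<lbrakk>U \<subseteq> ends; depends_on_level n U\<rbrakk> \<Longrightarrow> U \<in> clopens"
  unfolding clopens_def by blast

lemma clopen_levels:
  assumes "U \<in> clopens"
  shows "\<exists>n. \<forall>k \<ge> n. depends_on_level k U"
proof -
  obtain n where "depends_on_level n U"
    using assms unfolding clopens_def by blast
  then show ?thesis
    using depends_on_level_mono by blast
qed

lemma clopens_Diff:
  assumes "U \<in> clopens" "W \<in> clopens"
  shows "U - W \<in> clopens"
proof -
  obtain n where n: "\<forall>k \<ge> n. depends_on_level k U"
    using clopen_levels[OF assms(1)] by blast
  obtain m where m: "\<forall>k \<ge> m. depends_on_level k W"
    using clopen_levels[OF assms(2)] by blast
  have U: "depends_on_level (max n m) U" and W: "depends_on_level (max n m) W"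
    using n m by simp_all
  have "depends_on_level (max n m) (U - W)"
  proof (rule depends_on_levelI)
    fix \<xi> \<eta> assume "\<xi> \<in> ends" "\<eta> \<in> ends" "\<xi> (max n m) = \<eta> (max n m)" "\<xi> \<in> U - W"
    then show "\<eta> \<in> U - W"
      using depends_on_level_iff[OF U, of \<xi> \<eta>] depends_on_level_iff[OF W, of \<xi> \<eta>] by blast
  qed
  then show ?thesis
    using clopen_subset[OF assms(1)] by (intro clopenI) auto
qed

lemma cyl_clopen: "cyl n x \<in> clopens"
proof -
  have "depends_on_level n (cyl n x)"
    by (rule depends_on_levelI) simp
  then show ?thesis
    by (rule clopenI[rotated]) auto
qed

lemma ends_clopen: "ends \<in> clopens"
  by (rule clopenI[of _ 0]) (auto intro: depends_on_levelI)

lemma cyl_subset_clopen: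
  assumes "W \<in> clopens" "\<omega> \<in> W"
  shows "\<exists>k \<ge> n. cyl k (\<omega> k) \<subseteq> W"
proof -
  obtain m where m: "\<forall>k \<ge> m. depends_on_level k W"
    using clopen_levels[OF assms(1)] by blast
  have "\<omega> \<in> ends"
    using assms clopen_subset by blast
  moreover have "depends_on_level (max n m) W"
    using m by simp
  ultimately have "cyl (max n m) (\<omega> (max n m)) \<subseteq> W"
    using assms(2) depends_on_levelD[of "max n m" W \<omega>] by auto
  then show ?thesis
    using max.cobounded1 by blast
qed

lemma cyl_antimono:
  assumes "\<eta> \<in> ends" "i \<le> n"
  shows "cyl n (\<eta> n) \<subseteq> cyl i (\<eta> i)"
proof
  fix \<zeta> assume "\<zeta> \<in> cyl n (\<eta> n)"
  then have \<zeta>: "\<zeta> \<in> ends" "\<zeta> n = \<eta> n"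
    by auto
  show "\<zeta> \<in> cyl i (\<eta> i)"
    using ends_agree[OF \<zeta>(1) assms(1) \<zeta>(2) assms(2)] \<zeta>(1) by simp
qed

lemma clopen_split:
  assumes "U \<in> clopens" "U \<noteq> {}"
  shows "\<exists>W \<in> clopens. W \<noteq> {} \<and> W \<subset> U"
proof -
  obtain \<omega> where \<omega>: "\<omega> \<in> U"
    using assms(2) by blast
  then have \<omega>e: "\<omega> \<in> ends"
    using assms(1) clopen_subset by blast
  obtain k where k: "cyl k (\<omega> k) \<subseteq> U"
    using cyl_subset_clopen[OF assms(1) \<omega>] by blast
  obtain \<eta> \<eta>' j where \<eta>: "\<eta> \<in> ends" "\<eta>' \<in> ends" "\<eta> k = \<omega> k" "\<eta>' k = \<omega> k"
      "\<eta> (k + j) = \<eta>' (k + j)" "\<eta> (Suc (k + j)) \<noteq> \<eta>' (Suc (k + j))"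
    using ex_branching[OF \<omega>e] by blast
  let ?W = "cyl (Suc (k + j)) (\<eta> (Suc (k + j)))"
  have "?W \<subseteq> cyl k (\<omega> k)"
    using cyl_antimono[OF \<eta>(1), of k "Suc (k + j)"] \<eta>(3) by simp
  then have "?W \<subseteq> U"
    using k by blast
  moreover have "\<eta>' \<in> cyl k (\<omega> k)" "\<eta>' \<notin> ?W" "\<eta> \<in> ?W"
    using \<eta> by simp_all
  ultimately have "?W \<noteq> {} \<and> ?W \<subset> U"
    using k by blast
  then show ?thesis
    using cyl_clopen by blast
qed

lemma patterned_image_clopen:
  assumes g: "g \<in> patterned_perms F" and U: "U \<in> clopens"
  shows "g ` U \<in> clopens"
proof -
  have perm: "g permutes ends"
    using g by (simp add: patterned_perms_def)
  obtain n where n: "\<forall>k \<ge> n. \<exists>M. \<forall>\<xi> \<in> ends. \<exists>m. pattern_like F g k m \<xi> \<and> k \<le> m + n \<and> m \<le> M"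
    using patterned_perms_levels[OF g] by blast
  obtain n' where n': "\<forall>k \<ge> n'. depends_on_level k U"
    using clopen_levels[OF U] by blast
  define k where "k = max n n'"
  obtain M where M: "\<forall>\<xi> \<in> ends. \<exists>m. pattern_like F g k m \<xi> \<and> m \<le> M"
    using n unfolding k_def by (meson max.cobounded1)
  have "\<zeta>' \<in> g ` U" if \<zeta>: "\<zeta> \<in> g ` U" "\<zeta>' \<in> ends" "\<zeta> M = \<zeta>' M" for \<zeta> \<zeta>'
  proof -
    obtain \<xi> where \<xi>: "\<xi> \<in> U" "\<zeta> = g \<xi>"
      using \<zeta>(1) by blast
    have \<xi>e: "\<xi> \<in> ends"
      using \<xi>(1) clopen_subset[OF U] by blast
    then have \<zeta>e: "\<zeta> \<in> ends"
      using permutes_in_image[OF perm] \<xi>(2) by simp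
    obtain m where m: "pattern_like F g k m \<xi>" "m \<le> M"
      using M \<xi>e by blast
    have "\<zeta>' \<in> cyl m (g \<xi> m)"
      using ends_agree[OF \<zeta>e \<zeta>(2,3) m(2)] \<zeta>(2) \<xi>(2) by simp
    then obtain \<eta> where "\<eta> \<in> cyl k (\<xi> k)" "\<zeta>' = g \<eta>"
      using tree_like_image[OF pattern_like_tree_like[OF m(1)]] by blast
    moreover have "depends_on_level k U"
      using n' by (simp add: k_def)
    ultimately show ?thesis
      using depends_on_levelD[of k U \<xi> \<eta>] \<xi>(1) \<xi>e by auto
  qed
  then have "depends_on_level M (g ` U)"
    by (intro depends_on_levelI) blast
  moreover have "g ` U \<subseteq> ends"
    using permutes_in_image[OF perm] clopen_subset[OF U] by auto
  ultimately show ?thesis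
    by (rule clopenI[rotated])
qed

section \<open>Swaps and compressions\<close>

text \<open>
  The involution acts as \<open>f\<close> on \<open>U\<close>, as the inverse of \<open>f\<close> on the image, and trivially elsewhere. It is
  patterned below a depth that exceeds all depths involved in the three pieces.
\<close>

lemma ex_swap:
  assumes F: "patterning T C F" and U: "U \<subseteq> ends" "depends_on_level n U"
    and f: "inj_on f U" "f ` U \<inter> U = {}" and pat: "\<And>\<xi>. \<xi> \<in> U \<Longrightarrow> \<exists>m. pattern_like F f n m \<xi>"
  shows "\<exists>s \<in> patterned_perms F. (\<forall>x \<in> U. s x = f x) \<and> (\<forall>x. x \<notin> U \<union> f ` U \<longrightarrow> s x = x)"
proof -
  have cylU: "cyl n (\<xi> n) \<subseteq> U" if "\<xi> \<in> U" for \<xi>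
    using that U depends_on_levelD[OF U(2) that] by auto
  have "\<exists>M. \<forall>\<xi> \<in> ends. \<exists>m \<le> M. \<xi> \<in> U \<longrightarrow> pattern_like F f n m \<xi>"
  proof (rule finite_level_choice[where n = n])
    show "\<exists>m. \<xi> \<in> U \<longrightarrow> pattern_like F f n m \<xi>" if "\<xi> \<in> ends" for \<xi>
      using pat by blast
    show "\<eta> \<in> U \<longrightarrow> pattern_like F f n m \<eta>"
      if "\<xi> \<in> U \<longrightarrow> pattern_like F f n m \<xi>" "\<xi> \<in> ends" "\<eta> \<in> ends" "\<eta> n = \<xi> n" for \<xi> \<eta> m
      using that depends_on_levelD[OF U(2), of \<eta> \<xi>] pattern_like_cong_end[of F f n m \<xi> \<eta>] by blast
  qed
  then obtain M where M: "\<forall>\<xi> \<in> ends. \<exists>m \<le> M. \<xi> \<in> U \<longrightarrow> pattern_like F f n m \<xi>"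
    by blast
  define s where "s x = (if x \<in> U then f x else if x \<in> f ` U then inv_into U f x else x)" for x
  have s_U: "s x = f x" if "x \<in> U" for x
    using that by (simp add: s_def)
  have s_fU: "s (f x) = x" if "x \<in> U" for x
    using that f by (auto simp: s_def inv_into_f_f)
  have s_id: "s x = x" if "x \<notin> U \<union> f ` U" for x
    using that by (simp add: s_def)
  have invol: "s (s x) = x" for x
    using s_U s_fU s_id by (cases "x \<in> U"; cases "x \<in> f ` U") auto
  have fU: "f ` U \<subseteq> ends"
  proof
    fix y assume "y \<in> f ` U"
    then obtain \<xi> where \<xi>: "\<xi> \<in> U" "y = f \<xi>"
      by blast
    then obtain m where "pattern_like F f n m \<xi>"
      using pat by blast
    then have "f ` cyl n (\<xi> n) = cyl m (f \<xi> m)"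
      by (intro tree_like_image pattern_like_tree_like)
    moreover have "\<xi> \<in> cyl n (\<xi> n)"
      using \<xi>(1) U(1) by auto
    ultimately have "f \<xi> \<in> cyl m (f \<xi> m)"
      by blast
    then show "y \<in> ends"
      using \<xi>(2) by simp
  qed
  have perm: "s permutes ends"
  proof (rule bij_imp_permutes)
    have in_ends: "s x \<in> ends" if "x \<in> ends" for x
    proof (cases "x \<in> U")
      case True
      then show ?thesis
        using fU s_U by auto
    next
      case False
      then show ?thesis
        using that s_fU s_id U(1) by (cases "x \<in> f ` U") auto
    qed
    show "bij_betw s ends ends"
      by (rule bij_betw_byWitness[where f' = s]) (use in_ends invol in auto)
    show "s x = x" if "x \<notin> ends" for x
      using that U(1) fU by (intro s_id) auto
  qed
  have inv_s: "perm_inv s = s"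
    using invol by (intro inv_unique_comp) (auto simp: fun_eq_iff)
  have patU: "\<exists>m \<le> M. pattern_like F s n m \<xi>" if \<xi>: "\<xi> \<in> U" for \<xi>
  proof -
    obtain m where m: "m \<le> M" "pattern_like F f n m \<xi>"
      using M \<xi> U(1) by blast
    have "pattern_like F s n m \<xi>"
    proof (rule pattern_like_cong_map[OF m(2)])
      show "\<xi> \<in> ends"
        using \<xi> U(1) by blast
      show "f \<eta> = s \<eta>" if "\<eta> \<in> cyl n (\<xi> n)" for \<eta>
        using cylU[OF \<xi>] s_U that by auto
    qed
    then show ?thesis
      using m(1) by blast
  qed
  \<comment> \<open>On the image of \<open>U\<close> the roles of \<open>n\<close> and of the depths bounded by \<open>M\<close> are exchanged, so \<open>L\<close> exceeds both.\<close>
  define L where "L = Suc (max n M)"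
  have "\<exists>m. pattern_like F s L m \<zeta>" if \<zeta>: "\<zeta> \<in> ends" for \<zeta>
  proof -
    consider "\<zeta> \<in> U" | "\<zeta> \<in> f ` U" | "\<zeta> \<notin> U \<union> f ` U"
      by blast
    then show ?thesis
    proof cases
      case 1
      then obtain m where "pattern_like F s n m \<zeta>"
        using patU by blast
      then show ?thesis
        using pattern_like_shift[OF perm \<zeta>, of F n m "L - n"] by (auto simp: L_def)
    next
      case 2
      then obtain \<xi> where \<xi>: "\<xi> \<in> U" "\<zeta> = f \<xi>"
        by blast
      then obtain m where m: "m \<le> M" "pattern_like F s n m \<xi>"
        using patU by blast
      have "pattern_like F s m n \<zeta>"
        using pattern_like_inv[OF F _ perm m(2)] \<xi> U(1) s_U inv_s by auto
      then show ?thesis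
        using pattern_like_shift[OF perm \<zeta>, of F m n "L - m"] m(1) by (auto simp: L_def)
    next
      case 3
      have "id \<eta> = s \<eta>" if \<eta>: "\<eta> \<in> cyl L (\<zeta> L)" for \<eta>
      proof -
        have \<eta>': "\<eta> \<in> ends" "\<eta> L = \<zeta> L"
          using \<eta> by auto
        have "\<eta> \<notin> U"
          using depends_on_levelD[OF U(2) _ \<eta>'(1) \<zeta>] ends_agree[OF \<eta>'(1) \<zeta> \<eta>'(2), of n] 3
          by (auto simp: L_def)
        moreover have "\<eta> \<notin> f ` U"
        proof
          assume "\<eta> \<in> f ` U"
          then obtain \<xi> where \<xi>: "\<xi> \<in> U" "\<eta> = f \<xi>"
            by blast
          then obtain m where m: "m \<le> M" "pattern_like F s n m \<xi>"
            using patU by blast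
          have "\<zeta> m = s \<xi> m"
            using ends_agree[OF \<eta>'(1) \<zeta> \<eta>'(2), of m] m(1) \<xi> s_U by (simp add: L_def)
          then have "\<zeta> \<in> s ` cyl n (\<xi> n)"
            using tree_like_image[OF pattern_like_tree_like[OF m(2)]] \<zeta> by simp
          then have "\<zeta> \<in> f ` U"
            using cylU[OF \<xi>(1)] s_U by auto
          then show False
            using 3 by blast
        qed
        ultimately show ?thesis
          using s_id by simp
      qed
      then have "pattern_like F s L L \<zeta>"
        using pattern_like_cong_map[OF pattern_like_id[OF F \<zeta>] \<zeta>, of L s] by (simp add: L_def)
      then show ?thesis
        by blast
    qed
  qed
  then have "s \<in> patterned_perms F"
    using perm by (auto simp: patterned_perms_def)
  then show ?thesis
    using s_U s_id by blast
qed

lemma ex_swap_patterned: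
  assumes F: "patterning T C F" and a: "a \<in> patterned_perms F" and U: "U \<in> clopens" and aU: "a ` U \<inter> U = {}"
  shows "\<exists>s \<in> patterned_perms F. (\<forall>x \<in> U. s x = a x) \<and> (\<forall>x. x \<notin> U \<union> a ` U \<longrightarrow> s x = x)"
proof -
  have perm: "a permutes ends"
    using a by (simp add: patterned_perms_def)
  obtain n where n: "\<forall>k \<ge> n. \<exists>M. \<forall>\<xi> \<in> ends. \<exists>m. pattern_like F a k m \<xi> \<and> k \<le> m + n \<and> m \<le> M"
    using patterned_perms_levels[OF a] by blast
  obtain n' where n': "\<forall>k \<ge> n'. depends_on_level k U"
    using clopen_levels[OF U] by blast
  have Ue: "U \<subseteq> ends"
    by (rule clopen_subset[OF U])
  show ?thesis
  proof (rule ex_swap[OF F Ue])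
    show "depends_on_level (max n n') U"
      using n' by simp
    show "inj_on a U"
      using permutes_inj[OF perm] by (rule inj_on_subset) simp
    show "\<exists>m. pattern_like F a (max n n') m \<xi>" if "\<xi> \<in> U" for \<xi>
      using n that Ue by (meson max.cobounded1 subsetD)
  qed (rule aU)
qed

text \<open>
  The label of \<open>\<xi> n\<close> recurs below every vertex, in particular in \<open>W\<close>; the required element
  exchanges the two cylinders along the canonical map.
\<close>

lemma ex_compression_cyl:
  assumes F: "patterning T C F" and \<xi>: "\<xi> \<in> ends" and n: "1 \<le> n"
    and W: "W \<in> clopens" "W \<noteq> {}" "cyl n (\<xi> n) \<inter> W = {}"
  shows "\<exists>s \<in> patterned_perms F. s ` cyl n (\<xi> n) \<subseteq> W \<and> (\<forall>x. x \<notin> cyl n (\<xi> n) \<union> W \<longrightarrow> s x = x)"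
proof -
  obtain \<omega> where \<omega>: "\<omega> \<in> W"
    using W(2) by blast
  then have \<omega>e: "\<omega> \<in> ends"
    using clopen_subset[OF W(1)] by blast
  obtain k where k: "1 \<le> k" "cyl k (\<omega> k) \<subseteq> W"
    using cyl_subset_clopen[OF W(1) \<omega>] by blast
  have "lab C (\<xi> n) \<in> labels C"
    using ends_inner[OF \<xi> n] lab_in_labels by blast
  then obtain \<theta> j where \<theta>: "\<theta> \<in> ends" "\<theta> k = \<omega> k" "lab C (\<theta> (k + j)) = lab C (\<xi> n)"
    using ex_label_below[OF \<omega>e k(1)] by blast
  have "cyl (k + j) (\<theta> (k + j)) \<subseteq> cyl k (\<omega> k)"
    using cyl_antimono[OF \<theta>(1), of k "k + j"] \<theta>(2) by simp
  then have cylW: "cyl (k + j) (\<theta> (k + j)) \<subseteq> W"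
    using k(2) by blast
  have kj: "1 \<le> k + j"
    using k(1) by simp
  obtain h where h: "bij_betw h (cyl n (\<xi> n)) (cyl (k + j) (\<theta> (k + j)))"
      "\<forall>\<eta> \<in> cyl n (\<xi> n). same_colours n (k + j) \<eta> (h \<eta>)"
    using ex_cylinder_map[OF \<xi> \<theta>(1) n kj \<theta>(3)] by blast
  have img: "h ` cyl n (\<xi> n) = cyl (k + j) (\<theta> (k + j))"
    using h(1) by (simp add: bij_betw_def)
  have "\<exists>s \<in> patterned_perms F. (\<forall>x \<in> cyl n (\<xi> n). s x = h x) \<and>
      (\<forall>x. x \<notin> cyl n (\<xi> n) \<union> h ` cyl n (\<xi> n) \<longrightarrow> s x = x)"
  proof (rule ex_swap[OF F])
    show "cyl n (\<xi> n) \<subseteq> ends"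
      by auto
    show "depends_on_level n (cyl n (\<xi> n))"
      by (rule depends_on_levelI) simp
    show "inj_on h (cyl n (\<xi> n))"
      using h(1) by (simp add: bij_betw_def)
    show "h ` cyl n (\<xi> n) \<inter> cyl n (\<xi> n) = {}"
      using img cylW W(3) by blast
    fix \<eta> assume \<eta>: "\<eta> \<in> cyl n (\<xi> n)"
    then have "h \<eta> \<in> cyl (k + j) (\<theta> (k + j))"
      using img by blast
    then have "pattern_like F h n (k + j) \<eta>"
      using \<eta> img h(2) by (intro pattern_like_if_same_colours[OF F _ n kj]) auto
    then show "\<exists>m. pattern_like F h n m \<eta>"
      by blast
  qed
  then obtain s where s: "s \<in> patterned_perms F" "\<forall>x \<in> cyl n (\<xi> n). s x = h x"
      "\<forall>x. x \<notin> cyl n (\<xi> n) \<union> h ` cyl n (\<xi> n) \<longrightarrow> s x = x"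
    by blast
  have "s ` cyl n (\<xi> n) = h ` cyl n (\<xi> n)"
    using s(2) by (intro image_cong) auto
  then have "s ` cyl n (\<xi> n) \<subseteq> W"
    using img cylW by simp
  moreover have "s x = x" if "x \<notin> cyl n (\<xi> n) \<union> W" for x
    using that s(3) img cylW by blast
  ultimately show ?thesis
    using s(1) by blast
qed

lemma clopen_split2:
  assumes "W \<in> clopens" "W \<noteq> {}"
  shows "\<exists>W1 \<in> clopens. \<exists>W2 \<in> clopens. W1 \<noteq> {} \<and> W2 \<noteq> {} \<and> W1 \<inter> W2 = {} \<and> W1 \<union> W2 = W"
proof -
  obtain W1 where W1: "W1 \<in> clopens" "W1 \<noteq> {}" "W1 \<subset> W"
    using clopen_split[OF assms] by blast
  then show ?thesis
    using clopens_Diff[OF assms(1) W1(1)] by (intro bexI[of _ W1] bexI[of _ "W - W1"]) auto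
qed

text \<open>
  Half of \<open>W\<close> receives the new cylinder and the other half receives the remaining ones. Control of the
  support keeps the two moves from interfering.
\<close>

lemma ex_compression_union:
  assumes F: "patterning T C F" and n: "1 \<le> n" and A: "finite A" "A \<subseteq> sphere n"
  shows "\<lbrakk>W \<in> clopens; W \<noteq> {}; (\<Union>x \<in> A. cyl n x) \<inter> W = {}\<rbrakk> \<Longrightarrow>
    \<exists>c \<in> patterned_perms F. c ` (\<Union>x \<in> A. cyl n x) \<subseteq> W \<and> (\<forall>x. x \<notin> (\<Union>x \<in> A. cyl n x) \<union> W \<longrightarrow> c x = x)"
  using A
proof (induction A arbitrary: W)
  case empty
  then show ?case
    using id_patterned[OF F] by (intro bexI[of _ id]) auto
next
  case (insert a A)
  let ?U = "\<Union>x \<in> A. cyl n x"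
  obtain \<xi> where \<xi>: "\<xi> \<in> ends" "a = \<xi> n"
    using insert.prems by (auto simp: sphere_def)
  have disj: "cyl n a \<inter> ?U = {}"
    using insert.hyps by auto
  obtain W1 W2 where W: "W1 \<in> clopens" "W2 \<in> clopens" "W1 \<noteq> {}" "W2 \<noteq> {}" "W1 \<inter> W2 = {}" "W1 \<union> W2 = W"
    using clopen_split2[OF insert.prems(1,2)] by blast
  have UW1: "?U \<inter> W1 = {}" and aW1: "cyl n a \<inter> W1 = {}" and aW2: "cyl n (\<xi> n) \<inter> W2 = {}"
    using insert.prems(3) W(6) \<xi>(2) by auto
  obtain c where c: "c \<in> patterned_perms F" "c ` ?U \<subseteq> W1" "\<forall>x. x \<notin> ?U \<union> W1 \<longrightarrow> c x = x"
    using insert.IH[OF W(1,3) UW1] insert.prems(4) by auto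
  obtain s where s: "s \<in> patterned_perms F" "s ` cyl n a \<subseteq> W2" "\<forall>x. x \<notin> cyl n a \<union> W2 \<longrightarrow> s x = x"
    using ex_compression_cyl[OF F \<xi>(1) n W(2,4) aW2] \<xi>(2) by blast
  have "(s \<circ> c) x \<in> W" if "x \<in> cyl n a \<union> ?U" for x
  proof (cases "x \<in> ?U")
    case True
    then have "c x \<in> W1"
      using c(2) by blast
    moreover from this have "c x \<notin> cyl n a \<union> W2"
      using aW1 W(5) by blast
    then have "s (c x) = c x"
      using s(3) by blast
    ultimately show ?thesis
      using W(6) by auto
  next
    case False
    then have x: "x \<in> cyl n a"
      using that by blast
    then have "c x = x"
      using c(3) False aW1 by blast
    moreover have "s x \<in> W2"
      using s(2) x by blast
    ultimately show ?thesis
      using W(6) by auto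
  qed
  then have "(s \<circ> c) ` (\<Union>x \<in> insert a A. cyl n x) \<subseteq> W"
    by auto
  moreover have "(s \<circ> c) x = x" if "x \<notin> (\<Union>x \<in> insert a A. cyl n x) \<union> W" for x
  proof -
    have "c x = x"
      using c(3) that W(6) by auto
    then show ?thesis
      using s(3) that W(6) by auto
  qed
  ultimately show ?case
    using comp_patterned[OF F s(1) c(1)] by blast
qed

lemma ex_compression:
  assumes F: "patterning T C F" and U: "U \<in> clopens" and W: "W \<in> clopens" "W \<noteq> {}" "U \<inter> W = {}"
  shows "\<exists>c \<in> patterned_perms F. c ` U \<subseteq> W"
proof -
  obtain n where n: "\<forall>k \<ge> n. depends_on_level k U"
    using clopen_levels[OF U] by blast
  define k where "k = Suc n"
  have Ue: "U \<subseteq> ends"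
    by (rule clopen_subset[OF U])
  define A where "A = (\<lambda>\<xi>. \<xi> k) ` U"
  have A: "A \<subseteq> sphere k"
    using Ue by (auto simp: A_def sphere_def)
  have "depends_on_level k U"
    using n by (simp add: k_def)
  then have UA: "(\<Union>x \<in> A. cyl k x) = U"
    using Ue depends_on_levelD[of k U] by (auto simp: A_def)
  have "\<exists>c \<in> patterned_perms F. c ` (\<Union>x \<in> A. cyl k x) \<subseteq> W \<and> (\<forall>x. x \<notin> (\<Union>x \<in> A. cyl k x) \<union> W \<longrightarrow> c x = x)"
    by (rule ex_compression_union[OF F _ finite_subset[OF A finite_sphere] A]) (use W UA in \<open>auto simp: k_def\<close>)
  then show ?thesis
    using UA by auto
qed

section \<open>Displacement, density and conjugation\<close>

text \<open>
  An end and its image separate at some depth, and the image of a small enough cylinder around the end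
  is a cylinder that does not reach above this depth.
\<close>

lemma ex_displaced_clopen:
  assumes g: "g \<in> tree_like_perms" and ne: "g \<noteq> id"
  shows "\<exists>U \<in> clopens. U \<noteq> {} \<and> g ` U \<inter> U = {}"
proof -
  have perm: "g permutes ends"
    using g by (simp add: tree_like_perms_def)
  obtain \<xi> where \<xi>: "g \<xi> \<noteq> \<xi>"
    using ne by (auto simp: fun_eq_iff)
  then have \<xi>e: "\<xi> \<in> ends"
    using permutes_not_in[OF perm] by blast
  then have g\<xi>: "g \<xi> \<in> ends"
    using permutes_in_image[OF perm] by simp
  obtain n0 where n0: "g \<xi> n0 \<noteq> \<xi> n0"
    using \<xi> by (auto simp: fun_eq_iff)
  obtain n m where m: "tree_like g n m \<xi>"
    using g \<xi>e by (auto simp: tree_like_perms_def)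
  \<comment> \<open>Both cylinders below have depth at least \<open>n0\<close>, where the end and its image differ.\<close>
  let ?N = "n + n0" and ?M = "m + n0"
  have tl: "tree_like g ?N ?M \<xi>"
    by (rule tree_like_shift[OF perm \<xi>e m])
  have "g ` cyl ?N (\<xi> ?N) \<inter> cyl ?N (\<xi> ?N) = {}"
  proof (rule ccontr)
    assume "g ` cyl ?N (\<xi> ?N) \<inter> cyl ?N (\<xi> ?N) \<noteq> {}"
    then obtain \<eta> where \<eta>: "\<eta> \<in> cyl ?N (\<xi> ?N)" "\<eta> \<in> cyl ?M (g \<xi> ?M)"
      using tree_like_image[OF tl] by blast
    then have "\<eta> n0 = \<xi> n0" "\<eta> n0 = g \<xi> n0"
      using ends_agree[OF _ \<xi>e, of \<eta> ?N n0] ends_agree[OF _ g\<xi>, of \<eta> ?M n0] by auto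
    then show False
      using n0 by simp
  qed
  moreover have "\<xi> \<in> cyl ?N (\<xi> ?N)"
    using \<xi>e by simp
  then have "cyl ?N (\<xi> ?N) \<noteq> {}"
    by blast
  ultimately show ?thesis
    using cyl_clopen by (intro bexI[of _ "cyl ?N (\<xi> ?N)"] conjI)
qed

lemma ball_fixing_antimono:
  assumes "n \<le> k"
  shows "ball_fixing k \<subseteq> ball_fixing n"
proof
  fix g assume g: "g \<in> ball_fixing k"
  then show "g \<in> ball_fixing n"
    using ball_fixing_tree_like[OF g] ball_fixing_below[OF g _ assms] by (simp add: ball_fixing_def)
qed

text \<open>
  Below each vertex of a large sphere, replace \<open>g\<close> by the canonical colour preserving map onto the same
  image. The result \<open>v\<close> moves the vertices of the sphere as \<open>g\<close> does.
\<close>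

lemma ex_colour_preserving_approximation:
  assumes F: "patterning T C F" and g: "g \<in> patterned_perms F"
  shows "\<exists>v \<in> patterned_perms trivial_pattern. perm_inv g \<circ> v \<in> ball_fixing n0"
proof -
  have perm: "g permutes ends"
    using g by (simp add: patterned_perms_def)
  note inv = permutes_inverses[OF perm]
  obtain n' where n': "\<forall>k \<ge> n'. \<exists>M. \<forall>\<xi> \<in> ends. \<exists>m. pattern_like F g k m \<xi> \<and> k \<le> m + n' \<and> m \<le> M"
    using patterned_perms_levels[OF g] by blast
  define n where "n = max n0 n'"
  have n: "\<exists>m. pattern_like F g n m \<xi>" if "\<xi> \<in> ends" for \<xi>
    using n' that unfolding n_def by (meson max.cobounded2)
  have "\<exists>h m. \<forall>\<xi> \<in> cyl n x. pattern_like F g n m \<xi> \<and> bij_betw h (cyl n x) (cyl m (g \<xi> m)) \<and>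
      (\<forall>\<eta> \<in> cyl n x. same_colours n m \<eta> (h \<eta>))" for x
  proof (cases "cyl n x = {}")
    case True
    then show ?thesis
      by simp
  next
    case False
    then obtain \<xi> where "\<xi> \<in> cyl n x"
      by blast
    then have \<xi>: "\<xi> \<in> ends" "\<xi> n = x"
      by simp_all
    obtain m where m: "pattern_like F g n m \<xi>"
      using n \<xi>(1) by blast
    then have nm: "1 \<le> n" "1 \<le> m"
      by (auto simp: pattern_like_def)
    have g\<xi>: "g \<xi> \<in> ends"
      using permutes_in_image[OF perm] \<xi>(1) by simp
    have "lab C (g \<xi> m) = lab C (\<xi> n)"
      using pattern_like_locally[OF m \<xi>(1) refl, of 0] by (simp add: locally_patterned_def)
    then obtain h where h: "bij_betw h (cyl n (\<xi> n)) (cyl m (g \<xi> m))"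
        "\<forall>\<eta> \<in> cyl n (\<xi> n). same_colours n m \<eta> (h \<eta>)"
      using ex_cylinder_map[OF \<xi>(1) g\<xi> nm] by blast
    have "pattern_like F g n m \<eta> \<and> g \<eta> m = g \<xi> m" if "\<eta> \<in> cyl n x" for \<eta>
      using that pattern_like_cong_end[OF m \<xi>(1), of \<eta>] \<xi>(2)
        tree_like_base[OF pattern_like_tree_like[OF m] \<xi>(1), of \<eta>] by auto
    then show ?thesis
      using h \<xi>(2) by (intro exI[of _ h] exI[of _ m]) auto
  qed
  then have "\<exists>h m. \<forall>x. \<forall>\<xi> \<in> cyl n x. pattern_like F g n (m x) \<xi> \<and>
      bij_betw (h x) (cyl n x) (cyl (m x) (g \<xi> (m x))) \<and> (\<forall>\<eta> \<in> cyl n x. same_colours n (m x) \<eta> (h x \<eta>))"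
    by metis
  then obtain h m where hm: "\<forall>x. \<forall>\<xi> \<in> cyl n x. pattern_like F g n (m x) \<xi> \<and>
      bij_betw (h x) (cyl n x) (cyl (m x) (g \<xi> (m x))) \<and> (\<forall>\<eta> \<in> cyl n x. same_colours n (m x) \<eta> (h x \<eta>))"
    by blast
  have at: "pattern_like F g n (m (\<xi> n)) \<xi>" "bij_betw (h (\<xi> n)) (cyl n (\<xi> n)) (g ` cyl n (\<xi> n))"
    "g ` cyl n (\<xi> n) = cyl (m (\<xi> n)) (g \<xi> (m (\<xi> n)))"
    "\<forall>\<eta> \<in> cyl n (\<xi> n). same_colours n (m (\<xi> n)) \<eta> (h (\<xi> n) \<eta>)" if "\<xi> \<in> ends" for \<xi>
  proof -
    have \<xi>: "\<xi> \<in> cyl n (\<xi> n)"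
      using that by simp
    then show pat: "pattern_like F g n (m (\<xi> n)) \<xi>"
      using hm by blast
    show img: "g ` cyl n (\<xi> n) = cyl (m (\<xi> n)) (g \<xi> (m (\<xi> n)))"
      by (rule tree_like_image[OF pattern_like_tree_like[OF pat]])
    show "bij_betw (h (\<xi> n)) (cyl n (\<xi> n)) (g ` cyl n (\<xi> n))"
      "\<forall>\<eta> \<in> cyl n (\<xi> n). same_colours n (m (\<xi> n)) \<eta> (h (\<xi> n) \<eta>)"
      using hm \<xi> img by auto
  qed
  define v where "v \<xi> = (if \<xi> \<in> ends then h (\<xi> n) \<xi> else \<xi>)" for \<xi>
  have v_img: "v ` cyl n (\<xi> n) = g ` cyl n (\<xi> n)" if "\<xi> \<in> ends" for \<xi>
  proof -
    have "v ` cyl n (\<xi> n) = h (\<xi> n) ` cyl n (\<xi> n)"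
      by (intro image_cong) (auto simp: v_def)
    then show ?thesis
      using at(2)[OF that] by (simp add: bij_betw_def)
  qed
  have v_g: "v \<xi> \<in> g ` cyl n (\<xi> n)" if "\<xi> \<in> ends" for \<xi>
    using v_img[OF that] that by auto
  have v_perm: "v permutes ends"
  proof (rule bij_imp_permutes)
    show "v \<xi> = \<xi>" if "\<xi> \<notin> ends" for \<xi>
      using that by (simp add: v_def)
    have "inj_on v ends"
    proof (rule inj_onI)
      fix \<xi> \<xi>' assume \<xi>: "\<xi> \<in> ends" "\<xi>' \<in> ends" "v \<xi> = v \<xi>'"
      then obtain \<eta> \<eta>' where "\<eta> \<in> cyl n (\<xi> n)" "\<eta>' \<in> cyl n (\<xi>' n)" "g \<eta> = g \<eta>'"
        using v_g by (metis imageE)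
      moreover from this have "\<eta> = \<eta>'"
        using injD[OF permutes_inj[OF perm]] by blast
      ultimately have eq: "\<xi> n = \<xi>' n"
        by auto
      then have "h (\<xi> n) \<xi> = h (\<xi> n) \<xi>'"
        using \<xi> by (simp add: v_def)
      then show "\<xi> = \<xi>'"
        using at(2)[OF \<xi>(1)] \<xi> eq by (auto simp: bij_betw_def inj_on_def)
    qed
    moreover have "v ` ends = ends"
    proof
      show "v ` ends \<subseteq> ends"
        using v_g permutes_in_image[OF perm] by fastforce
      show "ends \<subseteq> v ` ends"
      proof
        fix \<zeta> assume "\<zeta> \<in> ends"
        then obtain \<xi> where \<xi>: "\<xi> \<in> ends" "\<zeta> = g \<xi>"
          using permutes_image[OF perm] by blast
        then have "\<zeta> \<in> v ` cyl n (\<xi> n)"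
          using v_img[OF \<xi>(1)] by auto
        then show "\<zeta> \<in> v ` ends"
          by auto
      qed
    qed
    ultimately show "bij_betw v ends ends"
      by (simp add: bij_betw_def)
  qed
  have v_pat: "pattern_like trivial_pattern v n (m (\<xi> n)) \<xi>" and v_m: "v \<xi> (m (\<xi> n)) = g \<xi> (m (\<xi> n))"
    if \<xi>: "\<xi> \<in> ends" for \<xi>
  proof -
    show eq: "v \<xi> (m (\<xi> n)) = g \<xi> (m (\<xi> n))"
      using v_g[OF \<xi>] at(3)[OF \<xi>] by auto
    have "1 \<le> n" "1 \<le> m (\<xi> n)"
      using at(1)[OF \<xi>] by (auto simp: pattern_like_def)
    then show "pattern_like trivial_pattern v n (m (\<xi> n)) \<xi>"
    proof (rule pattern_like_if_same_colours[OF patterning_trivial \<xi>])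
      show "v ` cyl n (\<xi> n) = cyl (m (\<xi> n)) (v \<xi> (m (\<xi> n)))"
        using v_img[OF \<xi>] at(3)[OF \<xi>] eq by simp
      show "same_colours n (m (\<xi> n)) \<eta> (v \<eta>)" if "\<eta> \<in> cyl n (\<xi> n)" for \<eta>
        using at(4)[OF \<xi>] that by (auto simp: v_def)
    qed
  qed
  then have v: "v \<in> patterned_perms trivial_pattern"
    using v_perm by (auto simp: patterned_perms_def)
  have "perm_inv g \<circ> v \<in> ball_fixing n"
    unfolding ball_fixing_def
  proof (intro CollectI conjI ballI)
    show "perm_inv g \<circ> v permutes ends"
      by (rule permutes_compose[OF v_perm permutes_inv[OF perm]])
    fix \<xi> assume \<xi>: "\<xi> \<in> ends"
    have ends: "g \<xi> \<in> ends" "v \<xi> \<in> ends"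
      using permutes_in_image[OF perm] permutes_in_image[OF v_perm] \<xi> by auto
    have "tree_like (perm_inv g) (m (\<xi> n)) n (g \<xi>)"
      by (rule tree_like_inv[OF perm pattern_like_tree_like[OF at(1)[OF \<xi>]]])
    then have "tree_like (perm_inv g) (m (\<xi> n)) n (v \<xi>)"
      using tree_like_cong_end ends v_m[OF \<xi>] by blast
    then show "tree_like (perm_inv g \<circ> v) n n \<xi>"
      by (rule tree_like_comp[OF pattern_like_tree_like[OF v_pat[OF \<xi>]]])
    obtain \<eta> where "\<eta> \<in> cyl n (\<xi> n)" "v \<xi> = g \<eta>"
      using v_g[OF \<xi>] by blast
    then show "(perm_inv g \<circ> v) \<xi> n = \<xi> n"
      by (simp add: inv)
  qed
  then have "perm_inv g \<circ> v \<in> ball_fixing n0"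
    using ball_fixing_antimono[of n0 n] by (auto simp: n_def)
  then show ?thesis
    using v by blast
qed

lemma ball_fixing_comp:
  assumes g: "g \<in> ball_fixing n" and h: "h \<in> ball_fixing n"
  shows "g \<circ> h \<in> ball_fixing n"
  unfolding ball_fixing_def
proof (intro CollectI conjI ballI)
  have perm: "g permutes ends" "h permutes ends"
    using g h by (auto simp: ball_fixing_def)
  then show "g \<circ> h permutes ends"
    by (intro permutes_compose)
  fix \<xi> assume \<xi>: "\<xi> \<in> ends"
  then have "h \<xi> \<in> ends"
    using permutes_in_image[OF perm(2)] by simp
  then show "tree_like (g \<circ> h) n n \<xi>" "(g \<circ> h) \<xi> n = \<xi> n"
    using g h \<xi> tree_like_comp[of h n n \<xi> g n] by (auto simp: ball_fixing_def)
qed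

lemma ball_fixing_inv:
  assumes g: "g \<in> ball_fixing n"
  shows "perm_inv g \<in> ball_fixing n"
  unfolding ball_fixing_def
proof (intro CollectI conjI ballI)
  have perm: "g permutes ends"
    using g by (auto simp: ball_fixing_def)
  then show "perm_inv g permutes ends"
    by (rule permutes_inv)
  fix \<zeta> assume "\<zeta> \<in> ends"
  then obtain \<xi> where \<xi>: "\<xi> \<in> ends" "\<zeta> = g \<xi>"
    using permutes_image[OF perm] by blast
  then show "tree_like (perm_inv g) n n \<zeta>" "perm_inv g \<zeta> n = \<zeta> n"
    using g tree_like_inv[OF perm, of n n \<xi>] by (auto simp: ball_fixing_def permutes_inverses[OF perm])
qed

text \<open>
  Choose \<open>L\<close> so large that \<open>perm_inv g\<close> is tree-like from depth \<open>L\<close> on, and let the images of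
  the vertices of depth \<open>L\<close> have depth at most \<open>M\<close>. If \<open>u\<close> fixes the ball of radius \<open>M\<close>, it fixes all
  of these images, so the conjugate fixes all vertices of depth \<open>L\<close>.
\<close>

lemma ball_fixing_conj:
  assumes F: "patterning T C F" and g: "g \<in> patterned_perms F"
  shows "\<exists>M. \<forall>u \<in> ball_fixing M. g \<circ> u \<circ> perm_inv g \<in> ball_fixing n"
proof -
  have perm: "g permutes ends"
    using g by (simp add: patterned_perms_def)
  note inv = permutes_inverses[OF perm]
  let ?i = "perm_inv g"
  have perm_i: "?i permutes ends"
    by (rule permutes_inv[OF perm])
  obtain n' where n': "\<forall>k \<ge> n'. \<exists>M. \<forall>\<xi> \<in> ends. \<exists>m. pattern_like F ?i k m \<xi> \<and> k \<le> m + n' \<and> m \<le> M"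
    using patterned_perms_levels[OF inv_patterned[OF F g]] by blast
  define L where "L = max n n'"
  obtain M where M: "\<forall>\<xi> \<in> ends. \<exists>m. pattern_like F ?i L m \<xi> \<and> m \<le> M"
    using n' unfolding L_def by (meson max.cobounded2)
  have "g \<circ> u \<circ> ?i \<in> ball_fixing n" if u: "u \<in> ball_fixing M" for u
  proof -
    have perm_u: "u permutes ends"
      using u by (simp add: ball_fixing_def)
    have "g \<circ> u \<circ> ?i \<in> ball_fixing L"
      unfolding ball_fixing_def
    proof (intro CollectI conjI ballI)
      show "g \<circ> u \<circ> ?i permutes ends"
        by (intro permutes_compose perm perm_u perm_i)
      fix \<zeta> assume \<zeta>: "\<zeta> \<in> ends"
      obtain m where m: "pattern_like F ?i L m \<zeta>" "m \<le> M"
        using M \<zeta> by blast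
      have i\<zeta>: "?i \<zeta> \<in> ends"
        using permutes_in_image[OF perm_i] \<zeta> by simp
      then have ui\<zeta>: "u (?i \<zeta>) \<in> ends"
        using permutes_in_image[OF perm_u] by simp
      have um: "u (?i \<zeta>) m = ?i \<zeta> m"
        by (rule ball_fixing_below[OF u i\<zeta> m(2)])
      have tl_i: "tree_like ?i L m \<zeta>"
        by (rule pattern_like_tree_like[OF m(1)])
      have "tree_like (perm_inv ?i) m L (?i \<zeta>)"
        by (rule tree_like_inv[OF perm_i tl_i])
      then have tl_g: "tree_like g m L (?i \<zeta>)"
        by (simp add: inv_inv_eq[OF permutes_bij[OF perm]])
      have "tree_like g m L (u (?i \<zeta>))"
        by (rule tree_like_cong_end[OF tl_g i\<zeta> ui\<zeta> um])
      then have "tree_like (g \<circ> u) m L (?i \<zeta>)"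
        by (rule tree_like_comp[OF ball_fixing_tree_like[OF u i\<zeta>]])
      then show "tree_like (g \<circ> u \<circ> ?i) L L \<zeta>"
        by (rule tree_like_comp[OF tl_i])
      show "(g \<circ> u \<circ> ?i) \<zeta> L = \<zeta> L"
        using tree_like_base[OF tl_g i\<zeta> ui\<zeta> um] by (simp add: inv)
    qed
    then show ?thesis
      using ball_fixing_antimono[of n L] by (auto simp: L_def)
  qed
  then show ?thesis
    by blast
qed

end

section \<open>The topology of the automorphism group\<close>

context branching_tree
begin

text \<open>
  Basic neighbourhoods in the topology of pointwise convergence prescribe the values at finitely many
  vertices, and finitely many vertices lie in a ball.
\<close>

lemma aut_topology_open_iff:
  assumes Q: "Q \<subseteq> tree_automorphisms T"
  shows "openin (subtopology (aut_topology T) Q) W \<longleftrightarrow> W \<subseteq> Q \<and>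
    (\<forall>\<alpha> \<in> W. \<exists>n. \<forall>\<beta> \<in> Q. (\<forall>\<xi> \<in> ends. \<forall>i \<le> n. \<beta> (\<xi> i) = \<alpha> (\<xi> i)) \<longrightarrow> \<beta> \<in> W)"
proof -
  let ?P = "product_topology (\<lambda>_. discrete_topology (tverts T)) (tverts T)"
  have sub: "subtopology (aut_topology T) Q = subtopology ?P Q"
    using Q by (simp add: aut_topology_def subtopology_subtopology Int_absorb1)
  have auts: "\<alpha> \<in> Pi\<^sub>E (tverts T) (\<lambda>_. tverts T)" if "\<alpha> \<in> tree_automorphisms T" for \<alpha>
    using that by (auto simp: tree_automorphisms_def Bij_def bij_betw_def PiE_def)
  have fin: "finite (\<Union>i \<le> n. sphere i)" for n
    using finite_sphere by simp
  show ?thesis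
    unfolding sub
  proof (intro iffI conjI ballI)
    assume W: "openin (subtopology ?P Q) W"
    then show "W \<subseteq> Q"
      using openin_subset by fastforce
    obtain R where R: "openin ?P R" "W = R \<inter> Q"
      using W by (auto simp: openin_subtopology)
    fix \<alpha> assume \<alpha>: "\<alpha> \<in> W"
    obtain B where B: "finite {x \<in> tverts T. B x \<noteq> topspace (discrete_topology (tverts T))}"
        "\<alpha> \<in> Pi\<^sub>E (tverts T) B" "Pi\<^sub>E (tverts T) B \<subseteq> R"
      using R(1) \<alpha> R(2) unfolding openin_product_topology_alt by blast
    obtain n where n: "\<forall>\<xi> \<in> ends. \<forall>N. \<xi> N \<in> {x \<in> tverts T. B x \<noteq> topspace (discrete_topology (tverts T))} \<longrightarrow> N \<le> n"
      using level_bound[OF B(1)] by blast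
    have "\<beta> \<in> W" if \<beta>: "\<beta> \<in> Q" "\<forall>\<xi> \<in> ends. \<forall>i \<le> n. \<beta> (\<xi> i) = \<alpha> (\<xi> i)" for \<beta>
    proof -
      have \<beta>E: "\<beta> \<in> Pi\<^sub>E (tverts T) (\<lambda>_. tverts T)"
        using auts Q \<beta>(1) by blast
      have "\<beta> \<in> Pi\<^sub>E (tverts T) B"
      proof (rule PiE_I)
        fix x assume x: "x \<in> tverts T"
        then obtain \<xi> i where \<xi>: "\<xi> \<in> ends" "\<xi> i = x"
          using ex_end_vertex by blast
        show "\<beta> x \<in> B x"
        proof (cases "B x = tverts T")
          case True
          then show ?thesis
            using \<beta>E x by auto
        next
          case False
          then have "i \<le> n"
            using n \<xi> x by auto
          then have "\<beta> x = \<alpha> x"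
            using \<beta>(2) \<xi> by blast
          then show ?thesis
            using B(2) x by auto
        qed
      next
        fix x assume "x \<notin> tverts T"
        then show "\<beta> x = undefined"
          using \<beta>E by (auto simp: PiE_def extensional_def)
      qed
      then show ?thesis
        using B(3) R(2) \<beta>(1) by blast
    qed
    then show "\<exists>n. \<forall>\<beta> \<in> Q. (\<forall>\<xi> \<in> ends. \<forall>i \<le> n. \<beta> (\<xi> i) = \<alpha> (\<xi> i)) \<longrightarrow> \<beta> \<in> W"
      by blast
  next
    assume W: "W \<subseteq> Q \<and>
      (\<forall>\<alpha> \<in> W. \<exists>n. \<forall>\<beta> \<in> Q. (\<forall>\<xi> \<in> ends. \<forall>i \<le> n. \<beta> (\<xi> i) = \<alpha> (\<xi> i)) \<longrightarrow> \<beta> \<in> W)"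
    show "openin (subtopology ?P Q) W"
    proof (subst openin_subopen, intro ballI)
      fix \<alpha> assume \<alpha>: "\<alpha> \<in> W"
      then obtain n where n: "\<forall>\<beta> \<in> Q. (\<forall>\<xi> \<in> ends. \<forall>i \<le> n. \<beta> (\<xi> i) = \<alpha> (\<xi> i)) \<longrightarrow> \<beta> \<in> W"
        using W by blast
      have \<alpha>E: "\<alpha> \<in> Pi\<^sub>E (tverts T) (\<lambda>_. tverts T)"
        using auts Q W \<alpha> by blast
      define B where "B x = (if x \<in> (\<Union>i \<le> n. sphere i) then {\<alpha> x} else tverts T)" for x
      have "finite {x \<in> tverts T. B x \<noteq> tverts T}"
        by (rule finite_subset[OF _ fin[of n]]) (auto simp: B_def split: if_splits)
      then have "openin ?P (Pi\<^sub>E (tverts T) B)"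
        using \<alpha>E by (auto simp: openin_PiE_gen B_def)
      then have "openin (subtopology ?P Q) (Pi\<^sub>E (tverts T) B \<inter> Q)"
        by (auto simp: openin_subtopology)
      moreover have "\<alpha> \<in> Pi\<^sub>E (tverts T) B \<inter> Q"
        using \<alpha>E \<alpha> W by (auto simp: B_def PiE_def)
      moreover have "Pi\<^sub>E (tverts T) B \<inter> Q \<subseteq> W"
      proof
        fix \<beta> assume \<beta>: "\<beta> \<in> Pi\<^sub>E (tverts T) B \<inter> Q"
        have "\<beta> (\<xi> i) = \<alpha> (\<xi> i)" if "\<xi> \<in> ends" "i \<le> n" for \<xi> i
        proof -
          have "\<xi> i \<in> (\<Union>i \<le> n. sphere i)"
            using that by (auto simp: sphere_def)
          then have "B (\<xi> i) = {\<alpha> (\<xi> i)}"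
            by (simp add: B_def)
          moreover have "\<beta> (\<xi> i) \<in> B (\<xi> i)"
            using \<beta> ends_vert[OF that(1)] by auto
          ultimately show ?thesis
            by simp
        qed
        then show "\<beta> \<in> W"
          using n \<beta> by blast
      qed
      ultimately show "\<exists>R. openin (subtopology ?P Q) R \<and> \<alpha> \<in> R \<and> R \<subseteq> W"
        by blast
    qed
  qed
qed

lemma topspace_aut_subtopology:
  assumes "Q \<subseteq> tree_automorphisms T"
  shows "topspace (subtopology (aut_topology T) Q) = Q"
proof
  show "topspace (subtopology (aut_topology T) Q) \<subseteq> Q"
    by simp
  have "openin (subtopology (aut_topology T) Q) Q"
    using aut_topology_open_iff[OF assms] by blast
  then show "Q \<subseteq> topspace (subtopology (aut_topology T) Q)"
    by (rule openin_subset)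
qed

end

section \<open>The group of patterned almost automorphisms\<close>

locale patterned_tree = coloured_tree T C for T :: "'v rooted_tree" and C :: "('v, 'l, 'c) colouring" +
  fixes F :: "'l \<Rightarrow> ('c \<Rightarrow> 'c) set"
  assumes pattern: "patterning T C F"
begin

abbreviation G :: "'v honest set monoid" where
  "G \<equiv> AAut_pat T C F"

lemma carrier_G: "carrier G = almost_of ` patterned_perms F"
  by (rule carrier_AAut_pat[OF pattern])

lemma inj_almost_of: "inj_on almost_of (patterned_perms F)"
  by (rule inj_on_subset[OF almost_of_inj patterned_perms_tree_like])

lemma mult_G:
  assumes "g \<in> patterned_perms F" "h \<in> patterned_perms F"
  shows "almost_of g \<otimes>\<^bsub>G\<^esub> almost_of h = almost_of (g \<circ> h)"
  using mult_AAut assms patterned_perms_tree_like by (auto simp: AAut_pat_def)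

lemma one_G: "\<one>\<^bsub>G\<^esub> = almost_of id"
proof -
  have id: "(\<lambda>x \<in> tverts T. x) \<in> tree_automorphisms T"
    using root_vert by (auto simp: tree_automorphisms_def Bij_def bij_betw_def inj_on_def)
  have "acts_as (\<lambda>x \<in> tverts T. x) id"
    using ends_vert by (simp add: acts_as_def permutes_id)
  then have "aut_to_almost T (\<lambda>x \<in> tverts T. x) = almost_of id"
    by (rule aut_to_almost_eq[OF id])
  then show ?thesis
    by (simp add: AAut_pat_def AAut_def aut_to_almost_def)
qed

lemma perm_cancel:
  assumes "g \<in> patterned_perms F"
  shows "perm_inv g \<circ> g = id" "g \<circ> perm_inv g = id"
  using assms permutes_inv_o[of g ends] by (auto simp: patterned_perms_def)

lemma group_G: "group G"
proof (rule groupI)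
  fix x y z assume "x \<in> carrier G" "y \<in> carrier G" "z \<in> carrier G"
  then obtain f g h where fgh: "f \<in> patterned_perms F" "g \<in> patterned_perms F" "h \<in> patterned_perms F"
      "x = almost_of f" "y = almost_of g" "z = almost_of h"
    unfolding carrier_G by blast
  show "x \<otimes>\<^bsub>G\<^esub> y \<otimes>\<^bsub>G\<^esub> z = x \<otimes>\<^bsub>G\<^esub> (y \<otimes>\<^bsub>G\<^esub> z)"
    using fgh by (simp add: mult_G comp_patterned[OF pattern] comp_assoc)
next
  fix x y assume "x \<in> carrier G" "y \<in> carrier G"
  then show "x \<otimes>\<^bsub>G\<^esub> y \<in> carrier G"
    using comp_patterned[OF pattern] by (auto simp: carrier_G mult_G)
next
  show "\<one>\<^bsub>G\<^esub> \<in> carrier G"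
    using id_patterned[OF pattern] by (auto simp: carrier_G one_G)
next
  fix x assume "x \<in> carrier G"
  then obtain g where g: "g \<in> patterned_perms F" "x = almost_of g"
    unfolding carrier_G by blast
  show "\<one>\<^bsub>G\<^esub> \<otimes>\<^bsub>G\<^esub> x = x"
    using g id_patterned[OF pattern] by (simp add: one_G mult_G)
  have "almost_of (perm_inv g) \<otimes>\<^bsub>G\<^esub> x = \<one>\<^bsub>G\<^esub>"
    using g inv_patterned[OF pattern g(1)] perm_cancel[OF g(1)] by (simp add: one_G mult_G)
  moreover have "almost_of (perm_inv g) \<in> carrier G"
    using inv_patterned[OF pattern g(1)] by (simp add: carrier_G)
  ultimately show "\<exists>y \<in> carrier G. y \<otimes>\<^bsub>G\<^esub> x = \<one>\<^bsub>G\<^esub>"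
    by blast
qed

sublocale group G
  by (rule group_G)

lemma inv_G:
  assumes g: "g \<in> patterned_perms F"
  shows "inv\<^bsub>G\<^esub> almost_of g = almost_of (perm_inv g)"
proof (rule inv_equality)
  note i = inv_patterned[OF pattern g]
  show "almost_of (perm_inv g) \<otimes>\<^bsub>G\<^esub> almost_of g = \<one>\<^bsub>G\<^esub>"
    using g i perm_cancel[OF g] by (simp add: one_G mult_G)
  show "almost_of g \<in> carrier G" "almost_of (perm_inv g) \<in> carrier G"
    using g i by (simp_all add: carrier_G)
qed

lemma subgroup_almost_of:
  assumes H: "H \<subseteq> patterned_perms F" and "id \<in> H"
    and comp: "\<And>g h. \<lbrakk>g \<in> H; h \<in> H\<rbrakk> \<Longrightarrow> g \<circ> h \<in> H" and inv: "\<And>g. g \<in> H \<Longrightarrow> perm_inv g \<in> H"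
  shows "subgroup (almost_of ` H) G"
proof (rule subgroupI)
  show "almost_of ` H \<subseteq> carrier G" "almost_of ` H \<noteq> {}"
    using assms by (auto simp: carrier_G)
  show "inv\<^bsub>G\<^esub> a \<in> almost_of ` H" if "a \<in> almost_of ` H" for a
  proof -
    obtain g where "g \<in> H" "a = almost_of g"
      using \<open>a \<in> almost_of ` H\<close> by blast
    then show ?thesis
      using H inv inv_G by auto
  qed
  show "a \<otimes>\<^bsub>G\<^esub> b \<in> almost_of ` H" if "a \<in> almost_of ` H" "b \<in> almost_of ` H" for a b
  proof -
    obtain g h where "g \<in> H" "a = almost_of g" "h \<in> H" "b = almost_of h"
      using \<open>a \<in> almost_of ` H\<close> \<open>b \<in> almost_of ` H\<close> by blast
    then show ?thesis
      using comp[of g h] mult_G[of g h] H by auto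
  qed
qed

lemma subgroup_V_group: "subgroup (V_group T C) G"
  unfolding V_group_eq
  by (intro subgroup_almost_of trivial_patterned_subset[OF pattern] id_patterned comp_patterned
      inv_patterned patterning_trivial)

text \<open>
  The permutation of the ends that an element of the group induces.
\<close>

definition action :: "'v honest set \<Rightarrow> (nat \<Rightarrow> 'v) \<Rightarrow> nat \<Rightarrow> 'v" where
  "action = the_inv_into (patterned_perms F) almost_of"

lemma action_almost_of: "g \<in> patterned_perms F \<Longrightarrow> action (almost_of g) = g"
  unfolding action_def by (rule the_inv_into_f_f[OF inj_almost_of])

lemma action_patterned: "a \<in> carrier G \<Longrightarrow> action a \<in> patterned_perms F"
  by (auto simp: carrier_G action_almost_of)

lemma action_V: "a \<in> V_group T C \<Longrightarrow> action a \<in> patterned_perms trivial_pattern"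
  using trivial_patterned_subset[OF pattern] by (auto simp: V_group_eq action_almost_of)

lemma V_group_action:
  assumes "g \<in> patterned_perms trivial_pattern"
  shows "almost_of g \<in> V_group T C" "action (almost_of g) = g"
  using assms trivial_patterned_subset[OF pattern] by (auto simp: V_group_eq action_almost_of)

lemma vigorous: "vigorous_action G action ends clopens (V_group T C)"
proof (intro vigorous_action.intro vigorous_action_axioms.intro group_G)
  show "subgroup (V_group T C) G"
    by (rule subgroup_V_group)
  show "ends \<in> clopens"
    by (rule ends_clopen)
  show "action g permutes ends" if "g \<in> carrier G" for g
    using action_patterned[OF that] by (simp add: patterned_perms_def)
  show "action (g \<otimes>\<^bsub>G\<^esub> h) = action g \<circ> action h" if "g \<in> carrier G" "h \<in> carrier G" for g h
    using that comp_patterned[OF pattern] by (auto simp: carrier_G mult_G action_almost_of)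
  show "inj_on action (carrier G)"
    unfolding carrier_G by (rule inj_onI) (auto simp: action_almost_of)
  show "U \<subseteq> ends" if "U \<in> clopens" for U
    using that by (rule clopen_subset)
  show "U - W \<in> clopens" if "U \<in> clopens" "W \<in> clopens" for U W
    using that by (rule clopens_Diff)
  show "action a ` U \<in> clopens" if "a \<in> V_group T C" "U \<in> clopens" for a U
    using patterned_image_clopen[OF action_V] that by blast
  show "\<exists>W \<in> clopens. W \<noteq> {} \<and> W \<subset> U" if "U \<in> clopens" "U \<noteq> {}" for U
    using that by (rule clopen_split)
  show "\<exists>s \<in> V_group T C. (\<forall>x \<in> U. action s x = action a x) \<and>
      (\<forall>x. x \<notin> U \<union> action a ` U \<longrightarrow> action s x = x)"
    if prems: "a \<in> V_group T C" "U \<in> clopens" "action a ` U \<inter> U = {}" for a U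
  proof -
    obtain s where "s \<in> patterned_perms trivial_pattern" "\<forall>x \<in> U. s x = action a x"
        "\<forall>x. x \<notin> U \<union> action a ` U \<longrightarrow> s x = x"
      using ex_swap_patterned[OF patterning_trivial action_V[OF prems(1)] prems(2,3)] by blast
    then show ?thesis
      using V_group_action by (intro bexI[of _ "almost_of s"]) auto
  qed
  show "\<exists>c \<in> V_group T C. action c ` U \<subseteq> W"
    if prems: "U \<in> clopens" "W \<in> clopens" "W \<noteq> {}" "U \<inter> W = {}" for U W
  proof -
    obtain c where "c \<in> patterned_perms trivial_pattern" "c ` U \<subseteq> W"
      using ex_compression[OF patterning_trivial prems] by blast
    then show ?thesis
      using V_group_action by (intro bexI[of _ "almost_of c"]) auto
  qed
qed

section \<open>The group topology\<close>

definition ball_subgroup :: "nat \<Rightarrow> 'v honest set set" where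
  "ball_subgroup n = almost_of ` (ball_fixing n \<inter> patterned_perms F)"

lemma id_ball_fixing: "id \<in> ball_fixing n"
  by (simp add: ball_fixing_def tree_like_id permutes_id)

lemma subgroup_basis_ball: "subgroup_basis G ball_subgroup"
proof (intro subgroup_basis.intro subgroup_basis_axioms.intro group_G)
  show "subgroup (ball_subgroup n) G" for n
    unfolding ball_subgroup_def
    by (rule subgroup_almost_of)
      (auto intro: id_ball_fixing ball_fixing_comp ball_fixing_inv id_patterned[OF pattern]
        comp_patterned[OF pattern] inv_patterned[OF pattern] simp del: comp_apply)
  show "ball_subgroup n \<subseteq> ball_subgroup m" if "m \<le> n" for m n
    using ball_fixing_antimono[OF that] by (auto simp: ball_subgroup_def)
  show "\<exists>m. \<forall>u \<in> ball_subgroup m. a \<otimes>\<^bsub>G\<^esub> u \<otimes>\<^bsub>G\<^esub> inv\<^bsub>G\<^esub> a \<in> ball_subgroup n"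
    if a: "a \<in> carrier G" for a n
  proof -
    obtain g where g: "g \<in> patterned_perms F" "a = almost_of g"
      using a unfolding carrier_G by blast
    obtain m where m: "\<forall>u \<in> ball_fixing m. g \<circ> u \<circ> perm_inv g \<in> ball_fixing n"
      using ball_fixing_conj[OF pattern g(1)] by blast
    have "a \<otimes>\<^bsub>G\<^esub> u \<otimes>\<^bsub>G\<^esub> inv\<^bsub>G\<^esub> a \<in> ball_subgroup n" if u: "u \<in> ball_subgroup m" for u
    proof -
      obtain h where h: "h \<in> ball_fixing m" "h \<in> patterned_perms F" "u = almost_of h"
        using u unfolding ball_subgroup_def by blast
      have "g \<circ> h \<in> patterned_perms F" "perm_inv g \<in> patterned_perms F"
        using g h comp_patterned[OF pattern] inv_patterned[OF pattern] by auto
      then have "a \<otimes>\<^bsub>G\<^esub> u \<otimes>\<^bsub>G\<^esub> inv\<^bsub>G\<^esub> a = almost_of (g \<circ> h \<circ> perm_inv g)"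
          "g \<circ> h \<circ> perm_inv g \<in> patterned_perms F"
        using g h by (simp_all add: mult_G inv_G comp_patterned[OF pattern])
      then show ?thesis
        using m h(1) by (simp add: ball_subgroup_def)
    qed
    then show ?thesis
      by blast
  qed
qed

sublocale ball: subgroup_basis G ball_subgroup
  by (rule subgroup_basis_ball)

lemma automorphism_acts_as_iff:
  assumes \<alpha>: "\<alpha> \<in> tree_automorphisms T" and g: "g \<in> tree_like_perms"
  shows "aut_to_almost T \<alpha> = almost_of g \<longleftrightarrow> acts_as \<alpha> g"
proof
  assume eq: "aut_to_almost T \<alpha> = almost_of g"
  obtain h where h: "h \<in> tree_like_perms" "acts_as \<alpha> h"
    using ex_acts_as[OF \<alpha>] by blast
  then have "almost_of h = almost_of g"
    using aut_to_almost_eq[OF \<alpha> h(2)] eq by simp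
  then have "h = g"
    using inj_onD[OF almost_of_inj _ h(1) g] by blast
  then show "acts_as \<alpha> g"
    using h(2) by simp
qed (rule aut_to_almost_eq[OF \<alpha>])

lemma automorphism_fixes_root: "\<alpha> \<in> tree_automorphisms T \<Longrightarrow> \<xi> \<in> ends \<Longrightarrow> \<alpha> (\<xi> 0) = \<xi> 0"
  by (simp add: tree_automorphisms_def ends_root)

text \<open>
  Every automorphism fixes the root.
\<close>

lemma Aut_pat_eq: "Aut_pat T C F = ball_subgroup 0"
proof
  show "Aut_pat T C F \<subseteq> ball_subgroup 0"
  proof
    fix A assume "A \<in> Aut_pat T C F"
    then obtain g \<alpha> where g: "g \<in> patterned_perms F" "A = almost_of g"
        "\<alpha> \<in> tree_automorphisms T" "A = aut_to_almost T \<alpha>"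
      by (auto simp: Aut_pat_def carrier_G)
    then have "acts_as \<alpha> g"
      using automorphism_acts_as_iff patterned_perms_tree_like by blast
    then have "g \<in> ball_fixing 0"
      unfolding ball_fixing_iff using g(3) automorphism_fixes_root by blast
    then show "A \<in> ball_subgroup 0"
      using g by (simp add: ball_subgroup_def)
  qed
  show "ball_subgroup 0 \<subseteq> Aut_pat T C F"
  proof
    fix A assume "A \<in> ball_subgroup 0"
    then obtain g where g: "g \<in> ball_fixing 0" "g \<in> patterned_perms F" "A = almost_of g"
      by (auto simp: ball_subgroup_def)
    then obtain \<alpha> where "\<alpha> \<in> tree_automorphisms T" "acts_as \<alpha> g"
      unfolding ball_fixing_iff by blast
    then show "A \<in> Aut_pat T C F"
      using g aut_to_almost_eq by (auto simp: Aut_pat_def carrier_G)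
  qed
qed

definition pattern_automorphisms :: "('v \<Rightarrow> 'v) set" where
  "pattern_automorphisms = {\<alpha> \<in> tree_automorphisms T. aut_to_almost T \<alpha> \<in> Aut_pat T C F}"

lemma pattern_automorphismE:
  assumes "\<alpha> \<in> pattern_automorphisms"
  obtains g where "g \<in> patterned_perms F" "g \<in> ball_fixing 0" "acts_as \<alpha> g" "aut_to_almost T \<alpha> = almost_of g"
proof -
  obtain g where g: "g \<in> ball_fixing 0" "g \<in> patterned_perms F" "aut_to_almost T \<alpha> = almost_of g"
    using assms unfolding pattern_automorphisms_def Aut_pat_eq ball_subgroup_def by blast
  then have "acts_as \<alpha> g"
    using assms automorphism_acts_as_iff patterned_perms_tree_like
    unfolding pattern_automorphisms_def by blast
  then show thesis
    using that g by blast
qed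

lemma ex_pattern_automorphism:
  assumes g: "g \<in> ball_fixing 0" "g \<in> patterned_perms F"
  shows "\<exists>\<alpha> \<in> pattern_automorphisms. acts_as \<alpha> g \<and> aut_to_almost T \<alpha> = almost_of g"
proof -
  obtain \<alpha> where \<alpha>: "\<alpha> \<in> tree_automorphisms T" "acts_as \<alpha> g"
    using g(1) unfolding ball_fixing_iff by blast
  then have "aut_to_almost T \<alpha> = almost_of g"
    by (rule aut_to_almost_eq)
  then show ?thesis
    using \<alpha> g by (auto simp: pattern_automorphisms_def Aut_pat_eq ball_subgroup_def)
qed

lemma openin_Aut_pat: "openin ball.basis_topology (Aut_pat T C F)"
  unfolding Aut_pat_eq ball.openin_basis_topology
  using ball.U_carrier subgroup.m_closed[OF ball.subgroup_U] by blast

text \<open>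
  On both sides, the basic neighbourhoods of an automorphism consist of those that agree with it on a
  ball: multiplying by an element that fixes the ball does not change the values on it, and conversely
  two automorphisms with the same values on the ball differ by such an element.
\<close>

lemma homeomorphic_map_Aut_pat:
  "homeomorphic_map (subtopology (aut_topology T) pattern_automorphisms)
     (subtopology ball.basis_topology (Aut_pat T C F)) (aut_to_almost T)"
proof -
  let ?Z = "subtopology (aut_topology T) pattern_automorphisms"
  have Q: "pattern_automorphisms \<subseteq> tree_automorphisms T"
    by (auto simp: pattern_automorphisms_def)
  have topZ: "topspace ?Z = pattern_automorphisms"
    by (rule topspace_aut_subtopology[OF Q])
  have topY: "topspace (subtopology ball.basis_topology (Aut_pat T C F)) = Aut_pat T C F"
    using openin_subset[OF openin_Aut_pat] by auto
  have "inj_on (aut_to_almost T) pattern_automorphisms"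
  proof (rule inj_onI)
    fix \<alpha> \<beta> assume \<alpha>: "\<alpha> \<in> pattern_automorphisms" and \<beta>: "\<beta> \<in> pattern_automorphisms"
      and eq: "aut_to_almost T \<alpha> = aut_to_almost T \<beta>"
    obtain g where g: "g \<in> patterned_perms F" "acts_as \<alpha> g" "aut_to_almost T \<alpha> = almost_of g"
      using pattern_automorphismE[OF \<alpha>] by metis
    have "\<beta> \<in> tree_automorphisms T" "g \<in> tree_like_perms"
      using \<beta> Q g(1) patterned_perms_tree_like by blast+
    then have "acts_as \<beta> g"
      using automorphism_acts_as_iff g(3) eq by simp
    then show "\<alpha> = \<beta>"
      using automorphism_unique \<alpha> \<beta> Q g(2) by blast
  qed
  moreover have "aut_to_almost T ` pattern_automorphisms = Aut_pat T C F"
  proof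
    show "aut_to_almost T ` pattern_automorphisms \<subseteq> Aut_pat T C F"
      by (auto simp: pattern_automorphisms_def)
    show "Aut_pat T C F \<subseteq> aut_to_almost T ` pattern_automorphisms"
    proof
      fix A assume "A \<in> Aut_pat T C F"
      then obtain g where "g \<in> ball_fixing 0" "g \<in> patterned_perms F" "A = almost_of g"
        unfolding Aut_pat_eq ball_subgroup_def by blast
      then show "A \<in> aut_to_almost T ` pattern_automorphisms"
        using ex_pattern_automorphism by (metis imageI)
    qed
  qed
  moreover have "openin ?Z {\<alpha> \<in> pattern_automorphisms. aut_to_almost T \<alpha> \<in> W} \<longleftrightarrow>
      openin (subtopology ball.basis_topology (Aut_pat T C F)) W" if W: "W \<subseteq> Aut_pat T C F" for W
  proof -
    have WG: "W \<subseteq> carrier G"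
      using W by (auto simp: Aut_pat_def)
    have "openin (subtopology ball.basis_topology (Aut_pat T C F)) W \<longleftrightarrow>
        (\<forall>A \<in> W. \<exists>n. \<forall>u \<in> ball_subgroup n. A \<otimes>\<^bsub>G\<^esub> u \<in> W)"
      using W WG by (simp add: openin_open_subtopology[OF openin_Aut_pat] ball.openin_basis_topology)
    moreover have "openin ?Z {\<alpha> \<in> pattern_automorphisms. aut_to_almost T \<alpha> \<in> W} \<longleftrightarrow>
        (\<forall>\<alpha> \<in> pattern_automorphisms. aut_to_almost T \<alpha> \<in> W \<longrightarrow> (\<exists>n. \<forall>\<beta> \<in> pattern_automorphisms.
          (\<forall>\<xi> \<in> ends. \<forall>i \<le> n. \<beta> (\<xi> i) = \<alpha> (\<xi> i)) \<longrightarrow> aut_to_almost T \<beta> \<in> W))"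
      unfolding aut_topology_open_iff[OF Q] by auto
    moreover have "(\<forall>\<alpha> \<in> pattern_automorphisms. aut_to_almost T \<alpha> \<in> W \<longrightarrow> (\<exists>n. \<forall>\<beta> \<in> pattern_automorphisms.
          (\<forall>\<xi> \<in> ends. \<forall>i \<le> n. \<beta> (\<xi> i) = \<alpha> (\<xi> i)) \<longrightarrow> aut_to_almost T \<beta> \<in> W)) \<longleftrightarrow>
        (\<forall>A \<in> W. \<exists>n. \<forall>u \<in> ball_subgroup n. A \<otimes>\<^bsub>G\<^esub> u \<in> W)" (is "?L \<longleftrightarrow> ?R")
    proof
      assume L: ?L
      show ?R
      proof
        fix A assume A: "A \<in> W"
        then obtain g where g: "g \<in> ball_fixing 0" "g \<in> patterned_perms F" "A = almost_of g"
          using W unfolding Aut_pat_eq ball_subgroup_def by blast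
        obtain \<alpha> where \<alpha>: "\<alpha> \<in> pattern_automorphisms" "acts_as \<alpha> g" "aut_to_almost T \<alpha> = A"
          using ex_pattern_automorphism[OF g(1,2)] g(3) by blast
        obtain n where n: "\<forall>\<beta> \<in> pattern_automorphisms.
            (\<forall>\<xi> \<in> ends. \<forall>i \<le> n. \<beta> (\<xi> i) = \<alpha> (\<xi> i)) \<longrightarrow> aut_to_almost T \<beta> \<in> W"
          using L \<alpha>(1,3) A by blast
        have "A \<otimes>\<^bsub>G\<^esub> u \<in> W" if u: "u \<in> ball_subgroup n" for u
        proof -
          obtain h where h: "h \<in> ball_fixing n" "h \<in> patterned_perms F" "u = almost_of h"
            using u unfolding ball_subgroup_def by blast
          have "h \<in> ball_fixing 0"
            using h(1) ball_fixing_antimono[of 0 n] by blast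
          then have "g \<circ> h \<in> ball_fixing 0"
            by (rule ball_fixing_comp[OF g(1)])
          then obtain \<beta> where \<beta>: "\<beta> \<in> pattern_automorphisms" "acts_as \<beta> (g \<circ> h)"
              "aut_to_almost T \<beta> = almost_of (g \<circ> h)"
            using ex_pattern_automorphism comp_patterned[OF pattern g(2) h(2)] by blast
          have "\<beta> (\<xi> i) = \<alpha> (\<xi> i)" if \<xi>: "\<xi> \<in> ends" "i \<le> n" for \<xi> i
          proof -
            have "h \<xi> \<in> ends"
              using h(1) permutes_in_image[of h ends \<xi>] \<xi>(1) by (simp add: ball_fixing_def)
            then have "g (h \<xi>) i = \<alpha> (h \<xi> i)"
              using \<alpha>(2) by (simp add: acts_as_def)
            moreover have "g (h \<xi>) i = \<beta> (\<xi> i)"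
              using \<beta>(2) \<xi>(1) by (simp add: acts_as_def)
            ultimately show ?thesis
              using ball_fixing_below[OF h(1) \<xi>] by simp
          qed
          then have "aut_to_almost T \<beta> \<in> W"
            using n \<beta>(1) by blast
          then show ?thesis
            using \<beta>(3) g h mult_G by simp
        qed
        then show "\<exists>n. \<forall>u \<in> ball_subgroup n. A \<otimes>\<^bsub>G\<^esub> u \<in> W"
          by blast
      qed
    next
      assume R: ?R
      show ?L
      proof (intro ballI impI)
        fix \<alpha> assume \<alpha>: "\<alpha> \<in> pattern_automorphisms" "aut_to_almost T \<alpha> \<in> W"
        obtain g where g: "g \<in> patterned_perms F" "g \<in> ball_fixing 0" "acts_as \<alpha> g"
            "aut_to_almost T \<alpha> = almost_of g"
          using pattern_automorphismE[OF \<alpha>(1)] by metis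
        have gperm: "g permutes ends"
          using g(1) by (simp add: patterned_perms_def)
        obtain n where n: "\<forall>u \<in> ball_subgroup n. almost_of g \<otimes>\<^bsub>G\<^esub> u \<in> W"
          using R \<alpha>(2) g(4) by auto
        have "aut_to_almost T \<beta> \<in> W"
          if \<beta>: "\<beta> \<in> pattern_automorphisms" "\<forall>\<xi> \<in> ends. \<forall>i \<le> n. \<beta> (\<xi> i) = \<alpha> (\<xi> i)" for \<beta>
        proof -
          obtain k where k: "k \<in> patterned_perms F" "k \<in> ball_fixing 0" "acts_as \<beta> k"
              "aut_to_almost T \<beta> = almost_of k"
            using pattern_automorphismE[OF \<beta>(1)] by metis
          let ?u = "perm_inv g \<circ> k"
          have inv0: "perm_inv g \<in> ball_fixing 0"
            by (rule ball_fixing_inv[OF g(2)])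
          have u0: "?u \<in> ball_fixing 0"
            by (rule ball_fixing_comp[OF inv0 k(2)])
          have "?u \<xi> n = \<xi> n" if \<xi>: "\<xi> \<in> ends" for \<xi>
          proof -
            have ends: "g \<xi> \<in> ends" "k \<xi> \<in> ends"
              using permutes_in_image[OF gperm] permutes_in_image[of k ends] k(1) \<xi>
              by (auto simp: patterned_perms_def)
            have "k \<xi> n = g \<xi> n"
              using g(3) k(3) \<beta>(2) \<xi> by (simp add: acts_as_def)
            then have "perm_inv g (k \<xi>) n = perm_inv g (g \<xi>) n"
              by (rule tree_like_base[OF ball_fixing_tree_like[OF inv0 ends(1)] ends])
            then show ?thesis
              by (simp add: permutes_inverses[OF gperm])
          qed
          then have "?u \<in> ball_fixing n"
            using u0 ball_fixing_tree_like[OF u0] by (simp add: ball_fixing_def)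
          moreover have uP: "?u \<in> patterned_perms F"
            by (rule comp_patterned[OF pattern inv_patterned[OF pattern g(1)] k(1)])
          ultimately have "almost_of g \<otimes>\<^bsub>G\<^esub> almost_of ?u \<in> W"
            using n by (simp add: ball_subgroup_def)
          moreover have "g \<circ> ?u = k"
            using perm_cancel[OF g(1)] by (simp flip: comp_assoc)
          ultimately show ?thesis
            using mult_G[OF g(1) uP] k(4) by simp
        qed
        then show "\<exists>n. \<forall>\<beta> \<in> pattern_automorphisms.
            (\<forall>\<xi> \<in> ends. \<forall>i \<le> n. \<beta> (\<xi> i) = \<alpha> (\<xi> i)) \<longrightarrow> aut_to_almost T \<beta> \<in> W"
          by blast
      qed
    qed
    ultimately show ?thesis
      by blast
  qed
  ultimately show ?thesis
    unfolding homeomorphic_map_def quotient_map_def topZ topY by blast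
qed

lemma AAut_pat_topology_eq: "AAut_pat_topology T C F = ball.basis_topology"
  unfolding AAut_pat_topology_def pattern_automorphisms_def[symmetric]
proof (rule the_equality)
  have one: "\<one>\<^bsub>G\<^esub> \<in> Aut_pat T C F"
    unfolding Aut_pat_eq by (rule subgroup.one_closed[OF ball.subgroup_U])
  show "topological_group G ball.basis_topology \<and> openin ball.basis_topology (Aut_pat T C F) \<and>
      homeomorphic_map (subtopology (aut_topology T) pattern_automorphisms)
        (subtopology ball.basis_topology (Aut_pat T C F)) (aut_to_almost T)"
    using ball.topological_group_basis_topology openin_Aut_pat homeomorphic_map_Aut_pat by blast
  fix X assume "topological_group G X \<and> openin X (Aut_pat T C F) \<and>
      homeomorphic_map (subtopology (aut_topology T) pattern_automorphisms)
        (subtopology X (Aut_pat T C F)) (aut_to_almost T)"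
  then show "X = ball.basis_topology"
    using topological_group_unique[OF _ _ ball.topological_group_basis_topology openin_Aut_pat one _
        homeomorphic_map_Aut_pat] by blast
qed

text \<open>
  Every element can be approximated up to an element fixing a given ball.
\<close>

lemma V_group_dense: "ball.basis_topology closure_of V_group T C = carrier G"
proof
  show "ball.basis_topology closure_of V_group T C \<subseteq> carrier G"
    using closure_of_subset_topspace ball.topspace_basis_topology by metis
  show "carrier G \<subseteq> ball.basis_topology closure_of V_group T C"
  proof
    fix A assume A: "A \<in> carrier G"
    then obtain g where g: "g \<in> patterned_perms F" "A = almost_of g"
      unfolding carrier_G by blast
    have "\<exists>B \<in> V_group T C. B \<in> W" if W: "A \<in> W" "openin ball.basis_topology W" for W
    proof -
      obtain n where n: "\<forall>u \<in> ball_subgroup n. A \<otimes>\<^bsub>G\<^esub> u \<in> W"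
        using W unfolding ball.openin_basis_topology by blast
      obtain v where v: "v \<in> patterned_perms trivial_pattern" "perm_inv g \<circ> v \<in> ball_fixing n"
        using ex_colour_preserving_approximation[OF pattern g(1)] by blast
      have vP: "v \<in> patterned_perms F"
        using v(1) trivial_patterned_subset[OF pattern] by blast
      have u: "perm_inv g \<circ> v \<in> patterned_perms F"
        by (rule comp_patterned[OF pattern inv_patterned[OF pattern g(1)] vP])
      have "A \<otimes>\<^bsub>G\<^esub> almost_of (perm_inv g \<circ> v) \<in> W"
        using n u v(2) by (simp add: ball_subgroup_def)
      moreover have "g \<circ> (perm_inv g \<circ> v) = v"
        using perm_cancel[OF g(1)] by (simp flip: comp_assoc)
      ultimately have "almost_of v \<in> W"
        using mult_G[OF g(1) u] g(2) by simp
      then show ?thesis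
        using V_group_action(1)[OF v(1)] by blast
    qed
    then show "A \<in> ball.basis_topology closure_of V_group T C"
      using A unfolding in_closure_of ball.topspace_basis_topology by blast
  qed
qed

section \<open>Topological simplicity\<close>

text \<open>
  Equality of the closures follows from density of the colour preserving group. For simplicity, a
  nontrivial element of a normal subgroup displaces some clopen set, so the subgroup contains the
  derived group of the colour preserving group; if it is closed, it contains the closure.
\<close>

theorem closure_derived_topologically_simple:
  fixes N defines "N \<equiv> ball.basis_topology closure_of (derived G (carrier G))"
  shows "N = ball.basis_topology closure_of (derived G (V_group T C))"
    and "topologically_simple (G\<lparr>carrier := N\<rparr>) (subtopology ball.basis_topology N)"
proof -
  let ?X = "ball.basis_topology"
  interpret vigorous_action G action ends clopens "V_group T C"
    by (rule vigorous)
  have VG: "V_group T C \<subseteq> carrier G"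
    by (rule subgroup.subset[OF subgroup_V_group])
  show NV: "N = ?X closure_of (derived G (V_group T C))"
    unfolding N_def by (rule closure_of_derived_dense[OF ball.topological_group_basis_topology VG V_group_dense])
  have N: "subgroup N G"
    unfolding N_def
    by (rule closure_of_subgroup[OF ball.topological_group_basis_topology derived_is_subgroup[OF subset_refl]])
  have closedN: "closedin ?X N"
    unfolding N_def by (rule closedin_closure_of)
  have DN: "derived G (V_group T C) \<subseteq> N"
    unfolding NV using derived_in_carrier[OF VG] ball.topspace_basis_topology
    by (intro closure_of_subset) simp
  have "K = N \<or> K = {\<one>\<^bsub>G\<^esub>}" if normal: "K \<lhd> G\<lparr>carrier := N\<rparr>" and closed: "closedin (subtopology ?X N) K" for K
  proof (rule disjCI)
    assume K1: "K \<noteq> {\<one>\<^bsub>G\<^esub>}"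
    have KN: "subgroup K (G\<lparr>carrier := N\<rparr>)"
      using normal by (rule normal_imp_subgroup)
    have K: "subgroup K G"
      by (rule incl_subgroup[OF N KN])
    obtain k where k: "k \<in> K" "k \<noteq> \<one>\<^bsub>G\<^esub>"
      using K1 subgroup.one_closed[OF K] by blast
    have kG: "k \<in> carrier G"
      using k(1) subgroup.subset[OF K] by blast
    have "action k \<noteq> id"
    proof
      assume "action k = id"
      then have "action k = action \<one>\<^bsub>G\<^esub>"
        by (simp add: act_one)
      then show False
        using act_inj kG k(2) by (auto simp: inj_on_def)
    qed
    then obtain U where U: "U \<in> clopens" "U \<noteq> {}" "action k ` U \<inter> U = {}"
      using ex_displaced_clopen action_patterned[OF kG] patterned_perms_tree_like by blast
    have "derived G (V_group T C) \<subseteq> K"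
    proof (rule derived_subset_if_normalized[OF K _ k(1) U])
      fix g h assume g: "g \<in> derived G (V_group T C)" and h: "h \<in> K"
      have gN: "g \<in> N"
        using g DN by blast
      have "g \<otimes>\<^bsub>G\<lparr>carrier := N\<rparr>\<^esub> h \<otimes>\<^bsub>G\<lparr>carrier := N\<rparr>\<^esub> inv\<^bsub>G\<lparr>carrier := N\<rparr>\<^esub> g \<in> K"
        using normal.inv_op_closed2[OF normal] gN h by simp
      then show "g \<otimes>\<^bsub>G\<^esub> h \<otimes>\<^bsub>G\<^esub> inv\<^bsub>G\<^esub> g \<in> K"
        using m_inv_consistent[OF N gN] by simp
    qed
    moreover have "closedin ?X K"
      using closed closedN by (rule closedin_trans_full)
    ultimately have "N \<subseteq> K"
      unfolding NV by (rule closure_of_minimal)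
    then show "K = N"
      using subgroup.subset[OF KN] by auto
  qed
  then show "topologically_simple (G\<lparr>carrier := N\<rparr>) (subtopology ?X N)"
    using topological_group_subgroup[OF ball.topological_group_basis_topology N]
    by (simp add: topologically_simple_def)
qed

end

theorem proposition4p6:
  fixes T :: "'v rooted_tree"
    and C :: "('v, 'l, 'c) colouring"
    and F :: "'l \<Rightarrow> ('c \<Rightarrow> 'c) set"
  assumes "locally_finite_tree T"
    and "colouring_structure T C"
    and "patterning T C F"
    and "\<exists>v \<in> tverts T - {troot T}. card (children T v) \<ge> 2"
  shows
    "let G = AAut_pat T C F; X = AAut_pat_topology T C F;
         N = X closure_of (derived G (carrier G))
     in N = X closure_of (derived G (V_group T C)) \<and>
        topologically_simple (G\<lparr>carrier := N\<rparr>) (subtopology X N)"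
proof -
  obtain b where b: "b \<in> tverts T - {troot T}" "2 \<le> card (children T b)"
    using assms(4) by blast
  interpret coloured_tree T C
    by (rule coloured_tree_if_branching_vertex[OF assms(1,2) b])
  interpret patterned_tree T C F
    by unfold_locales (rule assms(3))
  show ?thesis
    unfolding Let_def AAut_pat_topology_eq
    using closure_derived_topologically_simple by blast
qed

end
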